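(* Let $\beta\in(0,1)$ and $r>0$ be constants, and suppose that, for each $n$, $\epsilon=n^{-\beta}$ and $\theta\in\mathbb{R}^p$, $\eta\in\mathbb{R}^q$ (with $\theta,\eta,p,q$ allowed to depend on $n$) satisfy $\|\theta\|=\|\eta\|=\sqrt{r\log n}$. Let $$\beta^*(r)=\begin{cases}\frac12(1+3r), & 0<r\le\frac15,\\ \sqrt{1-(1-2r)_+^2}, & r>\frac15,\end{cases}$$ and let $\check\psi$ be the test defined in the context. If $\beta<\beta^*(r)$, then $\lim_{n\to\infty}R_n(\check\psi,\theta,\eta,\epsilon)=0$. Moreover, if $\beta>\beta^*(r)$, then $\liminf_{n\to\infty}R_n(\theta,\eta,\epsilon)>0$.
   Context: Model: for $z,\sigma\in\{-1,1\}^n$, $P^{(n)}_{(\theta,\eta,z,\sigma)}$ is the joint law of independent $X_i\sim N(z_i\theta,I_p)$, $Y_i\sim N(\sigma_i\eta,I_q)$, $i\in[n]$. Write $a\wedge b=\min(a,b)$, $a_+=\max(a,0)$, and $\ell(z,\sigma)=\big(\frac1n\sum_i\mathbf 1\{z_i\ne\sigma_i\}\big)\wedge\big(\frac1n\sum_i\mathbf 1\{z_i\ne-\sigma_i\}\big)$. For a test $\psi$ (measurable function of the data with values in $[0,1]$; $P\psi$ denotes expectation), the worst-case testing error for $H_0:\ell(z,\sigma)=0$ vs. $H_1:\ell(z,\sigma)>\epsilon$ is $$R_n(\psi,\theta,\eta,\epsilon)=\sup_{z,\sigma\in\{-1,1\}^n:\,\ell(z,\sigma)=0}P^{(n)}_{(\theta,\eta,z,\sigma)}\psi+\sup_{z,\sigma\in\{-1,1\}^n:\,\ell(z,\sigma)>\epsilon}P^{(n)}_{(\theta,\eta,z,\sigma)}(1-\psi),$$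 and $R_n(\theta,\eta,\epsilon)=\inf_\psi R_n(\psi,\theta,\eta,\epsilon)$. Test: let $\widetilde X_i=\theta^TX_i/\|\theta\|$, $\widetilde Y_i=\eta^TY_i/\|\eta\|$, and $S_{\|\theta\|}(t)=\mathbb P(|U|-|V|>t)$ where $U^2\sim\chi^2_1$ and $V^2\sim\chi^2_{1,2\|\theta\|^2}$ are independent ($\chi^2_{1,\lambda}$ is the noncentral chi-square law with one degree of freedom and noncentrality $\lambda$, i.e. the law of $N(\sqrt\lambda,1)^2$). Let $$\check T_n^-=\sup_{t\in\mathbb R}\frac{\left|\sum_{i=1}^n\mathbf 1\{|\widetilde X_i-\widetilde Y_i|-|\widetilde X_i+\widetilde Y_i|>\sqrt2t\}-nS_{\|\theta\|}(t)\right|}{\sqrt{nS_{\|\theta\|}(t)(1-S_{\|\theta\|}(t))}},$$ $$\check T_n^+=\sup_{t\in\mathbb R}\frac{\left|\sum_{i=1}^n\mathbf 1\{|\widetilde X_i+\widetilde Y_i|-|\widetilde X_i-\widetilde Y_i|>\sqrt2t\}-nS_{\|\theta\|}(t)\right|}{\sqrt{nS_{\|\theta\|}(t)(1-S_{\|\theta\|}(t))}},$$ and $\check\psi=\mathbf 1\{\check T_n^-\wedge\check T_n^+>\sqrt{2(1+\delta)\log\log n}\}$, with $\delta>0$ an arbitrary fixed constant. *)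

theory Defs
  imports "HOL-Probability.Probability"
begin

text \<open>
  The dimensions \<open>p\<close>, \<open>q\<close> and the sample size \<open>n\<close> vary inside the statement, so a vector of
  \<open>\<real>\<^sup>d\<close> is a function \<^typ>\<open>nat \<Rightarrow> real\<close> of which only the coordinates below \<open>d\<close> are used; its
  Euclidean norm is \<^const>\<open>L2_set\<close> over those coordinates.  The index set \<open>[n]\<close> is \<open>{..<n}\<close>.
\<close>

definition dot :: "nat \<Rightarrow> (nat \<Rightarrow> real) \<Rightarrow> (nat \<Rightarrow> real) \<Rightarrow> real" where
  "dot d x y = (\<Sum>j<d. x j * y j)"

definition euclid_norm :: "nat \<Rightarrow> (nat \<Rightarrow> real) \<Rightarrow> real" where
  "euclid_norm d x = L2_set x {..<d}"

definition normal_law :: "real \<Rightarrow> real measure" where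
  "normal_law m = density lborel (\<lambda>x. ennreal (normal_density m 1 x))"

text \<open>The law \<open>N(\<mu>, I\<^sub>d)\<close>: independent coordinates with unit variance.\<close>

definition normal_vec_law :: "nat \<Rightarrow> (nat \<Rightarrow> real) \<Rightarrow> (nat \<Rightarrow> real) measure" where
  "normal_vec_law d \<mu> = (\<Pi>\<^sub>M j\<in>{..<d}. normal_law (\<mu> j))"

type_synonym data = "(nat \<Rightarrow> nat \<Rightarrow> real) \<times> (nat \<Rightarrow> nat \<Rightarrow> real)"

definition sample_space :: "nat \<Rightarrow> nat \<Rightarrow> nat \<Rightarrow> data measure" where
  "sample_space n p q =
     (\<Pi>\<^sub>M i\<in>{..<n}. \<Pi>\<^sub>M j\<in>{..<p}. borel) \<Otimes>\<^sub>M (\<Pi>\<^sub>M i\<in>{..<n}. \<Pi>\<^sub>M j\<in>{..<q}. borel)"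

definition sample_law ::
  "nat \<Rightarrow> nat \<Rightarrow> nat \<Rightarrow> (nat \<Rightarrow> real) \<Rightarrow> (nat \<Rightarrow> real) \<Rightarrow> (nat \<Rightarrow> real) \<Rightarrow> (nat \<Rightarrow> real) \<Rightarrow> data measure" where
  "sample_law n p q \<theta> \<eta> z \<sigma> =
     (\<Pi>\<^sub>M i\<in>{..<n}. normal_vec_law p (\<lambda>j. z i * \<theta> j)) \<Otimes>\<^sub>M
     (\<Pi>\<^sub>M i\<in>{..<n}. normal_vec_law q (\<lambda>j. \<sigma> i * \<eta> j))"

definition sign_vectors :: "nat \<Rightarrow> (nat \<Rightarrow> real) set" where
  "sign_vectors n = {..<n} \<rightarrow>\<^sub>E {-1, 1}"

definition ell :: "nat \<Rightarrow> (nat \<Rightarrow> real) \<Rightarrow> (nat \<Rightarrow> real) \<Rightarrow> real" where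
  "ell n z \<sigma> = min (real (card {i\<in>{..<n}. z i \<noteq> \<sigma> i}) / real n)
                   (real (card {i\<in>{..<n}. z i \<noteq> - \<sigma> i}) / real n)"

definition tests :: "nat \<Rightarrow> nat \<Rightarrow> nat \<Rightarrow> (data \<Rightarrow> real) set" where
  "tests n p q = {\<psi> \<in> borel_measurable (sample_space n p q).
                    \<forall>x\<in>space (sample_space n p q). 0 \<le> \<psi> x \<and> \<psi> x \<le> 1}"

text \<open>
  The errors take values in \<^typ>\<open>ennreal\<close>, so that the supremum over an alternative that happens
  to be empty (which can only occur for small \<open>n\<close>) is \<open>0\<close>.
\<close>

definition test_error ::
  "nat \<Rightarrow> nat \<Rightarrow> nat \<Rightarrow> (data \<Rightarrow> real) \<Rightarrow> (nat \<Rightarrow> real) \<Rightarrow> (nat \<Rightarrow> real) \<Rightarrow> real \<Rightarrow> ennreal" where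
  "test_error n p q \<psi> \<theta> \<eta> \<epsilon> =
     (SUP (z, \<sigma>) \<in> {(z, \<sigma>) \<in> sign_vectors n \<times> sign_vectors n. ell n z \<sigma> = 0}.
        \<integral>\<^sup>+ x. ennreal (\<psi> x) \<partial>sample_law n p q \<theta> \<eta> z \<sigma>) +
     (SUP (z, \<sigma>) \<in> {(z, \<sigma>) \<in> sign_vectors n \<times> sign_vectors n. ell n z \<sigma> > \<epsilon>}.
        \<integral>\<^sup>+ x. ennreal (1 - \<psi> x) \<partial>sample_law n p q \<theta> \<eta> z \<sigma>)"

definition minimax_error ::
  "nat \<Rightarrow> nat \<Rightarrow> nat \<Rightarrow> (nat \<Rightarrow> real) \<Rightarrow> (nat \<Rightarrow> real) \<Rightarrow> real \<Rightarrow> ennreal" where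
  "minimax_error n p q \<theta> \<eta> \<epsilon> = (INF \<psi> \<in> tests n p q. test_error n p q \<psi> \<theta> \<eta> \<epsilon>)"

text \<open>
  The noncentral chi-square law with one degree of freedom and noncentrality \<open>l\<close>; the case
  \<open>l = 0\<close> is the central law.
\<close>

definition chi_square_1 :: "real \<Rightarrow> real measure" where
  "chi_square_1 l = distr (normal_law (sqrt l)) borel (\<lambda>x. x ^ 2)"

text \<open>The pair \<open>(a, b)\<close> stands for \<open>(U\<^sup>2, V\<^sup>2)\<close>, so that \<open>|U| - |V|\<close> is \<open>sqrt a - sqrt b\<close>.\<close>

definition S_fun :: "real \<Rightarrow> real \<Rightarrow> real" where
  "S_fun s t = measure (chi_square_1 0 \<Otimes>\<^sub>M chi_square_1 (2 * s ^ 2))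
                 {(a, b). sqrt a - sqrt b > t}"

definition sup_stat :: "nat \<Rightarrow> real \<Rightarrow> (nat \<Rightarrow> real) \<Rightarrow> ereal" where
  "sup_stat n s D =
     (SUP t::real. ereal (\<bar>real (card {i\<in>{..<n}. D i > sqrt 2 * t}) - real n * S_fun s t\<bar> /
                          sqrt (real n * S_fun s t * (1 - S_fun s t))))"

definition proj :: "nat \<Rightarrow> (nat \<Rightarrow> real) \<Rightarrow> (nat \<Rightarrow> real) \<Rightarrow> real" where
  "proj d \<theta> x = dot d \<theta> x / euclid_norm d \<theta>"

definition T_minus :: "nat \<Rightarrow> nat \<Rightarrow> nat \<Rightarrow> (nat \<Rightarrow> real) \<Rightarrow> (nat \<Rightarrow> real) \<Rightarrow> data \<Rightarrow> ereal" where
  "T_minus n p q \<theta> \<eta> = (\<lambda>(X, Y). sup_stat n (euclid_norm p \<theta>)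
     (\<lambda>i. \<bar>proj p \<theta> (X i) - proj q \<eta> (Y i)\<bar> - \<bar>proj p \<theta> (X i) + proj q \<eta> (Y i)\<bar>))"

definition T_plus :: "nat \<Rightarrow> nat \<Rightarrow> nat \<Rightarrow> (nat \<Rightarrow> real) \<Rightarrow> (nat \<Rightarrow> real) \<Rightarrow> data \<Rightarrow> ereal" where
  "T_plus n p q \<theta> \<eta> = (\<lambda>(X, Y). sup_stat n (euclid_norm p \<theta>)
     (\<lambda>i. \<bar>proj p \<theta> (X i) + proj q \<eta> (Y i)\<bar> - \<bar>proj p \<theta> (X i) - proj q \<eta> (Y i)\<bar>))"

definition psi_check ::
  "real \<Rightarrow> nat \<Rightarrow> nat \<Rightarrow> nat \<Rightarrow> (nat \<Rightarrow> real) \<Rightarrow> (nat \<Rightarrow> real) \<Rightarrow> data \<Rightarrow> real" where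
  "psi_check \<delta> n p q \<theta> \<eta> x =
     of_bool (min (T_minus n p q \<theta> \<eta> x) (T_plus n p q \<theta> \<eta> x)
              > ereal (sqrt (2 * (1 + \<delta>) * ln (ln (real n)))))"

definition beta_star :: "real \<Rightarrow> real" where
  "beta_star r = (if r \<le> 1 / 5 then (1 + 3 * r) / 2 else sqrt (1 - (max (1 - 2 * r) 0) ^ 2))"

end

theory Submission
  imports Defs "HOL-Real_Asymp.Real_Asymp"
begin

text \<open>
  Upper bound.  After a rotation, the scores \<open>(|X - Y| - |X + Y|) / \<surd>2\<close> are independent with law
  \<open>null_law\<close> where the signs agree and with its mirror image \<open>alt_law\<close> where they differ.  Under the
  null the normalised empirical process has to stay below \<open>\<surd>(2 (1 + \<delta>) log log n)\<close> with probability
  tending to one.  After a transformation to the uniform law, \<open>(N(u) - n u) / (1 - u)\<close> is a martingale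
  in \<open>u\<close>, so the exponential maximal inequality applies on geometric blocks of \<open>u\<close>; \<open>O(log n)\<close> blocks
  cost \<open>(log n)\<^bsup>-(1 + \<delta>/2)\<^esup>\<close> each, and those with \<open>n u = O(log log n)\<close> a vanishing
  geometric sum.
  Under the alternative a single level \<open>t = a \<surd>(2 log n)\<close> suffices, with \<open>a = 2 \<surd>r\<close>, \<open>\<surd>(1 - r)\<close> or
  \<open>\<surd>r\<close> according to the range of \<open>r\<close>.

  Lower bound.  With uniform signs \<open>z\<close> and independent flips of probability \<open>4\<epsilon>\<close>, the testing problem
  becomes one between two product laws, and the affinity defect of one coordinate is at most
  \<open>(4\<epsilon>)\<^bsup>w\<^esup> (1 + 2 n\<^bsup>r (w\<^sup>2 - 1)\<^esup>)\<close> for every \<open>w\<close> in \<open>[1, 2]\<close>; minimising over \<open>w\<close> makes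
  this \<open>o(1/n)\<close> exactly above the boundary.
\<close>

text \<open>Why the two bounds meet: at level a * sqrt (2 log n) the null tail is about n^-(a^2 + r)
  and the mirrored tail about n^-(a - sqrt r)^2. Detection asks that flipped exceedances be numerous
  and outweigh the square root of the number of null exceedances, up to log log n factors; this
  fixes a. In the lower bound a second-moment argument (w = 2) is sharp only for r up to 1/5. Beyond
  that, rare large values of the likelihood ratio dominate its variance, so a moment of order w < 2
  of its deviation from 1 takes over; the best w is a / sqrt r for the same a.

  Two obstacles shape the upper bound. Dividing by 1 - u creates the martingale but degenerates at u
  = 1, so levels up to 1/2 are treated directly and the others by reflection. The statistics are
  suprema over a continuum of levels, so each bad event is enclosed in a measurable exceptional set
  B of small probability, and monotonicity of the integral bounds the errors.\<close>

lemma emeasure_distr_nn_integral: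
  assumes "f \<in> measurable M N" "A \<in> sets N"
  shows "emeasure (distr M N f) A = (\<integral>\<^sup>+x. indicator A (f x) \<partial>M)"
proof -
  have "emeasure (distr M N f) A = (\<integral>\<^sup>+x. indicator A x \<partial>distr M N f)" using assms by simp
  also have "\<dots> = (\<integral>\<^sup>+x. indicator A (f x) \<partial>M)" using assms by (subst nn_integral_distr) auto
  finally show ?thesis .
qed

section \<open>Products of pairs of laws, their images and densities\<close>

lemma nn_integral_pair_PiM_prod:
  fixes M :: "nat \<Rightarrow> 'a measure" and N :: "nat \<Rightarrow> 'b measure"
  assumes "finite I" "\<And>i. prob_space (M i)" "\<And>i. prob_space (N i)"
    and f: "\<And>i. i \<in> I \<Longrightarrow> f i \<in> borel_measurable (M i \<Otimes>\<^sub>M N i)"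
  shows "(\<integral>\<^sup>+\<omega>. (\<Prod>i\<in>I. f i (fst \<omega> i, snd \<omega> i)) \<partial>(PiM I M \<Otimes>\<^sub>M PiM I N)) =
         (\<Prod>i\<in>I. integral\<^sup>N (M i \<Otimes>\<^sub>M N i) (f i))"
proof -
  interpret M: product_prob_space M by (intro product_prob_spaceI assms)
  interpret N: product_prob_space N by (intro product_prob_spaceI assms)
  have PN: "sigma_finite_measure (PiM I N)"
    by (intro prob_space_imp_sigma_finite prob_space_PiM assms)
  note f[measurable]
  have m[measurable]: "(\<lambda>\<omega>. f i (fst \<omega> i, snd \<omega> i)) \<in> borel_measurable (PiM I M \<Otimes>\<^sub>M PiM I N)" if "i \<in> I" for i
    using that by measurable
  have "(\<integral>\<^sup>+\<omega>. (\<Prod>i\<in>I. f i (fst \<omega> i, snd \<omega> i)) \<partial>(PiM I M \<Otimes>\<^sub>M PiM I N)) =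
        (\<integral>\<^sup>+x. \<integral>\<^sup>+y. (\<Prod>i\<in>I. f i (x i, y i)) \<partial>PiM I N \<partial>PiM I M)"
    by (subst sigma_finite_measure.nn_integral_fst[OF PN, symmetric]) (auto intro!: borel_measurable_prod_ennreal)
  also have "\<dots> = (\<integral>\<^sup>+x. (\<Prod>i\<in>I. \<integral>\<^sup>+y. f i (x i, y) \<partial>N i) \<partial>PiM I M)"
  proof (rule nn_integral_cong)
    fix x assume "x \<in> space (PiM I M)"
    then have "\<And>i. i \<in> I \<Longrightarrow> x i \<in> space (M i)" by (auto simp: space_PiM)
    then show "(\<integral>\<^sup>+y. (\<Prod>i\<in>I. f i (x i, y i)) \<partial>PiM I N) = (\<Prod>i\<in>I. \<integral>\<^sup>+y. f i (x i, y) \<partial>N i)"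
      by (intro N.product_nn_integral_prod assms(1)) measurable
  qed
  also have "\<dots> = (\<Prod>i\<in>I. \<integral>\<^sup>+x. \<integral>\<^sup>+y. f i (x, y) \<partial>N i \<partial>M i)"
    using f prob_space_imp_sigma_finite[OF assms(3)]
    by (intro M.product_nn_integral_prod assms(1) sigma_finite_measure.borel_measurable_nn_integral) auto
  also have "\<dots> = (\<Prod>i\<in>I. integral\<^sup>N (M i \<Otimes>\<^sub>M N i) (f i))"
  proof (rule prod.cong[OF refl])
    fix i assume "i \<in> I"
    have Ni: "sigma_finite_measure (N i)" by (intro prob_space_imp_sigma_finite assms)
    show "(\<integral>\<^sup>+x. \<integral>\<^sup>+y. f i (x, y) \<partial>N i \<partial>M i) = integral\<^sup>N (M i \<Otimes>\<^sub>M N i) (f i)"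
      using \<open>i \<in> I\<close> by (intro sigma_finite_measure.nn_integral_fst[OF Ni] f)
  qed
  finally show ?thesis .
qed

lemma indicator_PiE_prod:
  fixes x :: "nat \<Rightarrow> 'a"
  assumes "finite I" "x \<in> extensional I"
  shows "indicator (PiE I A) x = (\<Prod>i\<in>I. indicator (A i) (x i) :: ennreal)"
proof (cases "x \<in> PiE I A")
  case True then show ?thesis by (auto simp: PiE_iff indicator_def intro!: prod.neutral[symmetric])
next
  case False
  then obtain i where "i \<in> I" "x i \<notin> A i" using assms(2) by (auto simp: PiE_iff)
  then have "(\<Prod>i\<in>I. indicator (A i) (x i) :: ennreal) = 0" using assms(1) by (auto simp: indicator_def)
  with False show ?thesis by simp
qed

text \<open>The two samples form a product of products, while a score pairs the i-th entries of
  both. Boxes generate the target, and on a box the integrand factors over i. Each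
  \<open>L i\<close> is both target sigma-algebra and image law, so the law may change from one
  coordinate to the next.\<close>

lemma distr_pair_PiM:
  fixes M :: "nat \<Rightarrow> 'a measure" and N :: "nat \<Rightarrow> 'b measure" and L :: "nat \<Rightarrow> 'c measure"
  assumes "finite I" "\<And>i. prob_space (M i)" "\<And>i. prob_space (N i)" "\<And>i. prob_space (L i)"
    and h: "\<And>i. i \<in> I \<Longrightarrow> h i \<in> measurable (M i \<Otimes>\<^sub>M N i) (L i)"
    and L: "\<And>i. i \<in> I \<Longrightarrow> distr (M i \<Otimes>\<^sub>M N i) (L i) (h i) = L i"
  shows "distr (PiM I M \<Otimes>\<^sub>M PiM I N) (PiM I L) (\<lambda>\<omega>. \<lambda>i\<in>I. h i (fst \<omega> i, snd \<omega> i)) = PiM I L"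
proof -
  interpret L: product_prob_space L by (intro product_prob_spaceI assms)
  note h[measurable]
  have m[measurable]: "(\<lambda>\<omega>. \<lambda>i\<in>I. h i (fst \<omega> i, snd \<omega> i)) \<in> measurable (PiM I M \<Otimes>\<^sub>M PiM I N) (PiM I L)"
    by (rule measurable_restrict) measurable
  show ?thesis
  proof (rule L.PiM_eqI[OF assms(1)])
    fix A assume A[measurable]: "\<And>i. i \<in> I \<Longrightarrow> A i \<in> sets (L i)"
    have "emeasure (distr (PiM I M \<Otimes>\<^sub>M PiM I N) (PiM I L) (\<lambda>\<omega>. \<lambda>i\<in>I. h i (fst \<omega> i, snd \<omega> i))) (PiE I A)
      = (\<integral>\<^sup>+\<omega>. indicator (PiE I A) (\<lambda>i\<in>I. h i (fst \<omega> i, snd \<omega> i)) \<partial>(PiM I M \<Otimes>\<^sub>M PiM I N))"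
      using assms(1) A by (intro emeasure_distr_nn_integral m sets_PiM_I_finite) auto
    also have "\<dots> = (\<integral>\<^sup>+\<omega>. (\<Prod>i\<in>I. indicator (A i) (h i (fst \<omega> i, snd \<omega> i))) \<partial>(PiM I M \<Otimes>\<^sub>M PiM I N))"
      by (subst indicator_PiE_prod[OF assms(1)]) auto
    also have "\<dots> = (\<Prod>i\<in>I. \<integral>\<^sup>+\<omega>. indicator (A i) (h i \<omega>) \<partial>(M i \<Otimes>\<^sub>M N i))"
      by (rule nn_integral_pair_PiM_prod[OF assms(1-3), where f="\<lambda>i \<omega>. indicator (A i) (h i \<omega>)"]) measurable
    also have "\<dots> = (\<Prod>i\<in>I. emeasure (L i) (A i))"
    proof (rule prod.cong[OF refl])
      fix i assume i: "i \<in> I"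
      show "(\<integral>\<^sup>+\<omega>. indicator (A i) (h i \<omega>) \<partial>(M i \<Otimes>\<^sub>M N i)) = emeasure (L i) (A i)"
        using emeasure_distr_nn_integral[OF h[OF i] A[OF i]] L[OF i] by simp
    qed
    finally show "emeasure (distr (PiM I M \<Otimes>\<^sub>M PiM I N) (PiM I L) (\<lambda>\<omega>. \<lambda>i\<in>I. h i (fst \<omega> i, snd \<omega> i))) (PiE I A) = (\<Prod>i\<in>I. emeasure (L i) (A i))" .
  qed simp
qed

text \<open>Serves to pull exceptional sets back: a bad set built for a transformed sample becomes a
  set of the same probability for the original one.\<close>

lemma PiM_image:
  fixes \<nu> :: "'a measure" and \<mu> :: "'b measure" and I :: "nat set"
  assumes "finite I" "prob_space \<nu>" "prob_space \<mu>" and g: "g \<in> measurable \<nu> \<mu>" and d: "distr \<nu> \<mu> g = \<mu>"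
  shows "(\<lambda>\<omega>. \<lambda>i\<in>I. g (\<omega> i)) \<in> measurable (\<Pi>\<^sub>M i\<in>I. \<nu>) (\<Pi>\<^sub>M i\<in>I. \<mu>)"
    and "B \<in> sets (\<Pi>\<^sub>M i\<in>I. \<mu>) \<Longrightarrow> emeasure (\<Pi>\<^sub>M i\<in>I. \<nu>) ((\<lambda>\<omega>. \<lambda>i\<in>I. g (\<omega> i)) -` B \<inter> space (\<Pi>\<^sub>M i\<in>I. \<nu>)) =
      emeasure (\<Pi>\<^sub>M i\<in>I. \<mu>) B"
proof -
  let ?f = "\<lambda>\<omega>. \<lambda>i\<in>I. g (\<omega> i)"
  show m: "?f \<in> measurable (\<Pi>\<^sub>M i\<in>I. \<nu>) (\<Pi>\<^sub>M i\<in>I. \<mu>)"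
    by (rule measurable_restrict, rule measurable_compose[OF _ g], rule measurable_component_singleton)
  have "distr (\<Pi>\<^sub>M i\<in>I. \<nu>) (\<Pi>\<^sub>M i\<in>I. \<mu>) ?f = distr (\<Pi>\<^sub>M i\<in>I. \<nu>) (\<Pi>\<^sub>M i\<in>I. \<mu>) (compose I g)"
    by (intro distr_cong refl) (simp add: compose_def)
  also have "\<dots> = (\<Pi>\<^sub>M i\<in>I. \<mu>)"
    using distr_PiM_finite_prob_space'[OF assms(1), of "\<lambda>_. \<nu>" "\<lambda>_. \<mu>" g] assms by simp
  finally have "distr (\<Pi>\<^sub>M i\<in>I. \<nu>) (\<Pi>\<^sub>M i\<in>I. \<mu>) ?f = (\<Pi>\<^sub>M i\<in>I. \<mu>)" .
  then show "emeasure (\<Pi>\<^sub>M i\<in>I. \<nu>) (?f -` B \<inter> space (\<Pi>\<^sub>M i\<in>I. \<nu>)) = emeasure (\<Pi>\<^sub>M i\<in>I. \<mu>) B" if "B \<in> sets (\<Pi>\<^sub>M i\<in>I. \<mu>)"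
    using emeasure_distr[OF m that] by simp
qed

lemma PiM_density:
  fixes M :: "nat \<Rightarrow> 'a measure"
  assumes "finite I" "\<And>i. prob_space (M i)" "\<And>i. prob_space (density (M i) (f i))"
    and f: "\<And>i. i \<in> I \<Longrightarrow> f i \<in> borel_measurable (M i)"
  shows "PiM I (\<lambda>i. density (M i) (f i)) = density (PiM I M) (\<lambda>x. \<Prod>i\<in>I. f i (x i))"
proof -
  interpret M: product_prob_space M by (intro product_prob_spaceI assms)
  interpret D: product_prob_space "\<lambda>i. density (M i) (f i)" by (intro product_prob_spaceI assms)
  note f[measurable]
  show ?thesis
  proof (rule D.PiM_eqI[OF assms(1), symmetric])
    fix A assume A: "\<And>i. i \<in> I \<Longrightarrow> A i \<in> sets (density (M i) (f i))"
    then have A'[measurable]: "\<And>i. i \<in> I \<Longrightarrow> A i \<in> sets (M i)" by simp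
    have "emeasure (density (PiM I M) (\<lambda>x. \<Prod>i\<in>I. f i (x i))) (PiE I A) =
        (\<integral>\<^sup>+x. (\<Prod>i\<in>I. f i (x i)) * indicator (PiE I A) x \<partial>PiM I M)"
      using assms(1) A by (intro emeasure_density) (auto intro!: sets_PiM_I_finite borel_measurable_prod_ennreal)
    also have "\<dots> = (\<integral>\<^sup>+x. (\<Prod>i\<in>I. f i (x i) * indicator (A i) (x i)) \<partial>PiM I M)"
      by (intro nn_integral_cong) (auto simp: space_PiM PiE_iff prod.distrib indicator_PiE_prod[OF assms(1)])
    also have "\<dots> = (\<Prod>i\<in>I. \<integral>\<^sup>+x. f i x * indicator (A i) x \<partial>M i)"
      by (intro M.product_nn_integral_prod assms(1)) measurable
    also have "\<dots> = (\<Prod>i\<in>I. emeasure (density (M i) (f i)) (A i))"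
      by (intro prod.cong refl) (simp add: emeasure_density)
    finally show "emeasure (density (PiM I M) (\<lambda>x. \<Prod>i\<in>I. f i (x i))) (PiE I A) =
      (\<Prod>i\<in>I. emeasure (density (M i) (f i)) (A i))" .
  qed (auto intro!: sets_PiM_cong)
qed

subsection \<open>Gaussian laws\<close>

lemma prob_space_normal_law [simp, intro]: "prob_space (normal_law m)"
  unfolding normal_law_def by (rule prob_space_normal_density) simp

lemma sets_normal_law [simp, measurable_cong]: "sets (normal_law m) = sets borel"
  and space_normal_law [simp]: "space (normal_law m) = UNIV"
  by (auto simp: normal_law_def)

lemma prob_space_normal_vec_law [simp, intro]: "prob_space (normal_vec_law d \<mu>)"
  unfolding normal_vec_law_def by (intro prob_space_PiM) simp

lemma sets_normal_vec_law [simp, measurable_cong]: "sets (normal_vec_law d \<mu>) = sets (\<Pi>\<^sub>M j\<in>{..<d}. borel)"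
  unfolding normal_vec_law_def by (intro sets_PiM_cong) auto

lemma normal_law_tilt: "normal_law m = density (normal_law 0) (\<lambda>x. ennreal (exp (m * x - m\<^sup>2 / 2)))"
  unfolding normal_law_def
  by (subst density_density_eq)
     (auto intro!: density_cong simp: normal_density_def ennreal_mult[symmetric] exp_add[symmetric] power2_eq_square field_simps)

text \<open>The tilted density of \<open>normal_law_tilt\<close> has total mass one; solving this
  identity for the integral gives the moment generating function.\<close>

lemma normal_law_mgf: "(\<integral>\<^sup>+x. ennreal (exp (m * x)) \<partial>normal_law 0) = ennreal (exp (m\<^sup>2 / 2))"
proof -
  interpret prob_space "normal_law m" by simp
  have "1 = emeasure (normal_law m) UNIV" using emeasure_space_1 by simp
  also have "\<dots> = (\<integral>\<^sup>+x. ennreal (exp (m * x - m\<^sup>2 / 2)) \<partial>normal_law 0)"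
    by (subst normal_law_tilt) (simp add: emeasure_density)
  also have "\<dots> = (\<integral>\<^sup>+x. ennreal (exp (- (m\<^sup>2 / 2))) * ennreal (exp (m * x)) \<partial>normal_law 0)"
    by (intro nn_integral_cong) (simp add: ennreal_mult[symmetric] exp_add[symmetric])
  also have "\<dots> = ennreal (exp (- (m\<^sup>2 / 2))) * (\<integral>\<^sup>+x. ennreal (exp (m * x)) \<partial>normal_law 0)"
    by (intro nn_integral_cmult) measurable
  finally have *: "ennreal (exp (- (m\<^sup>2 / 2))) * (\<integral>\<^sup>+x. ennreal (exp (m * x)) \<partial>normal_law 0) = 1" by simp
  have "(\<integral>\<^sup>+x. ennreal (exp (m * x)) \<partial>normal_law 0) =
    ennreal (exp (m\<^sup>2 / 2)) * ennreal (exp (- (m\<^sup>2 / 2))) * (\<integral>\<^sup>+x. ennreal (exp (m * x)) \<partial>normal_law 0)"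
    by (simp add: ennreal_mult[symmetric] exp_add[symmetric])
  also have "\<dots> = ennreal (exp (m\<^sup>2 / 2))" using * by (simp add: mult.assoc)
  finally show ?thesis .
qed

lemma normal_law_uminus: "distr (normal_law m) borel uminus = normal_law (- m)"
proof -
  interpret prob_space "normal_law m" by simp
  have "distributed (normal_law m) lborel (\<lambda>x. x) (normal_density m 1)"
    unfolding distributed_def normal_law_def by (auto intro!: distr_id2[symmetric] simp: distr_id2)
  from normal_density_affine[OF this, of "-1" 0]
  have "distributed (normal_law m) lborel (\<lambda>x. - x) (normal_density (- m) 1)" by simp
  then show ?thesis by (simp add: distributed_def normal_law_def cong: distr_cong)
qed

text \<open>The projection on the direction of \<theta> is a sum of independent normals whose
  variances (\<theta> j / s)^2 add up to one. The factor c is a sign, or 0 for the reference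
  law.\<close>

lemma dot_law:
  assumes "euclid_norm d \<theta> > 0"
  shows "distr (normal_vec_law d (\<lambda>j. c * \<theta> j)) borel (proj d \<theta>) = normal_law (c * euclid_norm d \<theta>)"
proof -
  let ?P = "normal_vec_law d (\<lambda>j. c * \<theta> j)"
  interpret prob_space ?P by simp
  define s where "s = euclid_norm d \<theta>"
  have s: "s > 0" "s\<^sup>2 = (\<Sum>j<d. (\<theta> j)\<^sup>2)"
    using assms by (auto simp: s_def euclid_norm_def L2_set_def sum_nonneg)
  \<comment> \<open>A coordinate with \<theta> j = 0 would contribute a normal of variance 0, which
    has no density; such coordinates are dropped before adding.\<close>
  define I where "I = {j\<in>{..<d}. \<theta> j \<noteq> 0}"
  have sI: "s\<^sup>2 = (\<Sum>j\<in>I. (\<theta> j)\<^sup>2)" unfolding s(2) I_def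
    by (intro sum.mono_neutral_right) auto
  have "finite I" by (simp add: I_def)
  have "I \<noteq> {}" using sI s(1) by auto
  have coord: "distr ?P borel (\<lambda>x. x j) = normal_law (c * \<theta> j)" if "j < d" for j
  proof -
    have "distr ?P (normal_law (c * \<theta> j)) (\<lambda>x. x j) = normal_law (c * \<theta> j)"
      unfolding normal_vec_law_def using that by (intro distr_PiM_component) auto
    then show ?thesis by (metis distr_cong sets_normal_law)
  qed
  have rv: "(\<lambda>x. x j) \<in> borel_measurable ?P" if "j < d" for j
    using that by (subst measurable_cong_sets[OF sets_normal_vec_law refl]) simp
  have ind: "indep_vars (\<lambda>_. borel) (\<lambda>j x. x j) {..<d}"
  proof (subst indep_vars_iff_distr_eq_PiM')
    show "distr ?P (\<Pi>\<^sub>M i\<in>{..<d}. borel) (\<lambda>x. \<lambda>i\<in>{..<d}. x i) = (\<Pi>\<^sub>M i\<in>{..<d}. distr ?P borel (\<lambda>x. x i))"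
    proof -
      have "distr ?P (\<Pi>\<^sub>M i\<in>{..<d}. borel) (\<lambda>x. \<lambda>i\<in>{..<d}. x i) = distr ?P ?P (\<lambda>x. x)"
        by (intro distr_cong refl sets_normal_vec_law[symmetric])
           (auto simp: normal_vec_law_def space_PiM PiE_iff extensional_restrict)
      also have "\<dots> = (\<Pi>\<^sub>M i\<in>{..<d}. distr ?P borel (\<lambda>x. x i))"
        using coord by (auto simp: normal_vec_law_def intro!: PiM_cong)
      finally show ?thesis .
    qed
  qed (use \<open>finite I\<close> \<open>I \<noteq> {}\<close> rv in \<open>auto simp: I_def\<close>)
  have "indep_vars (\<lambda>_. borel) (\<lambda>j. (\<lambda>x. \<theta> j / s * x) \<circ> (\<lambda>x. x j)) I"
    by (rule indep_vars_compose[OF indep_vars_subset[OF ind]]) (auto simp: I_def)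
  then have ind': "indep_vars (\<lambda>_. borel) (\<lambda>j x. \<theta> j / s * x j) I" by (simp add: comp_def)
  have dj: "distributed ?P lborel (\<lambda>x. \<theta> j / s * x j) (normal_density (c * (\<theta> j)\<^sup>2 / s) \<bar>\<theta> j / s\<bar>)" if "j \<in> I" for j
  proof -
    have jd: "j < d" "\<theta> j \<noteq> 0" using that by (auto simp: I_def)
    have "distributed ?P lborel (\<lambda>x. x j) (normal_density (c * \<theta> j) 1)"
      unfolding distributed_def using coord[OF jd(1)] rv[OF jd(1)]
      by (auto simp: normal_law_def cong: distr_cong)
    from normal_density_affine[OF this, of "\<theta> j / s" 0] jd s(1)
    show ?thesis by (simp add: power2_eq_square field_simps)
  qed
  have "distributed ?P lborel (\<lambda>x. \<Sum>j\<in>I. \<theta> j / s * x j)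
     (normal_density (\<Sum>j\<in>I. c * (\<theta> j)\<^sup>2 / s) (sqrt (\<Sum>j\<in>I. \<bar>\<theta> j / s\<bar>\<^sup>2)))"
    using s(1) by (intro sum_indep_normal \<open>finite I\<close> \<open>I \<noteq> {}\<close> ind' dj) (auto simp: I_def)
  also have "(\<Sum>j\<in>I. c * (\<theta> j)\<^sup>2 / s) = c * s"
    using s(1) by (simp only: sum_divide_distrib[symmetric] sum_distrib_left[symmetric] sI[symmetric]) (simp add: power2_eq_square)
  also have "(\<Sum>j\<in>I. \<bar>\<theta> j / s\<bar>\<^sup>2) = 1"
    using s(1) by (simp add: power_divide sum_divide_distrib[symmetric] sI[symmetric])
  also have "(\<lambda>x. \<Sum>j\<in>I. \<theta> j / s * x j) = proj d \<theta>"
  proof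
    fix x :: "nat \<Rightarrow> real"
    have "(\<Sum>j\<in>I. \<theta> j / s * x j) = (\<Sum>j<d. \<theta> j / s * x j)"
      unfolding I_def by (intro sum.mono_neutral_left) auto
    then show "(\<Sum>j\<in>I. \<theta> j / s * x j) = proj d \<theta> x"
      by (simp add: proj_def dot_def s_def sum_divide_distrib)
  qed
  finally show ?thesis unfolding distributed_def by (simp add: normal_law_def s_def cong: distr_cong)
qed

lemma nn_integral_normal_pair:
  assumes [measurable]: "F \<in> borel_measurable (borel \<Otimes>\<^sub>M borel)"
  shows "(\<integral>\<^sup>+\<omega>. F \<omega> \<partial>(normal_law a \<Otimes>\<^sub>M normal_law b)) =
    (\<integral>\<^sup>+x. \<integral>\<^sup>+y. ennreal (normal_density a 1 x * normal_density b 1 y) * F (x, y) \<partial>lborel \<partial>lborel)"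
proof -
  interpret nb: prob_space "normal_law b" by simp
  have "(\<integral>\<^sup>+\<omega>. F \<omega> \<partial>(normal_law a \<Otimes>\<^sub>M normal_law b)) = (\<integral>\<^sup>+x. \<integral>\<^sup>+y. F (x, y) \<partial>normal_law b \<partial>normal_law a)"
    by (subst nb.nn_integral_fst) auto
  also have "\<dots> = (\<integral>\<^sup>+x. ennreal (normal_density a 1 x) * (\<integral>\<^sup>+y. ennreal (normal_density b 1 y) * F (x, y) \<partial>lborel) \<partial>lborel)"
    unfolding normal_law_def by (simp add: nn_integral_density)
  also have "\<dots> = (\<integral>\<^sup>+x. \<integral>\<^sup>+y. ennreal (normal_density a 1 x * normal_density b 1 y) * F (x, y) \<partial>lborel \<partial>lborel)"
    by (simp add: nn_integral_cmult[symmetric] ennreal_mult' mult.assoc)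
  finally show ?thesis .
qed

text \<open>Two affine substitutions around one exchange of integrals: for fixed x the variable y
  becomes x - c * u, and for fixed u the variable x becomes (u + v) / c, with c = sqrt 2. The
  Jacobians c and 1 / c cancel.\<close>

lemma normal_law_rotation:
  "distr (normal_law a \<Otimes>\<^sub>M normal_law b) (borel \<Otimes>\<^sub>M borel) (\<lambda>(x, y). ((x - y) / sqrt 2, (x + y) / sqrt 2)) =
   normal_law ((a - b) / sqrt 2) \<Otimes>\<^sub>M normal_law ((a + b) / sqrt 2)" (is "?L = ?R")
proof (rule measure_eqI)
  show "sets ?L = sets ?R" by (simp cong: sets_pair_measure_cong)
  fix A assume "A \<in> sets ?L"
  then have A[measurable]: "A \<in> sets (borel \<Otimes>\<^sub>M borel)" by simp
  define c where "c = sqrt (2::real)"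
  have c: "c > 0" "c * c = 2" by (auto simp: c_def)
  let ?F = "\<lambda>(x, y). indicator A ((x - y) / c, (x + y) / c) :: ennreal"
  let ?h = "\<lambda>x y. ennreal (normal_density a 1 x * normal_density b 1 y)"
  have "emeasure ?L A = (\<integral>\<^sup>+\<omega>. ?F \<omega> \<partial>(normal_law a \<Otimes>\<^sub>M normal_law b))"
    unfolding c_def by (subst emeasure_distr_nn_integral) (auto simp: split_beta')
  also have "\<dots> = (\<integral>\<^sup>+x. \<integral>\<^sup>+y. ?h x y * ?F (x, y) \<partial>lborel \<partial>lborel)"
    by (rule nn_integral_normal_pair) measurable
  also have "\<dots> = (\<integral>\<^sup>+x. \<integral>\<^sup>+u. ennreal c * (?h x (x - c * u) * indicator A (u, (2 * x - c * u) / c)) \<partial>lborel \<partial>lborel)"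
  proof (rule nn_integral_cong)
    fix x
    have "(\<integral>\<^sup>+y. ?h x y * ?F (x, y) \<partial>lborel) =
      ennreal \<bar>-c\<bar> * (\<integral>\<^sup>+u. ?h x (x + (-c) * u) * ?F (x, x + (-c) * u) \<partial>lborel)"
      using c by (intro nn_integral_real_affine) auto
    also have "\<dots> = (\<integral>\<^sup>+u. ennreal c * (?h x (x - c * u) * indicator A (u, (2 * x - c * u) / c)) \<partial>lborel)"
      using c by (subst nn_integral_cmult) (auto simp: algebra_simps)
    finally show "(\<integral>\<^sup>+y. ?h x y * ?F (x, y) \<partial>lborel) = \<dots>" .
  qed
  also have "\<dots> = (\<integral>\<^sup>+u. \<integral>\<^sup>+x. ennreal c * (?h x (x - c * u) * indicator A (u, (2 * x - c * u) / c)) \<partial>lborel \<partial>lborel)"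
    by (rule lborel_pair.Fubini') measurable
  also have "\<dots> = (\<integral>\<^sup>+u. \<integral>\<^sup>+v. ennreal (normal_density ((a - b) / c) 1 u * normal_density ((a + b) / c) 1 v) * indicator A (u, v) \<partial>lborel \<partial>lborel)"
  proof (rule nn_integral_cong)
    fix u
    have "(\<integral>\<^sup>+x. ennreal c * (?h x (x - c * u) * indicator A (u, (2 * x - c * u) / c)) \<partial>lborel) =
      ennreal \<bar>1 / c\<bar> * (\<integral>\<^sup>+v. ennreal c * (?h (u / c + 1 / c * v) (u / c + 1 / c * v - c * u) *
         indicator A (u, (2 * (u / c + 1 / c * v) - c * u) / c)) \<partial>lborel)"
      using c by (intro nn_integral_real_affine) auto
    also have "\<dots> = (\<integral>\<^sup>+v. ennreal \<bar>1 / c\<bar> * (ennreal c * (?h (u / c + 1 / c * v) (u / c + 1 / c * v - c * u) *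
         indicator A (u, (2 * (u / c + 1 / c * v) - c * u) / c))) \<partial>lborel)"
      by (subst nn_integral_cmult) auto
    also have "\<dots> = (\<integral>\<^sup>+v. ennreal (normal_density ((a - b) / c) 1 u * normal_density ((a + b) / c) 1 v) * indicator A (u, v) \<partial>lborel)"
    proof (rule nn_integral_cong)
      fix v
      have cu: "c * u = 2 * u / c" using c by (simp add: field_simps)
      have 1: "(2 * (u / c + 1 / c * v) - c * u) / c = v"
        using c unfolding cu by (simp add: field_simps)
      \<comment> \<open>Rotations preserve the sum of squares. Writing x / c as x * c / 2 makes both
        sides polynomials in c whose difference is a multiple of c^2 - 2.\<close>
      have q: "(u / c + v / c - a)\<^sup>2 + (v / c - u / c - b)\<^sup>2 = (u - (a - b) / c)\<^sup>2 + (v - (a + b) / c)\<^sup>2"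
      proof -
        have "c\<^sup>2 = 2" using c by (simp add: power2_eq_square)
        then have e: "x / c = x * c / 2" for x using c by (simp add: field_simps power2_eq_square)
        have "(u * c / 2 + v * c / 2 - a)\<^sup>2 + (v * c / 2 - u * c / 2 - b)\<^sup>2 -
          ((u - (a - b) * c / 2)\<^sup>2 + (v - (a + b) * c / 2)\<^sup>2) = (c\<^sup>2 - 2) * ((u\<^sup>2 + v\<^sup>2) / 2 - (a\<^sup>2 + b\<^sup>2) / 2)"
          by (simp add: field_simps power2_eq_square)
        then show ?thesis unfolding e using \<open>c\<^sup>2 = 2\<close> by simp
      qed
      have 2: "u / c + 1 / c * v - c * u = v / c - u / c" unfolding cu by simp
      have "normal_density a 1 (u / c + 1 / c * v) * normal_density b 1 (u / c + 1 / c * v - c * u) =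
         normal_density ((a - b) / c) 1 u * normal_density ((a + b) / c) 1 v"
        unfolding 2 using q
        by (simp add: normal_density_def exp_add[symmetric] add_divide_distrib[symmetric])
      moreover have "ennreal \<bar>1 / c\<bar> * ennreal c = 1" using c by (simp add: ennreal_mult[symmetric])
      ultimately show "ennreal \<bar>1 / c\<bar> * (ennreal c * (?h (u / c + 1 / c * v) (u / c + 1 / c * v - c * u) *
         indicator A (u, (2 * (u / c + 1 / c * v) - c * u) / c))) =
         ennreal (normal_density ((a - b) / c) 1 u * normal_density ((a + b) / c) 1 v) * indicator A (u, v)"
        unfolding 1 by (simp add: mult.assoc[symmetric])
    qed
    finally show "(\<integral>\<^sup>+x. ennreal c * (?h x (x - c * u) * indicator A (u, (2 * x - c * u) / c)) \<partial>lborel) = \<dots>" .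
  qed
  also have "\<dots> = (\<integral>\<^sup>+\<omega>. indicator A \<omega> \<partial>?R)"
    unfolding c_def[symmetric] by (rule nn_integral_normal_pair[symmetric]) measurable
  also have "\<dots> = emeasure ?R A" by (subst nn_integral_indicator) (auto cong: sets_pair_measure_cong)
  finally show "emeasure ?L A = emeasure ?R A" .
qed

subsection \<open>The law of the scores\<close>

text \<open>Dividing by \<open>sqrt 2\<close> gives the two rotated coordinates unit variance and
  turns the thresholds \<open>sqrt 2 * t\<close> of the statistics into t.\<close>

definition gap :: "real \<times> real \<Rightarrow> real" where
  "gap = (\<lambda>(x, y). (\<bar>x - y\<bar> - \<bar>x + y\<bar>) / sqrt 2)"

definition abs_gap_law :: "real \<Rightarrow> real \<Rightarrow> real measure" where
  "abs_gap_law a b = distr (normal_law a \<Otimes>\<^sub>M normal_law b) borel (\<lambda>(u, v). \<bar>u\<bar> - \<bar>v\<bar>)"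

text \<open>Equal signs centre the difference and leave the sum with mean \<open>sqrt 2 * s\<close>
  up to a sign, which the absolute value removes.\<close>

definition null_law :: "real \<Rightarrow> real measure" where
  "null_law s = abs_gap_law 0 (sqrt 2 * s)"

definition alt_law :: "real \<Rightarrow> real measure" where
  "alt_law s = abs_gap_law (sqrt 2 * s) 0"

lemma prob_space_abs_gap_law [simp]: "prob_space (abs_gap_law a b)"
  unfolding abs_gap_law_def
  by (rule prob_space.prob_space_distr[OF prob_space_pair]) auto

lemma sets_abs_gap_law [simp, measurable_cong]: "sets (abs_gap_law a b) = sets borel"
  and space_abs_gap_law [simp]: "space (abs_gap_law a b) = UNIV"
  by (auto simp: abs_gap_law_def)

text \<open>Negation exchanges the roles of U and V. Hence negated scores, which are what
  \<open>T_plus\<close> reads, have the null and the alternative law interchanged.\<close>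

lemma abs_gap_law_swap: "distr (abs_gap_law a b) borel uminus = abs_gap_law b a"
proof -
  interpret pair_prob_space "normal_law a" "normal_law b" by (simp add: pair_prob_space_def pair_sigma_finite_def prob_space_imp_sigma_finite)
  have "abs_gap_law b a = distr (normal_law a \<Otimes>\<^sub>M normal_law b) borel (\<lambda>(u, v). \<bar>v\<bar> - \<bar>u\<bar>)"
    unfolding abs_gap_law_def
    by (subst pair_sigma_finite.distr_pair_swap[OF pair_sigma_finite.intro[OF prob_space_imp_sigma_finite prob_space_imp_sigma_finite]])
       (auto simp: distr_distr comp_def split_beta')
  then show ?thesis unfolding abs_gap_law_def by (simp add: distr_distr comp_def split_beta')
qed

lemma abs_gap_law_uminus2: "abs_gap_law a (- b) = abs_gap_law a b"
proof -
  have "normal_law a \<Otimes>\<^sub>M normal_law (- b) = distr (normal_law a) borel (\<lambda>x. x) \<Otimes>\<^sub>M distr (normal_law b) borel uminus"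
    by (simp add: normal_law_uminus distr_id2)
  also have "\<dots> = distr (normal_law a \<Otimes>\<^sub>M normal_law b) (borel \<Otimes>\<^sub>M borel) (\<lambda>(x, y). (x, - y))"
    by (rule pair_measure_distr) (auto simp: normal_law_uminus prob_space_imp_sigma_finite)
  finally show ?thesis unfolding abs_gap_law_def by (simp add: distr_distr comp_def split_beta')
qed

lemma abs_gap_law_uminus1: "abs_gap_law (- a) b = abs_gap_law a b"
  by (metis abs_gap_law_swap abs_gap_law_uminus2)

lemma gap_measurable [measurable]: "gap \<in> borel_measurable (borel \<Otimes>\<^sub>M borel)"
  unfolding gap_def by measurable

lemma gap_law: "distr (normal_law a \<Otimes>\<^sub>M normal_law b) borel gap = abs_gap_law ((a - b) / sqrt 2) ((a + b) / sqrt 2)"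
  unfolding abs_gap_law_def normal_law_rotation[symmetric]
  by (subst distr_distr) (auto simp: comp_def split_beta' gap_def simp flip: diff_divide_distrib add_divide_distrib intro!: distr_cong)

lemma gap_sign_law:
  assumes "a \<in> {-1, 1}" "b \<in> {-1, 1}"
  shows "distr (normal_law (a * s) \<Otimes>\<^sub>M normal_law (b * s)) borel gap = (if a = b then null_law s else alt_law s)"
proof -
  have [simp]: "2 * s / sqrt 2 = sqrt 2 * s" "-(2 * s) / sqrt 2 = - (sqrt 2 * s)"
    by (auto simp: field_simps simp flip: mult.assoc)
  from assms show ?thesis
    unfolding gap_law by (auto simp: null_law_def alt_law_def abs_gap_law_uminus1 abs_gap_law_uminus2)
qed

text \<open>Taking roots of the squared normals leaves absolute values; \<open>s \<ge> 0\<close>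
  identifies the root of the noncentrality \<open>2 * s ^ 2\<close> with
  \<open>sqrt 2 * s\<close>.\<close>

lemma S_fun_eq:
  assumes "s \<ge> 0"
  shows "S_fun s t = measure (null_law s) {t<..}"
proof -
  have e: "chi_square_1 0 \<Otimes>\<^sub>M chi_square_1 (2 * s\<^sup>2) =
     distr (normal_law 0 \<Otimes>\<^sub>M normal_law (sqrt 2 * s)) (borel \<Otimes>\<^sub>M borel) (\<lambda>(x, y). (x\<^sup>2, y\<^sup>2))"
    unfolding chi_square_1_def using assms
    by (subst pair_measure_distr) (auto simp: real_sqrt_mult intro!: prob_space_imp_sigma_finite prob_space.prob_space_distr)
  have "{x \<in> space (borel \<Otimes>\<^sub>M borel :: (real \<times> real) measure). t < sqrt (fst x) - sqrt (snd x)} \<in> sets (borel \<Otimes>\<^sub>M borel)"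
    by measurable
  then have [simp]: "{(a, b). t < sqrt a - sqrt b} \<in> sets (borel \<Otimes>\<^sub>M borel)"
    by (simp add: space_pair_measure split_beta')
  show ?thesis unfolding S_fun_def e null_law_def abs_gap_law_def
    by (subst (1 2) measure_distr) (auto intro!: arg_cong2[where f=measure])
qed

definition scores :: "nat \<Rightarrow> nat \<Rightarrow> nat \<Rightarrow> (nat \<Rightarrow> real) \<Rightarrow> (nat \<Rightarrow> real) \<Rightarrow> data \<Rightarrow> nat \<Rightarrow> real" where
  "scores n p q \<theta> \<eta> \<omega> = (\<lambda>i\<in>{..<n}. gap (proj p \<theta> (fst \<omega> i), proj q \<eta> (snd \<omega> i)))"

lemma proj_measurable [measurable]: "proj d \<theta> \<in> borel_measurable (\<Pi>\<^sub>M j\<in>{..<d}. borel)"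
  unfolding proj_def dot_def by measurable

lemma sets_sample_law [measurable_cong]: "sets (sample_law n p q \<theta> \<eta> z \<sigma>) = sets (sample_space n p q)"
  unfolding sample_law_def sample_space_def by (intro sets_pair_measure_cong sets_PiM_cong) auto

lemma scores_measurable [measurable]:
  "scores n p q \<theta> \<eta> \<in> measurable (sample_space n p q) (\<Pi>\<^sub>M i\<in>{..<n}. borel)"
  unfolding scores_def sample_space_def by (rule measurable_restrict) measurable

lemma proj_pair_law:
  assumes "euclid_norm p \<theta> > 0" "euclid_norm q \<eta> > 0"
  shows "distr (normal_vec_law p (\<lambda>j. a * \<theta> j) \<Otimes>\<^sub>M normal_vec_law q (\<lambda>j. b * \<eta> j)) (borel \<Otimes>\<^sub>M borel)
    (\<lambda>(x, y). (proj p \<theta> x, proj q \<eta> y)) = normal_law (a * euclid_norm p \<theta>) \<Otimes>\<^sub>M normal_law (b * euclid_norm q \<eta>)"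
  by (subst pair_measure_distr[symmetric])
     (auto simp: dot_law assms prob_space_imp_sigma_finite cong: measurable_cong_sets)

lemma scores_law:
  assumes s: "euclid_norm p \<theta> = s" "euclid_norm q \<eta> = s" "s > 0"
    and z: "z \<in> sign_vectors n" "\<sigma> \<in> sign_vectors n"
  shows "distr (sample_law n p q \<theta> \<eta> z \<sigma>) (\<Pi>\<^sub>M i\<in>{..<n}. borel) (scores n p q \<theta> \<eta>) =
    (\<Pi>\<^sub>M i\<in>{..<n}. if z i = \<sigma> i then null_law s else alt_law s)"
proof -
  let ?L = "\<lambda>i. if z i = \<sigma> i then null_law s else alt_law s"
  have sb: "sets (\<Pi>\<^sub>M i\<in>{..<n}. ?L i) = sets (\<Pi>\<^sub>M i\<in>{..<n}. borel)"
    by (intro sets_PiM_cong) (auto simp: null_law_def alt_law_def)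
  have "distr (sample_law n p q \<theta> \<eta> z \<sigma>) (\<Pi>\<^sub>M i\<in>{..<n}. borel) (scores n p q \<theta> \<eta>) =
    distr (sample_law n p q \<theta> \<eta> z \<sigma>) (\<Pi>\<^sub>M i\<in>{..<n}. ?L i)
      (\<lambda>\<omega>. \<lambda>i\<in>{..<n}. (\<lambda>(x, y). gap (proj p \<theta> x, proj q \<eta> y)) (fst \<omega> i, snd \<omega> i))"
    using sb by (intro distr_cong) (auto simp: scores_def)
  also have "\<dots> = (\<Pi>\<^sub>M i\<in>{..<n}. ?L i)"
    unfolding sample_law_def
  proof (rule distr_pair_PiM)
    fix i assume "i \<in> {..<n}"
    then have zi: "z i \<in> {-1, 1}" "\<sigma> i \<in> {-1, 1}" using z by (auto simp: sign_vectors_def PiE_iff)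
    let ?P = "normal_vec_law p (\<lambda>j. z i * \<theta> j) \<Otimes>\<^sub>M normal_vec_law q (\<lambda>j. \<sigma> i * \<eta> j)"
    have "sets (?L i) = sets borel" by (simp add: null_law_def alt_law_def)
    then show m: "(\<lambda>(x, y). gap (proj p \<theta> x, proj q \<eta> y)) \<in> measurable ?P (?L i)"
      by (simp cong: measurable_cong_sets)
    have "distr ?P (?L i) (\<lambda>(x, y). gap (proj p \<theta> x, proj q \<eta> y)) =
      distr (distr ?P (borel \<Otimes>\<^sub>M borel) (\<lambda>(x, y). (proj p \<theta> x, proj q \<eta> y))) borel gap"
      by (subst distr_distr) (auto intro!: distr_cong simp: null_law_def alt_law_def)
    also have "\<dots> = ?L i"
      using s by (simp only: proj_pair_law) (simp add: gap_sign_law[OF zi])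
    finally show "distr ?P (?L i) (\<lambda>(x, y). gap (proj p \<theta> x, proj q \<eta> y)) = ?L i" .
  qed (auto simp: null_law_def alt_law_def)
  finally show ?thesis .
qed

subsection \<open>A maximal inequality for the empirical process\<close>

text \<open>The centred indicator of x < u, divided by 1 - u. In this form the parameter enters only
  through the survival indicator over its probability: given survival up to a, the chance of
  surviving up to b is (1 - b) / (1 - a), whence the martingale property.\<close>

definition cent :: "real \<Rightarrow> real \<Rightarrow> real" where
  "cent u x = 1 - (if u \<le> x then 1 / (1 - u) else 0)"

text \<open>Uniformity is recorded through the mass of open half-lines, which is what the image
  under a strictly decreasing tail function delivers at once.\<close>

locale uniform_law = prob_space \<nu> for \<nu> :: "real measure" +
  assumes sets_nu [simp, measurable_cong]: "sets \<nu> = sets borel"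
    and prob_less: "\<And>u. 0 < u \<Longrightarrow> u < 1 \<Longrightarrow> measure \<nu> {..<u} = u"
begin

lemma space_nu [simp]: "space \<nu> = UNIV"
  using sets_eq_imp_space_eq[OF sets_nu] by simp

lemma cent_measurable [measurable]: "cent u \<in> borel_measurable borel"
  unfolding cent_def by measurable

lemma emeasure_less: "0 < u \<Longrightarrow> u < 1 \<Longrightarrow> emeasure \<nu> {..<u} = ennreal u"
  by (simp add: emeasure_eq_measure prob_less)

lemma emeasure_ge: "0 < u \<Longrightarrow> u < 1 \<Longrightarrow> emeasure \<nu> {u..} = ennreal (1 - u)"
proof -
  assume u: "0 < u" "u < 1"
  have "measure \<nu> (space \<nu> - {..<u}) = 1 - u" using u by (subst prob_compl) (auto simp: prob_less)
  moreover have "space \<nu> - {..<u} = {u..}" by auto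
  ultimately show ?thesis by (simp add: emeasure_eq_measure)
qed

lemma emeasure_between: "0 < a \<Longrightarrow> a \<le> b \<Longrightarrow> b < 1 \<Longrightarrow> emeasure \<nu> {a..<b} = ennreal (b - a)"
proof -
  assume u: "0 < a" "a \<le> b" "b < 1"
  have "measure \<nu> ({..<b} - {..<a}) = b - a" using u by (subst finite_measure_Diff) (auto simp: prob_less)
  moreover have "{..<b} - {..<a} = {a..<b}" by auto
  ultimately show ?thesis by (simp add: emeasure_eq_measure)
qed

text \<open>Conditionally on the truncation at \<open>a\<close>, the variable \<open>cent b\<close> has mean \<open>cent a\<close>, so this is
  Jensen's inequality for the exponential.\<close>
lemma cent_exp_step:
  assumes ab: "0 < a" "a \<le> b" "b < 1" and [measurable]: "G \<in> borel_measurable borel"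
    and G: "\<And>x. a \<le> x \<Longrightarrow> G x = c"
  shows "(\<integral>\<^sup>+x. G x * ennreal (exp (h * cent a x)) \<partial>\<nu>) \<le> (\<integral>\<^sup>+x. G x * ennreal (exp (h * cent b x)) \<partial>\<nu>)"
proof -
  define A where "A = exp (h * (1 - 1 / (1 - a)))"
  define B where "B = exp (h * (1 - 1 / (1 - b)))"
  have pos: "1 - a > 0" "1 - b > 0" using ab by auto
  have jensen: "(1 - a) * A \<le> (b - a) * exp h + (1 - b) * B"
  proof -
    \<comment> \<open>m is the value of h * \<open>cent a\<close> on survivors of a, hence also the
      conditional mean of h * \<open>cent b\<close>. In the tangent bound for exp at m the linear
      terms cancel.\<close>
    define m where "m = h * (1 - 1 / (1 - a))"
    have e: "exp y \<ge> exp m * (1 + (y - m))" for y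
    proof -
      have "exp m * (1 + (y - m)) \<le> exp m * exp (y - m)" by (intro mult_left_mono exp_ge_add_one_self) auto
      then show ?thesis by (simp add: exp_add[symmetric])
    qed
    have "(b - a) * (h - m) + (1 - b) * (h * (1 - 1 / (1 - b)) - m) = 0"
    proof -
      have "(1 - a) * (1 / (1 - a)) = 1" "(1 - b) * (1 / (1 - b)) = 1" using pos by auto
      then show ?thesis unfolding m_def by algebra
    qed
    then have "(1 - a) * exp m = (b - a) * (exp m * (1 + (h - m))) + (1 - b) * (exp m * (1 + (h * (1 - 1 / (1 - b)) - m)))"
      by algebra
    also have "\<dots> \<le> (b - a) * exp h + (1 - b) * B"
      unfolding B_def using ab by (intro add_mono mult_left_mono e) auto
    finally show ?thesis by (simp add: A_def m_def)
  qed
  \<comment> \<open>Below a both integrands agree, because \<open>cent\<close> is 1 there at either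
    level. Only the mass above a, where G is constant, has to be compared.\<close>
  have "(\<integral>\<^sup>+x. G x * ennreal (exp (h * cent a x)) \<partial>\<nu>) =
    (\<integral>\<^sup>+x. G x * ennreal (exp h) * indicator {..<a} x + c * ennreal A * indicator {a..} x \<partial>\<nu>)"
    by (intro nn_integral_cong) (auto simp: indicator_def cent_def A_def G)
  also have "\<dots> = (\<integral>\<^sup>+x. G x * ennreal (exp h) * indicator {..<a} x \<partial>\<nu>) + c * ennreal A * ennreal (1 - a)"
    using ab by (simp add: nn_integral_add nn_integral_cmult_indicator emeasure_ge)
  also have "\<dots> \<le> (\<integral>\<^sup>+x. G x * ennreal (exp h) * indicator {..<a} x \<partial>\<nu>) +
     (c * ennreal (exp h) * ennreal (b - a) + c * ennreal B * ennreal (1 - b))"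
  proof (rule add_left_mono)
    have "c * ennreal A * ennreal (1 - a) = c * ennreal ((1 - a) * A)"
      using pos by (simp add: A_def ennreal_mult mult_ac)
    also have "\<dots> \<le> c * ennreal ((b - a) * exp h + (1 - b) * B)"
      by (intro mult_left_mono ennreal_leI jensen) auto
    also have "\<dots> = c * ennreal (exp h) * ennreal (b - a) + c * ennreal B * ennreal (1 - b)"
      using pos ab by (simp add: B_def ennreal_mult ennreal_plus distrib_left mult_ac)
    finally show "c * ennreal A * ennreal (1 - a) \<le> c * ennreal (exp h) * ennreal (b - a) + c * ennreal B * ennreal (1 - b)" .
  qed
  also have "\<dots> = (\<integral>\<^sup>+x. G x * ennreal (exp h) * indicator {..<a} x + (c * ennreal (exp h) * indicator {a..<b} x + c * ennreal B * indicator {b..} x) \<partial>\<nu>)"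
    using ab by (simp add: nn_integral_add nn_integral_cmult_indicator emeasure_ge emeasure_between)
  also have "\<dots> = (\<integral>\<^sup>+x. G x * ennreal (exp (h * cent b x)) \<partial>\<nu>)"
    using ab by (intro nn_integral_cong) (auto simp: indicator_def cent_def B_def G)
  finally show ?thesis .
qed

text \<open>The condition on F says that each coordinate enters only through its truncation at a, so
  F belongs to the past of level a. Coordinates are moved from a to b one at a time, each move being
  \<open>cent_exp_step\<close> with the other coordinates frozen.\<close>

lemma cent_exp_submartingale:
  assumes ab: "0 < a" "a \<le> b" "b < 1" and "finite I"
    and "F \<in> borel_measurable (\<Pi>\<^sub>M i\<in>I. \<nu>)"
    and "\<And>x y. (\<And>i. i \<in> I \<Longrightarrow> x i = y i \<or> (a \<le> x i \<and> a \<le> y i)) \<Longrightarrow> x \<in> extensional I \<Longrightarrow> y \<in> extensional I \<Longrightarrow> F x = F y"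
  shows "(\<integral>\<^sup>+x. F x * (\<Prod>i\<in>I. ennreal (exp (h * cent a (x i)))) \<partial>(\<Pi>\<^sub>M i\<in>I. \<nu>)) \<le>
         (\<integral>\<^sup>+x. F x * (\<Prod>i\<in>I. ennreal (exp (h * cent b (x i)))) \<partial>(\<Pi>\<^sub>M i\<in>I. \<nu>))"
  using assms(4-)
proof (induction I arbitrary: F rule: finite_induct)
  case empty
  then show ?case by simp
next
  case (insert j I F)
  interpret P: product_prob_space "\<lambda>_::'a. \<nu>" by (intro product_prob_spaceI) unfold_locales
  note ji = insert.hyps
  note Fm[measurable] = insert.prems(1)
  have upd[measurable]: "(\<lambda>x. x(j := y)) \<in> measurable (\<Pi>\<^sub>M i\<in>I. \<nu>) (\<Pi>\<^sub>M i\<in>insert j I. \<nu>)" for y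
    by measurable
  have fub: "(\<integral>\<^sup>+x. F x * (\<Prod>i\<in>insert j I. ennreal (exp (h * cent u (x i)))) \<partial>(\<Pi>\<^sub>M i\<in>insert j I. \<nu>)) =
    (\<integral>\<^sup>+y. ennreal (exp (h * cent u y)) * (\<integral>\<^sup>+x. F (x(j := y)) * (\<Prod>i\<in>I. ennreal (exp (h * cent u (x i)))) \<partial>(\<Pi>\<^sub>M i\<in>I. \<nu>)) \<partial>\<nu>)" for u
  proof -
    have "(\<integral>\<^sup>+x. F x * (\<Prod>i\<in>insert j I. ennreal (exp (h * cent u (x i)))) \<partial>(\<Pi>\<^sub>M i\<in>insert j I. \<nu>)) =
      (\<integral>\<^sup>+y. \<integral>\<^sup>+x. F (x(j := y)) * (\<Prod>i\<in>insert j I. ennreal (exp (h * cent u ((x(j := y)) i)))) \<partial>(\<Pi>\<^sub>M i\<in>I. \<nu>) \<partial>\<nu>)"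
      using ji by (intro P.product_nn_integral_insert_rev) measurable
    also have "\<dots> = (\<integral>\<^sup>+y. \<integral>\<^sup>+x. ennreal (exp (h * cent u y)) * (F (x(j := y)) * (\<Prod>i\<in>I. ennreal (exp (h * cent u (x i))))) \<partial>(\<Pi>\<^sub>M i\<in>I. \<nu>) \<partial>\<nu>)"
    proof (intro nn_integral_cong)
      fix y x
      have "(\<Prod>i\<in>I. ennreal (exp (h * cent u ((x(j := y)) i)))) = (\<Prod>i\<in>I. ennreal (exp (h * cent u (x i))))"
        using ji by (intro prod.cong) auto
      then show "F (x(j := y)) * (\<Prod>i\<in>insert j I. ennreal (exp (h * cent u ((x(j := y)) i)))) =
        ennreal (exp (h * cent u y)) * (F (x(j := y)) * (\<Prod>i\<in>I. ennreal (exp (h * cent u (x i)))))"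
        using ji by (simp add: mult_ac)
    qed
    also have "\<dots> = (\<integral>\<^sup>+y. ennreal (exp (h * cent u y)) * (\<integral>\<^sup>+x. F (x(j := y)) * (\<Prod>i\<in>I. ennreal (exp (h * cent u (x i)))) \<partial>(\<Pi>\<^sub>M i\<in>I. \<nu>)) \<partial>\<nu>)"
      by (intro nn_integral_cong nn_integral_cmult) measurable
    finally show ?thesis .
  qed
  \<comment> \<open>The new coordinate is integrated innermost, so that the one-variable step
    applies for every value of the others.\<close>
  have swap: "(\<integral>\<^sup>+y. ennreal (exp (h * cent v y)) * (\<integral>\<^sup>+x. F (x(j := y)) * (\<Prod>i\<in>I. ennreal (exp (h * cent b (x i)))) \<partial>(\<Pi>\<^sub>M i\<in>I. \<nu>)) \<partial>\<nu>) =
    (\<integral>\<^sup>+x. (\<integral>\<^sup>+y. F (x(j := y)) * ennreal (exp (h * cent v y)) \<partial>\<nu>) * (\<Prod>i\<in>I. ennreal (exp (h * cent b (x i)))) \<partial>(\<Pi>\<^sub>M i\<in>I. \<nu>))" for v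
  proof -
    have PI: "sigma_finite_measure (\<Pi>\<^sub>M i\<in>I. \<nu>)" "sigma_finite_measure \<nu>"
      by (intro prob_space_imp_sigma_finite prob_space_PiM prob_space_axioms)+
    then interpret ps: pair_sigma_finite \<nu> "\<Pi>\<^sub>M i\<in>I. \<nu>" by (simp add: pair_sigma_finite_def)
    have [measurable]: "(\<lambda>\<omega>. F ((snd \<omega>)(j := fst \<omega>))) \<in> borel_measurable (\<nu> \<Otimes>\<^sub>M (\<Pi>\<^sub>M i\<in>I. \<nu>))"
      by measurable
    have "(\<integral>\<^sup>+y. ennreal (exp (h * cent v y)) * (\<integral>\<^sup>+x. F (x(j := y)) * (\<Prod>i\<in>I. ennreal (exp (h * cent b (x i)))) \<partial>(\<Pi>\<^sub>M i\<in>I. \<nu>)) \<partial>\<nu>) =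
      (\<integral>\<^sup>+y. \<integral>\<^sup>+x. ennreal (exp (h * cent v y)) * (F (x(j := y)) * (\<Prod>i\<in>I. ennreal (exp (h * cent b (x i))))) \<partial>(\<Pi>\<^sub>M i\<in>I. \<nu>) \<partial>\<nu>)"
      by (intro nn_integral_cong nn_integral_cmult[symmetric]) measurable
    also have "\<dots> = (\<integral>\<^sup>+x. \<integral>\<^sup>+y. ennreal (exp (h * cent v y)) * (F (x(j := y)) * (\<Prod>i\<in>I. ennreal (exp (h * cent b (x i))))) \<partial>\<nu> \<partial>(\<Pi>\<^sub>M i\<in>I. \<nu>))"
      by (rule ps.Fubini'[symmetric]) measurable
    also have "\<dots> = (\<integral>\<^sup>+x. (\<integral>\<^sup>+y. F (x(j := y)) * ennreal (exp (h * cent v y)) \<partial>\<nu>) * (\<Prod>i\<in>I. ennreal (exp (h * cent b (x i)))) \<partial>(\<Pi>\<^sub>M i\<in>I. \<nu>))"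
    proof (intro nn_integral_cong)
      fix x assume "x \<in> space (\<Pi>\<^sub>M i\<in>I. \<nu>)"
      then have [measurable]: "(\<lambda>y. F (x(j := y))) \<in> borel_measurable \<nu>" by measurable
      show "(\<integral>\<^sup>+y. ennreal (exp (h * cent v y)) * (F (x(j := y)) * (\<Prod>i\<in>I. ennreal (exp (h * cent b (x i))))) \<partial>\<nu>) =
        (\<integral>\<^sup>+y. F (x(j := y)) * ennreal (exp (h * cent v y)) \<partial>\<nu>) * (\<Prod>i\<in>I. ennreal (exp (h * cent b (x i))))"
        by (subst nn_integral_multc[symmetric]) (auto simp: mult_ac)
    qed
    finally show ?thesis .
  qed
  have "(\<integral>\<^sup>+x. F x * (\<Prod>i\<in>insert j I. ennreal (exp (h * cent a (x i)))) \<partial>(\<Pi>\<^sub>M i\<in>insert j I. \<nu>)) \<le>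
    (\<integral>\<^sup>+y. ennreal (exp (h * cent a y)) * (\<integral>\<^sup>+x. F (x(j := y)) * (\<Prod>i\<in>I. ennreal (exp (h * cent b (x i)))) \<partial>(\<Pi>\<^sub>M i\<in>I. \<nu>)) \<partial>\<nu>)"
    unfolding fub
  proof (rule nn_integral_mono, rule mult_left_mono)
    fix y
    have "(\<lambda>x. F (x(j := y))) \<in> borel_measurable (\<Pi>\<^sub>M i\<in>I. \<nu>)" by measurable
    moreover have "F (x(j := y)) = F (x'(j := y))"
      if "\<And>i. i \<in> I \<Longrightarrow> x i = x' i \<or> (a \<le> x i \<and> a \<le> x' i)" "x \<in> extensional I" "x' \<in> extensional I" for x x'
      using that by (intro insert.prems(2)) (auto simp: extensional_def)
    ultimately show "(\<integral>\<^sup>+x. F (x(j := y)) * (\<Prod>i\<in>I. ennreal (exp (h * cent a (x i)))) \<partial>(\<Pi>\<^sub>M i\<in>I. \<nu>)) \<le>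
      (\<integral>\<^sup>+x. F (x(j := y)) * (\<Prod>i\<in>I. ennreal (exp (h * cent b (x i)))) \<partial>(\<Pi>\<^sub>M i\<in>I. \<nu>))"
      by (rule insert.IH)
  qed simp
  also have "\<dots> \<le> (\<integral>\<^sup>+y. ennreal (exp (h * cent b y)) * (\<integral>\<^sup>+x. F (x(j := y)) * (\<Prod>i\<in>I. ennreal (exp (h * cent b (x i)))) \<partial>(\<Pi>\<^sub>M i\<in>I. \<nu>)) \<partial>\<nu>)"
    unfolding swap
  proof (rule nn_integral_mono, rule mult_right_mono)
    fix x assume x: "x \<in> space (\<Pi>\<^sub>M i\<in>I. \<nu>)"
    then have "(\<lambda>y. F (x(j := y))) \<in> borel_measurable \<nu>" by measurable
    then have m: "(\<lambda>y. F (x(j := y))) \<in> borel_measurable borel" by (simp cong: measurable_cong_sets)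
    \<comment> \<open>All values y \<ge> a are equivalent for F, so a itself represents them and
      supplies the constant.\<close>
    show "(\<integral>\<^sup>+y. F (x(j := y)) * ennreal (exp (h * cent a y)) \<partial>\<nu>) \<le> (\<integral>\<^sup>+y. F (x(j := y)) * ennreal (exp (h * cent b y)) \<partial>\<nu>)"
      using x by (intro cent_exp_step[OF ab m, where c="F (x(j := a))"] insert.prems(2))
        (auto simp: space_PiM extensional_def PiE_iff)
  qed simp
  also have "\<dots> = (\<integral>\<^sup>+x. F x * (\<Prod>i\<in>insert j I. ennreal (exp (h * cent b (x i)))) \<partial>(\<Pi>\<^sub>M i\<in>insert j I. \<nu>))"
    unfolding fub ..
  finally show ?case .
qed

definition cent_sum :: "nat \<Rightarrow> real \<Rightarrow> (nat \<Rightarrow> real) \<Rightarrow> real" where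
  "cent_sum n u \<omega> = (\<Sum>i<n. cent u (\<omega> i))"

abbreviation sample :: "nat \<Rightarrow> (nat \<Rightarrow> real) measure" where
  "sample n \<equiv> \<Pi>\<^sub>M i\<in>{..<n}. \<nu>"

lemma cent_sum_measurable [measurable]: "cent_sum n u \<in> borel_measurable (sample n)"
  unfolding cent_sum_def by measurable

lemma cent_sum_exp: "ennreal (exp (h * cent_sum n u \<omega>)) = (\<Prod>i<n. ennreal (exp (h * cent u (\<omega> i))))"
  by (simp add: cent_sum_def sum_distrib_left exp_sum prod_ennreal)

lemma cent_sum_exp_integral:
  "(\<integral>\<^sup>+\<omega>. ennreal (exp (h * cent_sum n u \<omega>)) \<partial>sample n) = (\<integral>\<^sup>+x. ennreal (exp (h * cent u x)) \<partial>\<nu>) ^ n"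
proof -
  interpret P: product_prob_space "\<lambda>_::nat. \<nu>" by (intro product_prob_spaceI) unfold_locales
  show ?thesis unfolding cent_sum_exp by (subst P.product_nn_integral_prod) auto
qed

text \<open>Doob's argument: split by the first level g of G at which the threshold is passed. That
  event lies in the past of g, so the exponential at g may be replaced by the one at b before
  summing. Either sign of h is covered, the exponential being convex in both cases.\<close>

lemma cent_sum_maximal_finite:
  assumes b: "b < 1" and G: "finite G" "G \<subseteq> {0<..b}"
  shows "emeasure (sample n) {\<omega>\<in>space (sample n). \<exists>u\<in>G. h * cent_sum n u \<omega> > c} \<le>
    ennreal (exp (- c)) * (\<integral>\<^sup>+\<omega>. ennreal (exp (h * cent_sum n b \<omega>)) \<partial>sample n)"
proof -
  define A where "A g = {\<omega>\<in>space (sample n). h * cent_sum n g \<omega> > c \<and> (\<forall>k\<in>{k\<in>G. k < g}. h * cent_sum n k \<omega> \<le> c)}" for g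
  have Am[measurable]: "A g \<in> sets (sample n)" for g
    unfolding A_def using G(1) by (intro sets.sets_Collect_conj sets.sets_Collect_finite_All) auto
  have step: "ennreal (exp c) * emeasure (sample n) (A g) \<le> (\<integral>\<^sup>+\<omega>. indicator (A g) \<omega> * ennreal (exp (h * cent_sum n b \<omega>)) \<partial>sample n)" if "g \<in> G" for g
  proof -
    have g: "0 < g" "g \<le> b" using that G by auto
    have "ennreal (exp c) * emeasure (sample n) (A g) = (\<integral>\<^sup>+\<omega>. ennreal (exp c) * indicator (A g) \<omega> \<partial>sample n)"
      by (simp add: nn_integral_cmult_indicator)
    also have "\<dots> \<le> (\<integral>\<^sup>+\<omega>. indicator (A g) \<omega> * ennreal (exp (h * cent_sum n g \<omega>)) \<partial>sample n)"
      by (intro nn_integral_mono) (auto simp: indicator_def A_def intro!: ennreal_leI)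
    also have "\<dots> \<le> (\<integral>\<^sup>+\<omega>. indicator (A g) \<omega> * ennreal (exp (h * cent_sum n b \<omega>)) \<partial>sample n)"
      unfolding cent_sum_exp
    proof (rule cent_exp_submartingale)
      fix x y :: "nat \<Rightarrow> real"
      assume xy: "\<And>i. i \<in> {..<n} \<Longrightarrow> x i = y i \<or> (g \<le> x i \<and> g \<le> y i)" "x \<in> extensional {..<n}" "y \<in> extensional {..<n}"
      have "cent k (x i) = cent k (y i)" if "i < n" "k \<le> g" for i k
        using xy(1)[of i] that by (auto simp: cent_def)
      then have "cent_sum n k x = cent_sum n k y" if "k \<le> g" for k
        using that unfolding cent_sum_def by (intro sum.cong) auto
      moreover have "x \<in> space (sample n)" "y \<in> space (sample n)" using xy(2,3) by (auto simp: space_PiM PiE_iff)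
      ultimately show "indicator (A g) x = (indicator (A g) y :: ennreal)" by (auto simp: A_def indicator_def)
    qed (use g b in auto)
    finally show ?thesis .
  qed
  have disj: "disjoint_family_on A G"
  proof (clarsimp simp: disjoint_family_on_def)
    fix g k assume "g \<in> G" "k \<in> G" "g \<noteq> k"
    then show "A g \<inter> A k = {}" by (cases "g < k") (fastforce simp: A_def)+
  qed
  have un: "{\<omega>\<in>space (sample n). \<exists>u\<in>G. h * cent_sum n u \<omega> > c} \<subseteq> (\<Union>g\<in>G. A g)"
  proof
    fix \<omega> assume w: "\<omega> \<in> {\<omega>\<in>space (sample n). \<exists>u\<in>G. h * cent_sum n u \<omega> > c}"
    define K where "K = {u\<in>G. h * cent_sum n u \<omega> > c}"
    have K: "finite K" "K \<noteq> {}" using w G(1) by (auto simp: K_def)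
    then have "Min K \<in> K" by simp
    moreover have "h * cent_sum n k \<omega> \<le> c" if "k \<in> G" "k < Min K" for k
    proof (rule ccontr)
      assume "\<not> ?thesis"
      then have "k \<in> K" using that by (auto simp: K_def)
      then show False using K(1) that(2) by (meson Min_le leD)
    qed
    ultimately show "\<omega> \<in> (\<Union>g\<in>G. A g)" using w by (auto simp: A_def K_def)
  qed
  have "ennreal (exp c) * emeasure (sample n) (\<Union>g\<in>G. A g) = (\<Sum>g\<in>G. ennreal (exp c) * emeasure (sample n) (A g))"
    using disj G(1) by (subst sum_emeasure[symmetric]) (auto simp: sum_distrib_left)
  also have "\<dots> \<le> (\<Sum>g\<in>G. \<integral>\<^sup>+\<omega>. indicator (A g) \<omega> * ennreal (exp (h * cent_sum n b \<omega>)) \<partial>sample n)"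
    by (intro sum_mono step)
  also have "\<dots> = (\<integral>\<^sup>+\<omega>. (\<Sum>g\<in>G. indicator (A g) \<omega>) * ennreal (exp (h * cent_sum n b \<omega>)) \<partial>sample n)"
    by (subst nn_integral_sum[symmetric]) (auto simp: sum_distrib_right)
  also have "\<dots> \<le> (\<integral>\<^sup>+\<omega>. ennreal (exp (h * cent_sum n b \<omega>)) \<partial>sample n)"
  proof (rule nn_integral_mono)
    fix \<omega>
    have "(\<Sum>g\<in>G. indicator (A g) \<omega>) = (indicator (\<Union>g\<in>G. A g) \<omega> :: ennreal)"
      by (rule indicator_UN_disjoint[symmetric, OF G(1) disj])
    then show "(\<Sum>g\<in>G. indicator (A g) \<omega>) * ennreal (exp (h * cent_sum n b \<omega>)) \<le> ennreal (exp (h * cent_sum n b \<omega>))"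
      by (auto simp: indicator_def)
  qed
  finally have *: "ennreal (exp c) * emeasure (sample n) (\<Union>g\<in>G. A g) \<le> (\<integral>\<^sup>+\<omega>. ennreal (exp (h * cent_sum n b \<omega>)) \<partial>sample n)" .
  have "emeasure (sample n) {\<omega>\<in>space (sample n). \<exists>u\<in>G. h * cent_sum n u \<omega> > c} \<le> emeasure (sample n) (\<Union>g\<in>G. A g)"
    using G(1) by (intro emeasure_mono un) auto
  also have "\<dots> = ennreal (exp (- c)) * (ennreal (exp c) * emeasure (sample n) (\<Union>g\<in>G. A g))"
    by (simp add: mult.assoc[symmetric] ennreal_mult[symmetric] exp_add[symmetric])
  also have "\<dots> \<le> ennreal (exp (- c)) * (\<integral>\<^sup>+\<omega>. ennreal (exp (h * cent_sum n b \<omega>)) \<partial>sample n)"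
    by (intro mult_left_mono *) simp
  finally show ?thesis .
qed


text \<open>Observations are counted strictly below the level, so every path is left continuous;
  rational levels below u then determine the value at u.\<close>

lemma cent_sum_tendsto_left: "((\<lambda>v. cent_sum n v \<omega>) \<longlongrightarrow> cent_sum n u \<omega>) (at_left u)" if "u < 1"
  unfolding cent_sum_def
proof (intro tendsto_sum)
  fix i
  show "((\<lambda>v. cent v (\<omega> i)) \<longlongrightarrow> cent u (\<omega> i)) (at_left u)"
  proof (cases "u \<le> \<omega> i")
    case True
    have "((\<lambda>v. 1 - 1 / (1 - v)) \<longlongrightarrow> 1 - 1 / (1 - u)) (at_left u)"
      using that by (intro tendsto_intros) auto
    moreover have "eventually (\<lambda>v. 1 - 1 / (1 - v) = cent v (\<omega> i)) (at_left u)"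
      using True by (auto simp: eventually_at_left_field cent_def intro!: exI[of _ "u - 1"])
    ultimately show ?thesis using True by (auto simp: cent_def intro: Lim_transform_eventually)
  next
    case False
    then have "eventually (\<lambda>v. 1 = cent v (\<omega> i)) (at_left u)"
      by (auto simp: eventually_at_left_field cent_def intro!: exI[of _ "\<omega> i"])
    then have "((\<lambda>v. cent v (\<omega> i)) \<longlongrightarrow> 1) (at_left u)"
      by (rule Lim_transform_eventually[OF tendsto_const])
    then show ?thesis using False by (simp add: cent_def)
  qed
qed

text \<open>Rational levels, exhausted by finite sets, carry the bound to a countable supremum, and
  left continuity extends it to every level of the half-open block, including b. The bad event over
  uncountably many levels is controlled through its measurable superset B.\<close>

lemma cent_sum_maximal:
  assumes ab: "0 \<le> a" "a < b" "b < 1"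
  obtains B where "B \<in> sets (sample n)"
    "emeasure (sample n) B \<le> ennreal (exp (- c)) * (\<integral>\<^sup>+\<omega>. ennreal (exp (h * cent_sum n b \<omega>)) \<partial>sample n)"
    "\<And>\<omega> u. \<omega> \<in> space (sample n) - B \<Longrightarrow> a < u \<Longrightarrow> u \<le> b \<Longrightarrow> h * cent_sum n u \<omega> \<le> c"
proof -
  define C where "C = \<rat> \<inter> {a<..<b}"
  have C: "countable C" "C \<noteq> {}"
    using Rats_dense_in_real[OF ab(2)] by (auto simp: C_def intro: countable_Int1 countable_rat)
  define e where "e = from_nat_into C"
  have eC: "range e = C" unfolding e_def by (rule range_from_nat_into[OF C(2,1)])
  define A where "A J = {\<omega>\<in>space (sample n). \<exists>u\<in>e ` {..J}. h * cent_sum n u \<omega> > c}" for J :: nat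
  have Am: "A J \<in> sets (sample n)" for J
    unfolding A_def by (intro sets.sets_Collect_finite_Ex) auto
  have inc: "incseq A" by (fastforce simp: A_def incseq_def)
  have bound: "emeasure (sample n) (A J) \<le> ennreal (exp (- c)) * (\<integral>\<^sup>+\<omega>. ennreal (exp (h * cent_sum n b \<omega>)) \<partial>sample n)" for J
  proof -
    have "e ` {..J} \<subseteq> C" using eC by blast
    then show ?thesis unfolding A_def using ab by (intro cent_sum_maximal_finite) (auto simp: C_def)
  qed
  show thesis
  proof (rule that)
    show "(\<Union>J. A J) \<in> sets (sample n)" using Am by auto
    have "emeasure (sample n) (\<Union>J. A J) = (SUP J. emeasure (sample n) (A J))"
      using Am inc by (intro SUP_emeasure_incseq[symmetric]) auto
    then show "emeasure (sample n) (\<Union>J. A J) \<le> ennreal (exp (- c)) * (\<integral>\<^sup>+\<omega>. ennreal (exp (h * cent_sum n b \<omega>)) \<partial>sample n)"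
      using bound by (auto intro: SUP_least)
  next
    fix \<omega> u assume w: "\<omega> \<in> space (sample n) - (\<Union>J. A J)" and u: "a < u" "u \<le> b"
    show "h * cent_sum n u \<omega> \<le> c"
    proof (rule ccontr)
      assume "\<not> ?thesis"
      moreover have "((\<lambda>v. h * cent_sum n v \<omega>) \<longlongrightarrow> h * cent_sum n u \<omega>) (at_left u)"
        using u ab by (intro tendsto_mult_left cent_sum_tendsto_left) auto
      ultimately have "eventually (\<lambda>v. h * cent_sum n v \<omega> > c) (at_left u)"
        by (intro order_tendstoD(1)) auto
      then obtain d where d: "d < u" "\<And>v. d < v \<Longrightarrow> v < u \<Longrightarrow> h * cent_sum n v \<omega> > c"
        by (auto simp: eventually_at_left_field)
      obtain v where v: "v \<in> \<rat>" "max a d < v" "v < u" using Rats_dense_in_real[of "max a d" u] d u by auto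
      then have "v \<in> C" using u by (auto simp: C_def)
      then obtain J where "v = e J" using eC by auto
      then have "\<omega> \<in> A J" using d(2)[of v] v w by (auto simp: A_def)
      then show False using w by auto
    qed
  qed
qed

section \<open>Exponential bounds on one block of levels\<close>

definition count_less :: "nat \<Rightarrow> real \<Rightarrow> (nat \<Rightarrow> real) \<Rightarrow> nat" where
  "count_less n u \<omega> = card {i\<in>{..<n}. \<omega> i < u}"

lemma cent_sum_eq: "cent_sum n u \<omega> = (real (count_less n u \<omega>) - real n * u) / (1 - u)" if "u < 1"
proof -
  have "cent_sum n u \<omega> = (\<Sum>i<n. ((if \<omega> i < u then 1 else 0) - u) / (1 - u))"
    unfolding cent_sum_def cent_def using that by (intro sum.cong) (auto simp: field_simps)
  also have "\<dots> = ((\<Sum>i<n. (if \<omega> i < u then 1 else 0)) - real n * u) / (1 - u)"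
    by (simp add: sum_divide_distrib[symmetric] sum_subtractf)
  also have "(\<Sum>i<n. (if \<omega> i < u then 1 else 0)) = real (count_less n u \<omega>)"
    unfolding count_less_def by (simp add: sum.If_cases Int_def)
  finally show ?thesis .
qed

text \<open>Second-order Taylor formula with remainder factor exp t. The restriction on y keeps this
  factor below 1 + \<kappa>, so the Gaussian exponent is lost only up to 1 + \<kappa>.\<close>

lemma exp_quadratic_bound:
  assumes "\<bar>y\<bar> \<le> ln (1 + \<kappa>)" "\<kappa> > 0"
  shows "exp y \<le> 1 + y + (1 + \<kappa>) * y\<^sup>2 / (2::real)"
proof -
  obtain t where t: "\<bar>t\<bar> \<le> \<bar>y\<bar>" "exp y = (\<Sum>m<2. y ^ m / fact m) + exp t / fact 2 * y ^ 2"
    using Maclaurin_exp_le[of y 2] by blast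
  have "exp t \<le> exp (ln (1 + \<kappa>))" using t(1) assms(1) by (subst exp_le_cancel_iff) linarith
  then have "exp t * y\<^sup>2 \<le> (1 + \<kappa>) * y\<^sup>2" using assms(2) by (intro mult_right_mono) auto
  then show ?thesis using t(2) by (simp add: numeral_2_eq_2 fact_numeral)
qed

text \<open>A centred two-point variable: value 1 with probability b and -b / (1 - b) otherwise, of
  variance b / (1 - b). The condition b \<le> 1/2 keeps the second value within [-1, 0], so both
  exponents stay in the range of the quadratic bound.\<close>

lemma cent_mgf:
  assumes b: "0 < b" "b \<le> 1/2" and h: "\<bar>h\<bar> \<le> ln (1 + \<kappa>)" "\<kappa> > 0"
  shows "(\<integral>\<^sup>+x. ennreal (exp (h * cent b x)) \<partial>\<nu>) \<le> ennreal (exp ((1 + \<kappa>) * h\<^sup>2 * b / (2 * (1 - b))))"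
proof -
  define r where "r = b / (1 - b)"
  have r: "0 \<le> r" "r \<le> 1" "(1 - b) * r = b" using b by (auto simp: r_def field_simps)
  have r1: "1 - 1 / (1 - b) = - r" using b by (simp add: r_def field_simps)
  have "(\<integral>\<^sup>+x. ennreal (exp (h * cent b x)) \<partial>\<nu>) =
    (\<integral>\<^sup>+x. ennreal (exp h) * indicator {..<b} x + ennreal (exp (h * (- r))) * indicator {b..} x \<partial>\<nu>)"
    by (intro nn_integral_cong) (auto simp: indicator_def cent_def r1)
  also have "\<dots> = ennreal (exp h) * ennreal b + ennreal (exp (h * (- r))) * ennreal (1 - b)"
    using b by (simp add: nn_integral_add nn_integral_cmult_indicator emeasure_ge emeasure_less)
  also have "\<dots> = ennreal (b * exp h + (1 - b) * exp (- (h * r)))"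
    using b by (simp add: ennreal_mult ennreal_plus mult_ac)
  also have "\<dots> \<le> ennreal (exp ((1 + \<kappa>) * h\<^sup>2 * b / (2 * (1 - b))))"
  proof (rule ennreal_leI)
    have hr: "\<bar>- (h * r)\<bar> \<le> ln (1 + \<kappa>)"
      using r mult_mono[OF order_refl[of "\<bar>h\<bar>"] r(2)] h(1) by (auto simp: abs_mult)
    have "b * exp h + (1 - b) * exp (- (h * r)) \<le>
      b * (1 + h + (1 + \<kappa>) * h\<^sup>2 / 2) + (1 - b) * (1 + (- (h * r)) + (1 + \<kappa>) * (- (h * r))\<^sup>2 / 2)"
      using b by (intro add_mono mult_left_mono exp_quadratic_bound hr h) auto
    also have "\<dots> = 1 + h * (b - (1 - b) * r) + (1 + \<kappa>) * h\<^sup>2 / 2 * (b + ((1 - b) * r) * r)"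
      by (simp add: power2_eq_square algebra_simps add_divide_distrib diff_divide_distrib)
    also have "\<dots> = 1 + (1 + \<kappa>) * h\<^sup>2 / 2 * (b + b * r)" unfolding r(3) by simp
    also have "b + b * r = b / (1 - b)" using b by (simp add: r_def field_simps)
    also have "1 + (1 + \<kappa>) * h\<^sup>2 / 2 * (b / (1 - b)) \<le> exp ((1 + \<kappa>) * h\<^sup>2 / 2 * (b / (1 - b)))" by (rule exp_ge_add_one_self)
    also have "(1 + \<kappa>) * h\<^sup>2 / 2 * (b / (1 - b)) = (1 + \<kappa>) * h\<^sup>2 * b / (2 * (1 - b))" by simp
    finally show "b * exp h + (1 - b) * exp (- (h * r)) \<le> exp ((1 + \<kappa>) * h\<^sup>2 * b / (2 * (1 - b)))" .
  qed
  finally show ?thesis .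
qed

text \<open>The exponents h and -h control the two tails, and \<open>cent_mgf\<close> treats them
  alike; hence the factor 2.\<close>

lemma cent_sum_block:
  assumes ab: "0 < a" "a < b" "b \<le> 1/2" and h: "0 < h" "h \<le> ln (1 + \<kappa>)" "\<kappa> > 0"
  obtains B where "B \<in> sets (sample n)"
    "emeasure (sample n) B \<le> ennreal (2 * exp (- h * x + real n * ((1 + \<kappa>) * h\<^sup>2 * b / (2 * (1 - b)))))"
    "\<And>\<omega> u. \<omega> \<in> space (sample n) - B \<Longrightarrow> a < u \<Longrightarrow> u \<le> b \<Longrightarrow> \<bar>cent_sum n u \<omega>\<bar> \<le> x"
proof -
  let ?e = "(1 + \<kappa>) * h\<^sup>2 * b / (2 * (1 - b))"
  have bd: "ennreal (exp (- (h * x))) * (\<integral>\<^sup>+\<omega>. ennreal (exp (g * cent_sum n b \<omega>)) \<partial>sample n) \<le> ennreal (exp (- h * x + real n * ?e))"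
    if "g = h \<or> g = - h" for g
  proof -
    have "\<bar>g\<bar> \<le> ln (1 + \<kappa>)" "g\<^sup>2 = h\<^sup>2" using that h by auto
    then have "(\<integral>\<^sup>+x. ennreal (exp (g * cent b x)) \<partial>\<nu>) \<le> ennreal (exp ?e)"
      using cent_mgf[of b g \<kappa>] ab h by simp
    then have "(\<integral>\<^sup>+\<omega>. ennreal (exp (g * cent_sum n b \<omega>)) \<partial>sample n) \<le> ennreal (exp ?e) ^ n"
      unfolding cent_sum_exp_integral by (rule power_mono) simp
    also have "\<dots> = ennreal (exp (real n * ?e))" by (simp only: ennreal_power exp_of_nat_mult exp_ge_zero)
    finally have "ennreal (exp (- (h * x))) * (\<integral>\<^sup>+\<omega>. ennreal (exp (g * cent_sum n b \<omega>)) \<partial>sample n) \<le> ennreal (exp (- (h * x))) * ennreal (exp (real n * ?e))"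
      by (rule mult_left_mono) simp
    then show ?thesis by (simp add: ennreal_mult[symmetric] exp_add[symmetric])
  qed
  obtain B1 where B1: "B1 \<in> sets (sample n)"
    "emeasure (sample n) B1 \<le> ennreal (exp (- (h * x))) * (\<integral>\<^sup>+\<omega>. ennreal (exp (h * cent_sum n b \<omega>)) \<partial>sample n)"
    "\<And>\<omega> u. \<omega> \<in> space (sample n) - B1 \<Longrightarrow> a < u \<Longrightarrow> u \<le> b \<Longrightarrow> h * cent_sum n u \<omega> \<le> h * x"
    using cent_sum_maximal[of a b n "h * x" h] ab by auto
  obtain B2 where B2: "B2 \<in> sets (sample n)"
    "emeasure (sample n) B2 \<le> ennreal (exp (- (h * x))) * (\<integral>\<^sup>+\<omega>. ennreal (exp ((- h) * cent_sum n b \<omega>)) \<partial>sample n)"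
    "\<And>\<omega> u. \<omega> \<in> space (sample n) - B2 \<Longrightarrow> a < u \<Longrightarrow> u \<le> b \<Longrightarrow> (- h) * cent_sum n u \<omega> \<le> h * x"
    using cent_sum_maximal[of a b n "h * x" "- h"] ab by auto
  show thesis
  proof (rule that[of "B1 \<union> B2"])
    have "emeasure (sample n) (B1 \<union> B2) \<le> emeasure (sample n) B1 + emeasure (sample n) B2"
      by (rule emeasure_subadditive[OF B1(1) B2(1)])
    also have "\<dots> \<le> ennreal (exp (- h * x + real n * ?e)) + ennreal (exp (- h * x + real n * ?e))"
      by (intro add_mono order_trans[OF B1(2) bd] order_trans[OF B2(2) bd]) auto
    also have "\<dots> = ennreal (2 * exp (- h * x + real n * ?e))" by (subst ennreal_plus[symmetric]) auto
    finally show "emeasure (sample n) (B1 \<union> B2) \<le> ennreal (2 * exp (- h * x + real n * ?e))" .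
  next
    fix \<omega> u assume w: "\<omega> \<in> space (sample n) - (B1 \<union> B2)" "a < u" "u \<le> b"
    have "h * cent_sum n u \<omega> \<le> h * x" "h * (- cent_sum n u \<omega>) \<le> h * x" using B1(3) B2(3) w by auto
    then show "\<bar>cent_sum n u \<omega>\<bar> \<le> x" using h(1) by (auto simp only: mult_le_cancel_left_pos abs_le_iff)
  qed (use B1 B2 in auto)
qed

text \<open>The first term of the bound comes from the optimal exponent, used when \<open>n b\<close> is large against
  \<open>l\<^sup>2\<close>; the second one from a constant exponent, used otherwise.\<close>
lemma empirical_block:
  assumes n: "n \<ge> 1" and b: "0 < b" "b \<le> 1/2" and k: "0 < \<kappa>" "\<kappa> \<le> 1" and l: "l > 0"
  obtains B where "B \<in> sets (sample n)"
    "emeasure (sample n) B \<le> ennreal (2 * exp (- (l\<^sup>2 / (2 * (1 + \<kappa>)\<^sup>2))) + 96 / (ln (1 + \<kappa>) * l * sqrt (real n * b)))"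
    "\<And>\<omega> u. \<omega> \<in> space (sample n) - B \<Longrightarrow> b / (1 + \<kappa> / 2) < u \<Longrightarrow> u \<le> b \<Longrightarrow>
       \<bar>real (count_less n u \<omega>) - real n * u\<bar> \<le> l * sqrt (real n * u * (1 - u))"
proof -
  define h0 where "h0 = ln (1 + \<kappa>)"
  \<comment> \<open>Half of \<kappa> is spent on the block ratio, the other half on the variation of
    1 / (1 - u) over the block; together b / (1 - b) is at most 1 + \<kappa> times a / (1 -
    a).\<close>
  define q where "q = 1 + \<kappa> / 2"
  define a where "a = b / q"
  \<comment> \<open>The envelope u / (1 - u) is smallest at the left end of the block, so a uniform
    bound by x serves every u in it.\<close>
  define x where "x = l * sqrt (real n * (a / (1 - a)))"
  define nb where "nb = real n * b"
  have h0: "h0 > 0" using k by (simp add: h0_def)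
  have q: "q > 1" "q \<le> 3/2" using k by (auto simp: q_def)
  have a: "0 < a" "a < b" using b q by (auto simp: a_def field_simps)
  have nb: "nb > 0" using n b by (simp add: nb_def)
  have ex: "\<exists>h. 0 < h \<and> h \<le> h0 \<and> 2 * exp (- h * x + real n * ((1 + \<kappa>) * h\<^sup>2 * b / (2 * (1 - b)))) \<le>
     2 * exp (- (l\<^sup>2 / (2 * (1 + \<kappa>)\<^sup>2))) + 96 / (h0 * l * sqrt nb)"
  \<comment> \<open>The condition keeps the optimal h below h0, that is, inside the range where the
    quadratic bound on exp holds.\<close>
  proof (cases "nb \<ge> 2 * l\<^sup>2 / h0\<^sup>2")
    case True
    define s where "s = real n * (b / (1 - b))"
    have s: "s > 0" "s \<ge> nb" using n b by (auto simp: s_def nb_def field_simps)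
    have x2: "x\<^sup>2 = l\<^sup>2 * (real n * (a / (1 - a)))" and x0: "x > 0" using a b l n by (auto simp: x_def power_mult_distrib)
    \<comment> \<open>The minimiser of - h * x + (1 + \<kappa>) * h^2 * s / 2.\<close>
    define h where "h = x / (s * (1 + \<kappa>))"
    have "h > 0" using x0 s k by (simp add: h_def)
    moreover have "h \<le> h0"
    proof -
      have "a / (1 - a) \<le> b / (1 - b)" using a b by (intro frac_le) auto
      also have "\<dots> \<le> 2 * b" using b by (simp add: field_simps)
      finally have "x\<^sup>2 \<le> l\<^sup>2 * (real n * (2 * b))" unfolding x2 by (intro mult_left_mono) auto
      also have "\<dots> = 2 * l\<^sup>2 * nb" by (simp add: nb_def)
      also have "\<dots> \<le> h0\<^sup>2 * nb * nb" using True nb h0 by (intro mult_right_mono) (auto simp: pos_divide_le_eq mult.commute)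
      also have "\<dots> = (h0 * nb)\<^sup>2" by (simp add: power2_eq_square)
      finally have x2le: "x\<^sup>2 \<le> (h0 * nb)\<^sup>2" .
      have "x \<le> h0 * nb" by (rule power2_le_imp_le[OF x2le]) (use h0 nb in simp)
      also have "\<dots> \<le> h0 * (s * (1 + \<kappa>))"
        using s k h0 mult_left_mono[of 1 "1 + \<kappa>" s] by (intro mult_left_mono order_trans[OF s(2)]) auto
      finally show ?thesis using s k by (simp add: h_def pos_divide_le_eq)
    qed
    moreover have "- h * x + real n * ((1 + \<kappa>) * h\<^sup>2 * b / (2 * (1 - b))) \<le> - (l\<^sup>2 / (2 * (1 + \<kappa>)\<^sup>2))"
    proof -
      have "real n * ((1 + \<kappa>) * h\<^sup>2 * b / (2 * (1 - b))) = (1 + \<kappa>) * h\<^sup>2 * s / 2"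
        by (simp add: s_def mult_ac)
      also have "\<dots> = h * x / 2" using s k by (simp add: h_def power2_eq_square)
      finally have "- h * x + real n * ((1 + \<kappa>) * h\<^sup>2 * b / (2 * (1 - b))) = - (x\<^sup>2 / (2 * (s * (1 + \<kappa>))))"
        by (simp add: h_def power2_eq_square)
      also have "\<dots> \<le> - (l\<^sup>2 / (2 * (1 + \<kappa>)\<^sup>2))"
      proof -
        have "b / (1 - b) \<le> (1 + \<kappa>) * (a / (1 - a))"
        proof -
          have "b * (1 - a) \<le> (1 + \<kappa>) * a * (1 - b)"
          proof -
            have "b = q * a" using q by (simp add: a_def)
            have qa: "q * a = b" using \<open>b = q * a\<close> by simp
            have "(1 + \<kappa>) * (1 - b) - q * (1 - a) = (1 + \<kappa>) - q - (1 + \<kappa>) * b + q * a" by (simp only: algebra_simps)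
            also have "\<dots> = \<kappa> / 2 - \<kappa> * b" unfolding qa by (simp add: q_def algebra_simps)
            also have "\<dots> \<ge> 0" using b k by (simp add: field_simps)
            finally have "q * (1 - a) \<le> (1 + \<kappa>) * (1 - b)" by simp
            from mult_left_mono[OF this, of a] show ?thesis using a \<open>b = q * a\<close> by (simp add: mult_ac)
          qed
          then show ?thesis using a b by (simp add: field_simps)
        qed
        then have "s \<le> (1 + \<kappa>) * (real n * (a / (1 - a)))" unfolding s_def
          using mult_left_mono[of "b / (1 - b)" "(1 + \<kappa>) * (a / (1 - a))" "real n"] by (simp add: mult_ac)
        then have "l\<^sup>2 * s \<le> l\<^sup>2 * ((1 + \<kappa>) * (real n * (a / (1 - a))))" by (intro mult_left_mono) auto
        then have "l\<^sup>2 * s \<le> (1 + \<kappa>) * x\<^sup>2" unfolding x2 by (simp add: mult_ac)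
        then have "l\<^sup>2 * (2 * (s * (1 + \<kappa>))) \<le> x\<^sup>2 * (2 * (1 + \<kappa>)\<^sup>2)"
          using k mult_right_mono[of "l\<^sup>2 * s" "(1 + \<kappa>) * x\<^sup>2" "2 * (1 + \<kappa>)"] by (simp add: power2_eq_square mult_ac)
        then have "l\<^sup>2 / (2 * (1 + \<kappa>)\<^sup>2) \<le> x\<^sup>2 / (2 * (s * (1 + \<kappa>)))"
          using s k by (subst frac_le_eq) (auto simp: divide_nonpos_pos)
        then show ?thesis by simp
      qed
      finally show ?thesis .
    qed
    moreover have "0 \<le> 96 / (h0 * l * sqrt nb)" using h0 l nb by simp
    ultimately show ?thesis by (intro exI[of _ h]) (auto intro!: add_increasing2)
  next
    case False
    \<comment> \<open>The divisor 12 makes the quadratic term at most half of the linear one: 2 * h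
      * y = h0 * y / 6 is at most l / 4, while h * x is at least h * l * y / 2.\<close>
    define h where "h = h0 / 12"
    define y where "y = sqrt nb"
    have y: "y > 0" "y\<^sup>2 = nb" using nb by (auto simp: y_def)
    have hy: "h0 * y \<le> (3/2) * l"
    proof -
      have "(h0 * y)\<^sup>2 \<le> 2 * l\<^sup>2" using False h0 unfolding power_mult_distrib y(2) by (simp add: field_simps)
      also have "\<dots> \<le> ((3/2) * l)\<^sup>2" by (simp add: power2_eq_square)
      finally show ?thesis by (rule power2_le_imp_le) (use l in simp)
    qed
    have xy: "x \<ge> l * y / 2"
    proof -
      have "nb / 4 \<le> real n * (a / (1 - a))"
      proof -
        have "b / 4 \<le> a" using q b by (auto simp: a_def field_simps)
        also have "a \<le> a / (1 - a)" using a b by (simp add: field_simps)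
        finally show ?thesis unfolding nb_def using mult_left_mono[of "b / 4" "a / (1 - a)" "real n"] by simp
      qed
      then have "sqrt (nb / 4) \<le> sqrt (real n * (a / (1 - a)))" by (rule real_sqrt_le_mono)
      then have "l * sqrt (nb / 4) \<le> x" using l by (simp add: x_def)
      then show ?thesis by (simp add: y_def real_sqrt_divide)
    qed
    have "real n * ((1 + \<kappa>) * h\<^sup>2 * b / (2 * (1 - b))) \<le> 2 * h\<^sup>2 * nb"
    proof -
      have "(1 + \<kappa>) / (2 * (1 - b)) \<le> 2" using k b by (simp add: field_simps)
      then have "(h\<^sup>2 * nb) * ((1 + \<kappa>) / (2 * (1 - b))) \<le> (h\<^sup>2 * nb) * 2" using nb by (intro mult_left_mono) auto
      then show ?thesis by (simp add: nb_def mult_ac)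
    qed
    also have "\<dots> = h * y * (2 * h * y)" using y by (simp add: power2_eq_square)
    also have "\<dots> \<le> h * y * (l / 4)" using hy h0 y by (intro mult_left_mono) (auto simp: h_def)
    finally have e1: "real n * ((1 + \<kappa>) * h\<^sup>2 * b / (2 * (1 - b))) \<le> h * y * (l / 4)" .
    have e2: "h * (l * y / 2) \<le> h * x" using mult_left_mono[OF xy, of h] h0 by (simp add: h_def)
    have e3: "E \<le> h * y * (l / 4) \<Longrightarrow> - h * x + E \<le> - (h * l * y / 4)" for E
      using e2 by (simp add: algebra_simps)
    have "- h * x + real n * ((1 + \<kappa>) * h\<^sup>2 * b / (2 * (1 - b))) \<le> - (h * l * y / 4)"
      by (rule e3[OF e1])
    then have "exp (- h * x + real n * ((1 + \<kappa>) * h\<^sup>2 * b / (2 * (1 - b)))) \<le> exp (- (h * l * y / 4))" by simp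
    \<comment> \<open>This crude bound decays like 1 / sqrt (n * b), which is enough for a geometric
      sum over the blocks.\<close>
    also have "\<dots> \<le> 1 / (h * l * y / 4)"
    proof -
      have "h * l * y / 4 > 0" using h0 l y by (simp add: h_def)
      moreover have "h * l * y / 4 \<le> exp (h * l * y / 4)" using exp_ge_add_one_self[of "h * l * y / 4"] by linarith
      ultimately show ?thesis by (simp add: exp_minus field_simps)
    qed
    also have "\<dots> = 48 / (h0 * l * y)" by (simp add: h_def)
    finally have "2 * exp (- h * x + real n * ((1 + \<kappa>) * h\<^sup>2 * b / (2 * (1 - b)))) \<le> 96 / (h0 * l * y)" by simp
    then show ?thesis using h0 by (intro exI[of _ h]) (auto simp: h_def y_def intro!: add_increasing)
  qed
  then obtain h where h: "0 < h" "h \<le> h0"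
    "2 * exp (- h * x + real n * ((1 + \<kappa>) * h\<^sup>2 * b / (2 * (1 - b)))) \<le> 2 * exp (- (l\<^sup>2 / (2 * (1 + \<kappa>)\<^sup>2))) + 96 / (h0 * l * sqrt nb)"
    by blast
  obtain B where B: "B \<in> sets (sample n)"
    "emeasure (sample n) B \<le> ennreal (2 * exp (- h * x + real n * ((1 + \<kappa>) * h\<^sup>2 * b / (2 * (1 - b)))))"
    "\<And>\<omega> u. \<omega> \<in> space (sample n) - B \<Longrightarrow> a < u \<Longrightarrow> u \<le> b \<Longrightarrow> \<bar>cent_sum n u \<omega>\<bar> \<le> x"
    using cent_sum_block[of a b h \<kappa> n x] a b h k unfolding h0_def by blast
  show thesis
  proof (rule that[OF B(1)])
    show "emeasure (sample n) B \<le> ennreal (2 * exp (- (l\<^sup>2 / (2 * (1 + \<kappa>)\<^sup>2))) + 96 / (ln (1 + \<kappa>) * l * sqrt (real n * b)))"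
      using order_trans[OF B(2) ennreal_leI[OF h(3)]] by (simp add: h0_def nb_def)
  next
    fix \<omega> u assume w: "\<omega> \<in> space (sample n) - B" and u': "b / (1 + \<kappa> / 2) < u" "u \<le> b"
    have u: "a < u" "u \<le> b" "0 < u" "u < 1" using u' a b by (auto simp: a_def q_def)
    have "\<bar>real (count_less n u \<omega>) - real n * u\<bar> / (1 - u) \<le> x"
      using B(3)[OF w u(1,2)] u by (simp add: cent_sum_eq abs_divide)
    then have "\<bar>real (count_less n u \<omega>) - real n * u\<bar> \<le> x * (1 - u)" using u by (simp add: field_simps)
    also have "\<dots> \<le> l * sqrt (real n * (u / (1 - u))) * (1 - u)"
      unfolding x_def using u a l by (intro mult_right_mono mult_left_mono real_sqrt_le_mono frac_le) auto
    also have "\<dots> = l * sqrt (real n * (u / (1 - u)) * (1 - u)\<^sup>2)"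
      using u by (simp only: real_sqrt_mult real_sqrt_abs)
    also have "real n * (u / (1 - u)) * (1 - u)\<^sup>2 = real n * u * (1 - u)"
      using u by (simp add: power2_eq_square)
    finally show "\<bar>real (count_less n u \<omega>) - real n * u\<bar> \<le> l * sqrt (real n * u * (1 - u))" .
  qed
qed

end

text \<open>The three terms are: the chance of an observation below 1 / (n * sqrt l); the number of
  blocks times the cost of one block at the optimal exponent; and the geometric sum of the
  constant-exponent costs.\<close>

definition emp_bound :: "real \<Rightarrow> real \<Rightarrow> real \<Rightarrow> real" where
  "emp_bound \<kappa> l n = 1 / sqrt l
     + 2 * (log (1 + \<kappa> / 2) (n * sqrt l) + 1) * exp (- (l\<^sup>2 / (2 * (1 + \<kappa>)\<^sup>2)))
     + 96 / (ln (1 + \<kappa>) * l) * (sqrt (2 * (1 + \<kappa> / 2) * sqrt l) / (sqrt (1 + \<kappa> / 2) - 1))"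

section \<open>From single blocks to all levels below 1/2\<close>

context uniform_law
begin

lemma emeasure_exists_less:
  assumes u: "0 < u" "u < 1"
  shows "{\<omega>\<in>space (sample n). \<exists>i<n. \<omega> i < u} \<in> sets (sample n)"
    "emeasure (sample n) {\<omega>\<in>space (sample n). \<exists>i<n. \<omega> i < u} \<le> ennreal (real n * u)"
proof -
  interpret P: product_prob_space "\<lambda>_::nat. \<nu>" "{..<n}" by (intro product_prob_spaceI) unfold_locales
  have e: "{\<omega>\<in>space (sample n). \<exists>i<n. \<omega> i < u} = (\<Union>i\<in>{..<n}. {\<omega>\<in>space (sample n). \<omega> i \<in> {..<u}})" by auto
  have m: "{\<omega>\<in>space (sample n). \<omega> i \<in> {..<u}} \<in> sets (sample n)" if "i < n" for i
    by measurable (use that in simp)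
  then show "{\<omega>\<in>space (sample n). \<exists>i<n. \<omega> i < u} \<in> sets (sample n)" unfolding e by auto
  have "emeasure (sample n) {\<omega>\<in>space (sample n). \<exists>i<n. \<omega> i < u} \<le> (\<Sum>i<n. emeasure (sample n) {\<omega>\<in>space (sample n). \<omega> i \<in> {..<u}})"
    unfolding e using m by (intro emeasure_subadditive_finite) auto
  also have "\<dots> = (\<Sum>i<n. ennreal u)"
  proof (rule sum.cong[OF refl])
    fix i assume "i \<in> {..<n}"
    then show "emeasure (sample n) {\<omega>\<in>space (sample n). \<omega> i \<in> {..<u}} = ennreal u"
      by (subst P.emeasure_PiM_Collect_single) (auto simp: emeasure_less u)
  qed
  also have "\<dots> = ennreal (real n * u)" using u by (simp add: ennreal_mult' ennreal_of_nat_eq_real_of_nat)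
  finally show "emeasure (sample n) {\<omega>\<in>space (sample n). \<exists>i<n. \<omega> i < u} \<le> ennreal (real n * u)" .
qed

text \<open>Blocks with right ends 1 / (2 * q ^ i) cover the levels down to v = 1 / (n * sqrt l).
  Below v there is no observation outside an event of probability 1 / sqrt l, and then the deviation
  n * u \<le> 1 lies within the envelope by itself because l \<ge> 2.\<close>

lemma empirical_lower_half:
  assumes n: "n \<ge> 1" and k: "0 < \<kappa>" "\<kappa> \<le> 1" and l: "l \<ge> 2"
  obtains B where "B \<in> sets (sample n)" "emeasure (sample n) B \<le> ennreal (emp_bound \<kappa> l (real n))"
    "\<And>\<omega> u. \<omega> \<in> space (sample n) - B \<Longrightarrow> 0 < u \<Longrightarrow> u \<le> 1/2 \<Longrightarrow>
       \<bar>real (count_less n u \<omega>) - real n * u\<bar> \<le> l * sqrt (real n * u * (1 - u))"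
proof -
  define q where "q = 1 + \<kappa> / 2"
  have q: "q > 1" using k by (simp add: q_def)
  define y where "y = real n * sqrt l"
  have sl: "sqrt l > 1" using l by (simp add: real_less_rsqrt)
  have n': "real n \<ge> 1" using n by simp
  have y: "y > 1" using mult_mono[OF n' less_imp_le[OF sl]] sl n' unfolding y_def
    by (metis less_le_trans mult_1 mult_right_mono order_less_imp_le zero_le_one le_less_trans order.trans)
  \<comment> \<open>Enough blocks to pass v, since 1 / (2 * q ^ K) < 1 / y. Rounding overshoots by
    at most one factor q, which keeps the geometric sum small.\<close>
  define K where "K = nat \<lceil>log q y\<rceil>"
  have lq: "log q y > 0" using y q by simp
  have K1: "real K \<le> log q y + 1" and K2: "real K \<ge> log q y" using lq unfolding K_def by linarith+
  have qK: "q ^ K \<ge> y" "q ^ K \<le> q * y"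
  proof -
    have "y = q powr (log q y)" using y q by simp
    also have "\<dots> \<le> q powr (real K)" using q K2 by (intro powr_mono) auto
    finally show "q ^ K \<ge> y" using q by (simp add: powr_realpow)
    have "q powr real K \<le> q powr (log q y + 1)" using q K1 by (intro powr_mono) auto
    also have "\<dots> = q * y" using y q by (simp add: powr_add)
    finally show "q ^ K \<le> q * y" using q by (simp add: powr_realpow)
  qed
  define b where "b i = 1 / (2 * q ^ i)" for i :: nat
  have b: "0 < b i" "b i \<le> 1/2" for i using q by (auto simp: b_def field_simps)
  have bS: "b i / q = b (Suc i)" for i by (simp add: b_def)
  define e1 where "e1 = 2 * exp (- (l\<^sup>2 / (2 * (1 + \<kappa>)\<^sup>2)))"
  define e2 where "e2 = 96 / (ln (1 + \<kappa>) * l)"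
  have e2: "e2 > 0" using l k by (simp add: e2_def)
  have "\<exists>B. B \<in> sets (sample n) \<and> emeasure (sample n) B \<le> ennreal (e1 + e2 / sqrt (real n * b i)) \<and>
     (\<forall>\<omega>\<in>space (sample n) - B. \<forall>u. b (Suc i) < u \<and> u \<le> b i \<longrightarrow>
       \<bar>real (count_less n u \<omega>) - real n * u\<bar> \<le> l * sqrt (real n * u * (1 - u)))" for i
  proof -
    obtain B where "B \<in> sets (sample n)"
      "emeasure (sample n) B \<le> ennreal (2 * exp (- (l\<^sup>2 / (2 * (1 + \<kappa>)\<^sup>2))) + 96 / (ln (1 + \<kappa>) * l * sqrt (real n * b i)))"
      "\<And>\<omega> u. \<omega> \<in> space (sample n) - B \<Longrightarrow> b i / (1 + \<kappa> / 2) < u \<Longrightarrow> u \<le> b i \<Longrightarrow>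
       \<bar>real (count_less n u \<omega>) - real n * u\<bar> \<le> l * sqrt (real n * u * (1 - u))"
      using empirical_block[OF n b k, of l i] l by auto
    then show ?thesis by (intro exI[of _ B]) (auto simp: e1_def e2_def bS[symmetric] q_def)
  qed
  then obtain Bs where Bs: "\<And>i. Bs i \<in> sets (sample n)"
     "\<And>i. emeasure (sample n) (Bs i) \<le> ennreal (e1 + e2 / sqrt (real n * b i))"
     "\<And>i \<omega> u. \<omega>\<in>space (sample n) - Bs i \<Longrightarrow> b (Suc i) < u \<Longrightarrow> u \<le> b i \<Longrightarrow>
       \<bar>real (count_less n u \<omega>) - real n * u\<bar> \<le> l * sqrt (real n * u * (1 - u))"
    by metis
  define v where "v = 1 / y"
  have v: "0 < v" "v < 1" using y by (auto simp: v_def)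
  define B0 where "B0 = {\<omega>\<in>space (sample n). \<exists>i<n. \<omega> i < v}"
  have B0: "B0 \<in> sets (sample n)" "emeasure (sample n) B0 \<le> ennreal (1 / sqrt l)"
    using emeasure_exists_less[OF v, of n] n by (auto simp: B0_def v_def y_def)
  have bK: "b K < v" using qK(1) y by (auto simp: b_def v_def intro!: divide_strict_left_mono)
  show thesis
  proof (rule that)
    show "B0 \<union> (\<Union>i<K. Bs i) \<in> sets (sample n)" using B0 Bs by auto
    have "emeasure (sample n) (B0 \<union> (\<Union>i<K. Bs i)) \<le> emeasure (sample n) B0 + (\<Sum>i<K. emeasure (sample n) (Bs i))"
      using B0 Bs by (intro order_trans[OF emeasure_subadditive] add_left_mono emeasure_subadditive_finite) auto
    also have "\<dots> \<le> ennreal (1 / sqrt l) + (\<Sum>i<K. ennreal (e1 + e2 / sqrt (real n * b i)))"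
      by (intro add_mono sum_mono B0 Bs)
    also have "\<dots> = ennreal (1 / sqrt l + (\<Sum>i<K. e1 + e2 / sqrt (real n * b i)))"
    proof -
      have nn: "0 \<le> e1 + e2 / sqrt (real n * b i)" for i
        using e2 b[of i] by (simp add: e1_def)
      show ?thesis using nn l by (simp add: sum_ennreal sum_nonneg)
    qed
    also have "\<dots> \<le> ennreal (emp_bound \<kappa> l (real n))"
    proof (rule ennreal_leI)
      define w where "w = sqrt q"
      have w: "w > 1" using q by (simp add: w_def)
      have "1 / sqrt (real n * b i) = sqrt (2 / real n) * w ^ i" for i
        using q n by (simp add: b_def w_def real_sqrt_divide real_sqrt_mult real_sqrt_power)
      then have "(\<Sum>i<K. e1 + e2 / sqrt (real n * b i)) = real K * e1 + e2 * (sqrt (2 / real n) * (\<Sum>i<K. w ^ i))"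
        by (simp add: sum.distrib sum_distrib_left divide_inverse mult.assoc) 
      also have "(\<Sum>i<K. w ^ i) = (w ^ K - 1) / (w - 1)" using w by (intro geometric_sum) auto
      also have "real K * e1 + e2 * (sqrt (2 / real n) * ((w ^ K - 1) / (w - 1))) \<le>
        (log q y + 1) * e1 + e2 * (sqrt (2 / real n) * (w ^ K / (w - 1)))"
        using K1 w e2 by (intro add_mono mult_right_mono mult_left_mono divide_right_mono) (auto simp: e1_def)
      also have "w ^ K = sqrt (q ^ K)" by (simp add: w_def real_sqrt_power)
      also have "sqrt (2 / real n) * (sqrt (q ^ K) / (w - 1)) = sqrt (2 / real n * q ^ K) / (w - 1)"
        by (simp only: real_sqrt_mult times_divide_eq_right)
      \<comment> \<open>The last term of the geometric series dominates, and in it n cancels because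
        q ^ K / n \<le> q * sqrt l. What remains has order l^(1/4), against the factor 1 / l in
        e2.\<close>
      also have "(log q y + 1) * e1 + e2 * (sqrt (2 / real n * q ^ K) / (w - 1)) \<le>
         (log q y + 1) * e1 + e2 * (sqrt (2 * q * sqrt l) / (w - 1))"
      proof (intro add_left_mono mult_left_mono divide_right_mono real_sqrt_le_mono)
        have "2 / real n * q ^ K \<le> 2 / real n * (q * y)" using qK(2) n by (intro mult_left_mono) auto
        also have "\<dots> = 2 * q * sqrt l" using n by (simp add: y_def)
        finally show "2 / real n * q ^ K \<le> 2 * q * sqrt l" .
      qed (use e2 w in auto)
      finally have le: "(\<Sum>i<K. e1 + e2 / sqrt (real n * b i)) \<le> (log q y + 1) * e1 + e2 * (sqrt (2 * q * sqrt l) / (w - 1))" .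
      have "emp_bound \<kappa> l (real n) = 1 / sqrt l + ((log q y + 1) * e1 + e2 * (sqrt (2 * q * sqrt l) / (w - 1)))"
        unfolding emp_bound_def e1_def e2_def y_def w_def q_def by (simp only: mult_ac add_ac)
      then show "1 / sqrt l + (\<Sum>i<K. e1 + e2 / sqrt (real n * b i)) \<le> emp_bound \<kappa> l (real n)"
        using le by simp
    qed
    finally show "emeasure (sample n) (B0 \<union> (\<Union>i<K. Bs i)) \<le> ennreal (emp_bound \<kappa> l (real n))" .
  next
    fix \<omega> and u :: real assume w: "\<omega> \<in> space (sample n) - (B0 \<union> (\<Union>i<K. Bs i))" and u: "0 < u" "u \<le> 1/2"
    show "\<bar>real (count_less n u \<omega>) - real n * u\<bar> \<le> l * sqrt (real n * u * (1 - u))"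
    proof (cases "u \<le> v")
      case True
      have "{i \<in> {..<n}. \<omega> i < u} = {}" using w True by (auto simp: B0_def)
      then have "count_less n u \<omega> = 0" by (simp only: count_less_def card.empty)
      moreover have "real n * u \<le> l * sqrt (real n * u * (1 - u))"
      proof -
        have "real n * u \<le> real n * v" using True by (intro mult_left_mono) auto
        also have "\<dots> = 1 / sqrt l" using n by (simp add: v_def y_def)
        also have "\<dots> \<le> 1" using sl by simp
        finally have nu: "real n * u \<le> 1" .
        have "(real n * u)\<^sup>2 \<le> real n * u * 1" unfolding power2_eq_square using nu u by (intro mult_left_mono) auto
        also have "\<dots> \<le> real n * u * (l\<^sup>2 * (1 - u))"
        proof (rule mult_left_mono)
          have "2 * 2 \<le> l * l" using l by (intro mult_mono) auto
          then have "4 * (1/2) \<le> l\<^sup>2 * (1 - u)" unfolding power2_eq_square using u by (intro mult_mono) auto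
          then show "1 \<le> l\<^sup>2 * (1 - u)" by simp
        qed (use u in simp)
        also have "\<dots> = (l * sqrt (real n * u * (1 - u)))\<^sup>2" using u by (simp add: power_mult_distrib)
        finally have sq: "(real n * u)\<^sup>2 \<le> (l * sqrt (real n * u * (1 - u)))\<^sup>2" .
        show ?thesis by (rule power2_le_imp_le[OF sq]) (use l u in simp)
      qed
      ultimately show ?thesis using u by simp
    next
      case False
      have ex: "\<exists>i. b i < u" using False bK by (intro exI[of _ K]) simp
      \<comment> \<open>The block containing u has its right end at the predecessor of the first b i
        below u; a predecessor exists because b 0 = 1/2.\<close>
      define i where "i = (LEAST i. b i < u)"
      have i1: "b i < u" unfolding i_def by (rule LeastI_ex[OF ex])
      have iK: "i \<le> K" unfolding i_def using False bK by (intro Least_le) auto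
      have "i \<noteq> 0" using i1 u by (auto simp: b_def intro!: gr0I)
      then obtain j where j: "i = Suc j" by (cases i) auto
      have "\<not> b j < u" using j unfolding i_def by (metis lessI not_less_Least)
      then show ?thesis using Bs(3)[of \<omega> j u] w i1 j iK by auto
    qed
  qed
qed


section \<open>Levels above 1/2 by reflection\<close>

lemma prob_atMost: "0 < u \<Longrightarrow> u < 1 \<Longrightarrow> measure \<nu> {..u} = u"
proof (rule antisym)
  assume u: "0 < u" "u < 1"
  have "u = measure \<nu> {..<u}" using u by (simp add: prob_less)
  also have "\<dots> \<le> measure \<nu> {..u}" by (intro finite_measure_mono) auto
  finally show "u \<le> measure \<nu> {..u}" .
  show "measure \<nu> {..u} \<le> u"
  proof (rule dense_ge_bounded[OF u(2)])
    fix w assume w: "u < w" "w < 1"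
    have "measure \<nu> {..u} \<le> measure \<nu> {..<w}" using w by (intro finite_measure_mono) auto
    then show "measure \<nu> {..u} \<le> w" using u w by (simp add: prob_less)
  qed
qed

lemma uniform_law_reflect: "uniform_law (distr \<nu> borel (\<lambda>x. 1 - x))"
proof (intro uniform_law.intro uniform_law_axioms.intro)
  show "prob_space (distr \<nu> borel (\<lambda>x. 1 - x))" by (rule prob_space_distr) simp
  fix u :: real assume u: "0 < u" "u < 1"
  have "measure (distr \<nu> borel (\<lambda>x. 1 - x)) {..<u} = measure \<nu> (space \<nu> - {..1 - u})"
    by (subst measure_distr) (auto intro!: arg_cong2[where f=measure])
  also have "\<dots> = u" using u by (subst prob_compl) (auto simp: prob_atMost)
  finally show "measure (distr \<nu> borel (\<lambda>x. 1 - x)) {..<u} = u" .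
qed simp

text \<open>Reflection turns a strict count into a non-strict one. Letting v decrease to u recovers
  it: for finitely many points, the two conditions agree at all v close enough to u from the
  right.\<close>

lemma count_le_limit:
  fixes u :: real
  assumes u: "0 < u" "u < 1/2"
    and le: "\<And>v. 0 < v \<Longrightarrow> v \<le> 1/2 \<Longrightarrow> \<bar>real (count_less n v \<omega>) - real n * v\<bar> \<le> l * sqrt (real n * v * (1 - v))"
  shows "\<bar>real (card {i\<in>{..<n}. \<omega> i \<le> u}) - real n * u\<bar> \<le> l * sqrt (real n * u * (1 - u))"
proof (rule tendsto_le[OF trivial_limit_at_right_real])
  let ?c = "real (card {i\<in>{..<n}. \<omega> i \<le> u})"
  show "((\<lambda>v. \<bar>?c - real n * v\<bar>) \<longlongrightarrow> \<bar>?c - real n * u\<bar>) (at_right u)" by (intro tendsto_intros)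
  show "((\<lambda>v. l * sqrt (real n * v * (1 - v))) \<longlongrightarrow> l * sqrt (real n * u * (1 - u))) (at_right u)"
    by (intro tendsto_intros)
  have "eventually (\<lambda>v. \<omega> i < v \<longleftrightarrow> \<omega> i \<le> u) (at_right u)" for i
  proof (cases "\<omega> i \<le> u")
    case True then show ?thesis by (auto simp: eventually_at_right_field intro!: exI[of _ "u + 1"])
  next
    case False then show ?thesis by (auto simp: eventually_at_right_field intro!: exI[of _ "\<omega> i"])
  qed
  then have "eventually (\<lambda>v. \<forall>i\<in>{..<n}. \<omega> i < v \<longleftrightarrow> \<omega> i \<le> u) (at_right u)"
    by (intro eventually_ball_finite) auto
  moreover have "eventually (\<lambda>v. u < v \<and> v < 1/2) (at_right u)"
    using u by (auto simp: eventually_at_right_field intro!: exI[of _ "1/2"])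
  ultimately show "eventually (\<lambda>v. \<bar>?c - real n * v\<bar> \<le> l * sqrt (real n * v * (1 - v))) (at_right u)"
  proof eventually_elim
    case (elim v)
    then have "{i\<in>{..<n}. \<omega> i \<le> u} = {i\<in>{..<n}. \<omega> i < v}" by auto
    then show ?case using le[of v] elim u by (simp add: count_less_def)
  qed
qed

text \<open>The deviation in absolute value and u * (1 - u) are symmetric under u -> 1 - u, so the
  upper half is read off the reflected sample, which is again uniform. The lower half is thus
  applied twice, hence the factor 2.\<close>

lemma empirical_uniform:
  assumes n: "n \<ge> 1" and k: "0 < \<kappa>" "\<kappa> \<le> 1" and l: "l \<ge> 2"
  obtains B where "B \<in> sets (sample n)" "emeasure (sample n) B \<le> ennreal (2 * emp_bound \<kappa> l (real n))"
    "\<And>\<omega> u. \<omega> \<in> space (sample n) - B \<Longrightarrow> 0 < u \<Longrightarrow> u < 1 \<Longrightarrow>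
       \<bar>real (count_less n u \<omega>) - real n * u\<bar> \<le> l * sqrt (real n * u * (1 - u))"
proof -
  let ?R = "distr \<nu> borel (\<lambda>x. 1 - x)"
  interpret R: uniform_law ?R by (rule uniform_law_reflect)
  define f where "f = (\<lambda>\<omega>. \<lambda>i\<in>{..<n}. 1 - \<omega> i :: real)"
  have "distr \<nu> ?R (\<lambda>x. 1 - x) = ?R" by (rule distr_cong) auto
  note im = PiM_image[OF finite_lessThan[of n] prob_space_axioms R.prob_space_axioms _ this, folded f_def]
  have fm: "f \<in> measurable (sample n) (\<Pi>\<^sub>M i\<in>{..<n}. ?R)" by (rule im(1)) simp
  obtain B1 where B1: "B1 \<in> sets (sample n)" "emeasure (sample n) B1 \<le> ennreal (emp_bound \<kappa> l (real n))"
    "\<And>\<omega> u. \<omega> \<in> space (sample n) - B1 \<Longrightarrow> 0 < u \<Longrightarrow> u \<le> 1/2 \<Longrightarrow>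
       \<bar>real (count_less n u \<omega>) - real n * u\<bar> \<le> l * sqrt (real n * u * (1 - u))"
    using empirical_lower_half[OF n k l] by blast
  obtain B2 where B2: "B2 \<in> sets (\<Pi>\<^sub>M i\<in>{..<n}. ?R)" "emeasure (\<Pi>\<^sub>M i\<in>{..<n}. ?R) B2 \<le> ennreal (emp_bound \<kappa> l (real n))"
    "\<And>\<omega> u. \<omega> \<in> space (\<Pi>\<^sub>M i\<in>{..<n}. ?R) - B2 \<Longrightarrow> 0 < u \<Longrightarrow> u \<le> 1/2 \<Longrightarrow>
       \<bar>real (R.count_less n u \<omega>) - real n * u\<bar> \<le> l * sqrt (real n * u * (1 - u))"
    using R.empirical_lower_half[OF n k l] by blast
  define B2' where "B2' = f -` B2 \<inter> space (sample n)"
  have B2': "B2' \<in> sets (sample n)" unfolding B2'_def by (rule measurable_sets[OF fm B2(1)])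
  have "emeasure (sample n) B2' = emeasure (\<Pi>\<^sub>M i\<in>{..<n}. ?R) B2"
    unfolding B2'_def by (rule im(2)[OF _ B2(1)]) simp
  then have B2b: "emeasure (sample n) B2' \<le> ennreal (emp_bound \<kappa> l (real n))" using B2(2) by simp
  have nn: "emp_bound \<kappa> l (real n) \<ge> 0"
  proof -
    have "real n * sqrt l \<ge> 1 * 1" using n l by (intro mult_mono) auto
    then show ?thesis unfolding emp_bound_def using k l n
      by (intro add_nonneg_nonneg mult_nonneg_nonneg divide_nonneg_nonneg) auto
  qed
  show thesis
  proof (rule that[of "B1 \<union> B2'"])
    show "B1 \<union> B2' \<in> sets (sample n)" using B1 B2' by auto
    have "emeasure (sample n) (B1 \<union> B2') \<le> emeasure (sample n) B1 + emeasure (sample n) B2'"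
      by (rule emeasure_subadditive[OF B1(1) B2'])
    also have "\<dots> \<le> ennreal (emp_bound \<kappa> l (real n)) + ennreal (emp_bound \<kappa> l (real n))"
      by (intro add_mono B1 B2b)
    also have "\<dots> = ennreal (2 * emp_bound \<kappa> l (real n))" using nn by (subst ennreal_plus[symmetric]) auto
    finally show "emeasure (sample n) (B1 \<union> B2') \<le> ennreal (2 * emp_bound \<kappa> l (real n))" .
  next
    fix \<omega> and u :: real
    assume w: "\<omega> \<in> space (sample n) - (B1 \<union> B2')" and u: "0 < u" "u < 1"
    show "\<bar>real (count_less n u \<omega>) - real n * u\<bar> \<le> l * sqrt (real n * u * (1 - u))"
    proof (cases "u \<le> 1/2")
      case True then show ?thesis using B1(3) w u by auto
    next
      case False
      have fw: "f \<omega> \<in> space (\<Pi>\<^sub>M i\<in>{..<n}. ?R) - B2"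
        using w measurable_space[OF fm, of \<omega>] by (auto simp: B2'_def)
      have "\<bar>real (card {i\<in>{..<n}. f \<omega> i \<le> 1 - u}) - real n * (1 - u)\<bar> \<le> l * sqrt (real n * (1 - u) * (1 - (1 - u)))"
        using u False B2(3)[OF fw] by (intro R.count_le_limit) auto
      moreover have "real (card {i\<in>{..<n}. f \<omega> i \<le> 1 - u}) = real n - real (count_less n u \<omega>)"
      proof -
        have "{i\<in>{..<n}. f \<omega> i \<le> 1 - u} = {..<n} - {i\<in>{..<n}. \<omega> i < u}" by (auto simp: f_def)
        then have "card {i\<in>{..<n}. f \<omega> i \<le> 1 - u} = n - count_less n u \<omega>"
          unfolding count_less_def by (simp only:) (subst card_Diff_subset, auto)
        moreover have "count_less n u \<omega> \<le> n"
          unfolding count_less_def using card_mono[of "{..<n}" "{i\<in>{..<n}. \<omega> i < u}"] by auto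
        ultimately show ?thesis by simp
      qed
      ultimately have "\<bar>real n - real (count_less n u \<omega>) - real n * (1 - u)\<bar> \<le> l * sqrt (real n * (1 - u) * u)" by simp
      moreover have "\<bar>real n - real (count_less n u \<omega>) - real n * (1 - u)\<bar> = \<bar>real (count_less n u \<omega>) - real n * u\<bar>"
        by (simp add: algebra_simps)
      moreover have "real n * (1 - u) * u = real n * u * (1 - u)" by simp
      ultimately show ?thesis by (simp only:)
    qed
  qed
qed

end

subsection \<open>Passing to a continuous law\<close>

text \<open>Probability integral transform with the tail function: S maps the sample to a uniform
  one and, being strictly decreasing, turns exceedances of t into values below S t.\<close>

lemma empirical_continuous:
  fixes \<nu> :: "real measure" and S :: "real \<Rightarrow> real"
  assumes "prob_space \<nu>" and sets: "sets \<nu> = sets borel"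
    and S: "\<And>t. S t = measure \<nu> {t<..}" and cont: "\<And>t. measure \<nu> {t} = 0"
    and decr: "\<And>t t'. t < t' \<Longrightarrow> S t' < S t"
    and n: "n \<ge> 1" and k: "0 < \<kappa>" "\<kappa> \<le> 1" and l: "l \<ge> 2"
  obtains B where "B \<in> sets (\<Pi>\<^sub>M i\<in>{..<n}. \<nu>)" "emeasure (\<Pi>\<^sub>M i\<in>{..<n}. \<nu>) B \<le> ennreal (2 * emp_bound \<kappa> l (real n))"
    "\<And>\<omega> t. \<omega> \<in> space (\<Pi>\<^sub>M i\<in>{..<n}. \<nu>) - B \<Longrightarrow>
       \<bar>real (card {i\<in>{..<n}. \<omega> i > t}) - real n * S t\<bar> \<le> l * sqrt (real n * S t * (1 - S t))"
proof -
  have sp: "space \<nu> = UNIV" using sets_eq_imp_space_eq[OF sets] by simp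
  interpret prob_space \<nu> by fact
  interpret rd: real_distribution \<nu> by (intro real_distribution.intro real_distribution_axioms.intro) (use sp sets assms(1) in auto)
  have Sc: "S t = 1 - cdf \<nu> t" for t
  proof -
    have "measure \<nu> (space \<nu> - {..t}) = 1 - measure \<nu> {..t}" by (rule prob_compl) (simp add: sets)
    moreover have "space \<nu> - {..t} = {t<..}" using sp by auto
    ultimately show ?thesis by (simp add: S cdf_def)
  qed
  have Scont: "isCont S t" for t
    unfolding Sc[abs_def] by (intro continuous_intros) (simp add: rd.isCont_cdf cont)
  have S01: "0 < S t" "S t < 1" for t
    using decr[of t "t + 1"] decr[of "t - 1" t] measure_nonneg[of \<nu> "{t + 1<..}"] prob_le_1[of "{t - 1<..}"]
    unfolding S by linarith+
  have less_iff: "S x < S t \<longleftrightarrow> t < x" for x t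
    using decr[of t x] decr[of x t] by (cases "t < x"; cases "x < t") auto
  \<comment> \<open>Absence of atoms makes S continuous, so by the intermediate value theorem every
    u in (0, 1) is a tail probability.\<close>
  have range: "\<exists>t. S t = u" if u: "0 < u" "u < 1" for u
  proof -
    have "eventually (\<lambda>t. cdf \<nu> t > 1 - u) at_top" using rd.cdf_lim_at_top_prob u by (intro order_tendstoD) auto
    then obtain t1 where "cdf \<nu> t1 > 1 - u" by (auto simp: eventually_at_top_linorder)
    then have t1: "S t1 < u" by (simp add: Sc)
    have "eventually (\<lambda>t. cdf \<nu> t < 1 - u) at_bot" using rd.cdf_lim_at_bot u by (intro order_tendstoD) auto
    then obtain t0 where "cdf \<nu> t0 < 1 - u" by (auto simp: eventually_at_bot_linorder)
    then have t0: "S t0 > u" by (simp add: Sc)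
    have "t0 \<le> t1" using t0 t1 less_iff[of t1 t0] by linarith
    then show ?thesis using IVT2[of S t1 u t0] t0 t1 Scont by auto
  qed
  have Sm: "S \<in> borel_measurable borel"
    using Scont by (intro borel_measurable_continuous_onI continuous_at_imp_continuous_on) auto
  then have Sm': "S \<in> measurable \<nu> borel" by (simp add: measurable_cong_sets[OF sets refl])
  let ?U = "distr \<nu> borel S"
  interpret U: uniform_law ?U
  proof (intro uniform_law.intro uniform_law_axioms.intro)
    show "prob_space ?U" by (rule prob_space_distr[OF Sm'])
    fix u :: real assume "0 < u" "u < 1"
    then obtain t where t: "S t = u" using range by blast
    have "measure ?U {..<u} = measure \<nu> {t<..}"
      using less_iff sp by (subst measure_distr[OF Sm']) (auto simp: t[symmetric] intro!: arg_cong2[where f=measure])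
    then show "measure ?U {..<u} = u" using t by (simp add: S)
  qed simp
  define f where "f = (\<lambda>\<omega>. \<lambda>i\<in>{..<n}. S (\<omega> i))"
  have "S \<in> measurable \<nu> ?U" "distr \<nu> ?U S = ?U" using Sm' by (auto intro: distr_cong)
  note im = PiM_image[OF finite_lessThan[of n] assms(1) U.prob_space_axioms this, folded f_def]
  note fm = im(1)
  obtain B where B: "B \<in> sets (\<Pi>\<^sub>M i\<in>{..<n}. ?U)" "emeasure (\<Pi>\<^sub>M i\<in>{..<n}. ?U) B \<le> ennreal (2 * emp_bound \<kappa> l (real n))"
    "\<And>\<omega> u. \<omega> \<in> space (\<Pi>\<^sub>M i\<in>{..<n}. ?U) - B \<Longrightarrow> 0 < u \<Longrightarrow> u < 1 \<Longrightarrow>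
       \<bar>real (U.count_less n u \<omega>) - real n * u\<bar> \<le> l * sqrt (real n * u * (1 - u))"
    using U.empirical_uniform[OF n k l] by blast
  define B' where "B' = f -` B \<inter> space (\<Pi>\<^sub>M i\<in>{..<n}. \<nu>)"
  show thesis
  proof (rule that)
    show "B' \<in> sets (\<Pi>\<^sub>M i\<in>{..<n}. \<nu>)" unfolding B'_def by (rule measurable_sets[OF fm B(1)])
    have "emeasure (\<Pi>\<^sub>M i\<in>{..<n}. \<nu>) B' = emeasure (\<Pi>\<^sub>M i\<in>{..<n}. ?U) B"
      unfolding B'_def by (rule im(2)[OF B(1)])
    then show "emeasure (\<Pi>\<^sub>M i\<in>{..<n}. \<nu>) B' \<le> ennreal (2 * emp_bound \<kappa> l (real n))" using B(2) by simp
  next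
    fix \<omega> t assume w: "\<omega> \<in> space (\<Pi>\<^sub>M i\<in>{..<n}. \<nu>) - B'"
    have fw: "f \<omega> \<in> space (\<Pi>\<^sub>M i\<in>{..<n}. ?U) - B"
      using w measurable_space[OF fm, of \<omega>] by (auto simp: B'_def)
    have "{i\<in>{..<n}. f \<omega> i < S t} = {i\<in>{..<n}. \<omega> i > t}"
      by (rule Collect_cong) (auto simp: f_def less_iff)
    then have eq: "U.count_less n (S t) (f \<omega>) = card {i\<in>{..<n}. \<omega> i > t}"
      by (simp only: U.count_less_def)
    show "\<bar>real (card {i\<in>{..<n}. \<omega> i > t}) - real n * S t\<bar> \<le> l * sqrt (real n * S t * (1 - S t))"
      unfolding eq[symmetric] by (rule B(3)[OF fw S01(1)[of t] S01(2)[of t]])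
  qed
qed

section \<open>Atomlessness and full support of the score laws\<close>

lemma normal_law_null: "A \<in> null_sets lborel \<Longrightarrow> emeasure (normal_law m) A = 0"
  using absolutely_continuousI_density[of "\<lambda>x. ennreal (normal_density m 1 x)" lborel]
  by (auto simp: absolutely_continuous_def normal_law_def)

lemma normal_law_interval_pos:
  assumes "x < y"
  shows "emeasure (normal_law m) {x<..<y} > 0"
proof (rule ccontr)
  assume "\<not> ?thesis"
  then have "(\<integral>\<^sup>+z. ennreal (normal_density m 1 z) * indicator {x<..<y} z \<partial>lborel) = 0"
    by (simp add: normal_law_def emeasure_density)
  then have "AE z in lborel. ennreal (normal_density m 1 z) * indicator {x<..<y} z = 0"
    by (subst (asm) nn_integral_0_iff_AE) auto
  then have "AE z in lborel. z \<notin> {x<..<y}"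
    by eventually_elim (use normal_density_pos[of 1 m] in \<open>auto simp: indicator_def less_le split: if_splits\<close>)
  then have "emeasure lborel {x<..<y} = 0" by (subst (asm) AE_iff_measurable[where N="{x<..<y}"]) auto
  then show False using assms by simp
qed

lemma emeasure_abs_gap_law:
  assumes "A \<in> sets borel"
  shows "emeasure (abs_gap_law a b) A = emeasure (normal_law a \<Otimes>\<^sub>M normal_law b) {(u, v). \<bar>u\<bar> - \<bar>v\<bar> \<in> A}"
proof -
  have "emeasure (abs_gap_law a b) A = emeasure (normal_law a \<Otimes>\<^sub>M normal_law b) ((\<lambda>(u, v). \<bar>u\<bar> - \<bar>v\<bar>) -` A \<inter> space (normal_law a \<Otimes>\<^sub>M normal_law b))"
    unfolding abs_gap_law_def using assms by (intro emeasure_distr) auto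
  then show ?thesis by (simp add: space_pair_measure vimage_def split_beta')
qed

lemma sets_abs_gap_vimage: 
  assumes "A \<in> sets borel"
  shows "{(u, v). \<bar>u\<bar> - \<bar>v\<bar> \<in> A} \<in> sets (normal_law a \<Otimes>\<^sub>M normal_law b)"
proof -
  have "(\<lambda>(u, v). \<bar>u\<bar> - \<bar>v\<bar>) -` A \<inter> space (normal_law a \<Otimes>\<^sub>M normal_law b) \<in> sets (normal_law a \<Otimes>\<^sub>M normal_law b)"
    by (intro measurable_sets[OF _ assms]) measurable
  then show ?thesis by (simp add: space_pair_measure vimage_def split_beta')
qed

lemma abs_gap_law_atomless: "measure (abs_gap_law a b) {t} = 0"
proof -
  interpret nb: prob_space "normal_law b" by simp
  let ?A = "{(u, v). \<bar>u\<bar> - \<bar>v\<bar> \<in> {t}} :: (real \<times> real) set"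
  have "emeasure (abs_gap_law a b) {t} = emeasure (normal_law a \<Otimes>\<^sub>M normal_law b) ?A"
    by (rule emeasure_abs_gap_law) simp
  also have "\<dots> = (\<integral>\<^sup>+u. emeasure (normal_law b) (Pair u -` ?A) \<partial>normal_law a)"
    by (rule nb.emeasure_pair_measure_alt) (rule sets_abs_gap_vimage, simp)
  also have "\<dots> = (\<integral>\<^sup>+u. 0 \<partial>normal_law a)"
  proof (rule nn_integral_cong)
    fix u
    have "Pair u -` ?A \<subseteq> {\<bar>u\<bar> - t, t - \<bar>u\<bar>}" by auto
    then have "finite (Pair u -` ?A)" by (rule finite_subset) simp
    then show "emeasure (normal_law b) (Pair u -` ?A) = 0"
      by (intro normal_law_null countable_imp_null_set_lborel countable_finite)
  qed
  finally show ?thesis by (simp add: measure_def)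
qed

text \<open>Independence bounds the mass from below by that of a rectangle. Strict monotonicity of
  the tail and its lower bound both come from a well placed rectangle.\<close>

lemma abs_gap_law_box:
  assumes A: "A \<in> sets borel" and IJ: "I \<in> sets borel" "J \<in> sets borel"
    and sub: "\<And>u v. u \<in> I \<Longrightarrow> v \<in> J \<Longrightarrow> \<bar>u\<bar> - \<bar>v\<bar> \<in> A"
  shows "emeasure (normal_law a) I * emeasure (normal_law b) J \<le> emeasure (abs_gap_law a b) A"
proof -
  interpret nb: prob_space "normal_law b" by simp
  have "emeasure (normal_law a) I * emeasure (normal_law b) J = emeasure (normal_law a \<Otimes>\<^sub>M normal_law b) (I \<times> J)"
    using IJ by (subst nb.emeasure_pair_measure_Times) auto
  also have "\<dots> \<le> emeasure (abs_gap_law a b) A"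
    unfolding emeasure_abs_gap_law[OF A] using sub by (intro emeasure_mono sets_abs_gap_vimage A) auto
  finally show ?thesis .
qed

lemma abs_gap_law_tail_strict:
  assumes "t < t'"
  shows "measure (abs_gap_law a b) {t'<..} < measure (abs_gap_law a b) {t<..}"
proof -
  interpret prob_space "abs_gap_law a b" by simp
  define c where "c = (t + t') / 2"
  define d where "d = (t' - t) / 2"
  have d: "d > 0" "c - d = t" "c + d = t'" using assms by (auto simp: c_def d_def field_simps)
  \<comment> \<open>A square of side d/2 on which |u| - |v| stays within d/2 of the midpoint c: the
    offset is put on u if c \<ge> 0 and on v otherwise.\<close>
  obtain x y :: real where xy: "\<And>u v. x < u \<Longrightarrow> u < x + d/2 \<Longrightarrow> y < v \<Longrightarrow> v < y + d/2 \<Longrightarrow> t < \<bar>u\<bar> - \<bar>v\<bar> \<and> \<bar>u\<bar> - \<bar>v\<bar> \<le> t'"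
  proof (cases "c \<ge> 0")
    case True
    show ?thesis by (rule that[of c 0]) (use d True in \<open>auto simp: abs_if\<close>)
  next
    case False
    show ?thesis by (rule that[of 0 "- c"]) (use d False in \<open>auto simp: abs_if\<close>)
  qed
  have "emeasure (normal_law a) {x<..<x + d/2} * emeasure (normal_law b) {y<..<y + d/2} \<le> emeasure (abs_gap_law a b) {t<..t'}"
    using xy by (intro abs_gap_law_box) auto
  moreover have "emeasure (normal_law a) {x<..<x + d/2} * emeasure (normal_law b) {y<..<y + d/2} > 0"
    using d normal_law_interval_pos[of x "x + d/2" a] normal_law_interval_pos[of y "y + d/2" b]
    by (simp add: ennreal_zero_less_mult_iff)
  ultimately have "0 < emeasure (abs_gap_law a b) {t<..t'}" by simp
  then have "0 < measure (abs_gap_law a b) {t<..t'}" by (simp add: emeasure_eq_measure)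
  moreover have "measure (abs_gap_law a b) {t<..} = measure (abs_gap_law a b) ({t<..t'} \<union> {t'<..})"
    using assms by (intro arg_cong[where f="measure _"]) auto
  moreover have "\<dots> = measure (abs_gap_law a b) {t<..t'} + measure (abs_gap_law a b) {t'<..}"
    by (rule finite_measure_Union) auto
  ultimately show ?thesis by simp
qed

text \<open>Keeps the denominator of the statistics positive at every level, so the convention x / 0
  = 0 never enters.\<close>

lemma S_fun_bounds:
  assumes "s \<ge> 0"
  shows "0 < S_fun s t" "S_fun s t < 1"
proof -
  interpret prob_space "null_law s" by (simp add: null_law_def)
  show "0 < S_fun s t" "S_fun s t < 1"
    unfolding S_fun_eq[OF assms]
    using abs_gap_law_tail_strict[of t "t + 1" 0 "sqrt 2 * s"] abs_gap_law_tail_strict[of "t - 1" t 0 "sqrt 2 * s"]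
      measure_nonneg[of "null_law s" "{t + 1<..}"] prob_le_1[of "{t - 1<..}"]
    unfolding null_law_def by linarith+
qed

section \<open>Asymptotics at the iterated-logarithm threshold\<close>

lemma log_log_threshold_limit:
  fixes \<kappa> \<delta> :: real
  assumes k: "0 < \<kappa>" and d: "0 < \<delta>" and kd: "(1 + \<kappa>)\<^sup>2 * (1 + \<delta> / 2) \<le> 1 + \<delta>"
  shows "(\<lambda>n. 2 * (log (1 + \<kappa> / 2) (real n * sqrt (sqrt (2 * (1 + \<delta>) * ln (ln (real n))))) + 1) *
     exp (- ((sqrt (2 * (1 + \<delta>) * ln (ln (real n))))\<^sup>2 / (2 * (1 + \<kappa>)\<^sup>2)))) \<longlonglongrightarrow> 0"
proof -
  define c where "c = 2 * (1 + \<delta>)"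
  define L where "L = ln (1 + \<kappa> / 2)"
  have c: "c > 0" and L: "L > 0" using d k by (auto simp: c_def L_def)
  have "1 + \<delta> / 2 \<le> (1 + \<delta>) / (1 + \<kappa>)\<^sup>2" using kd k by (simp add: field_simps)
  \<comment> \<open>What is kept of 1 + \<delta> after division by (1 + \<kappa>)^2. As e > 1, the
    cost (ln n)^-e per block beats the number of blocks, which is of order ln n up to smaller
    terms.\<close>
  define e where "e = 1 + \<delta> / 2"
  have e1: "e > 1" using d by (simp add: e_def)
  let ?f = "\<lambda>n. 2 * (ln (real n * sqrt (sqrt (c * ln (ln (real n))))) / L + 1) * exp (- (e * ln (ln (real n))))"
  show ?thesis
  proof (rule tendsto_sandwich[OF _ _ tendsto_const])
    show "?f \<longlonglongrightarrow> 0" using c L e1 by real_asymp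
    have ev: "eventually (\<lambda>n. ln (ln (real n)) \<ge> 0 \<and> real n * sqrt (sqrt (c * ln (ln (real n)))) \<ge> 1) at_top"
      using c by (intro eventually_conj) real_asymp+
    have L': "log (1 + \<kappa> / 2) x = ln x / L" for x by (simp add: log_def L_def)
    have ee: "exp (- ((sqrt (2 * (1 + \<delta>) * ln (ln (real n))))\<^sup>2 / (2 * (1 + \<kappa>)\<^sup>2))) \<le> exp (- (e * ln (ln (real n))))"
      if "ln (ln (real n)) \<ge> 0" for n
    proof -
      have "e * ln (ln (real n)) \<le> (1 + \<delta>) / (1 + \<kappa>)\<^sup>2 * ln (ln (real n))"
        unfolding e_def by (intro mult_right_mono that) fact
      also have "\<dots> = (2 * ((1 + \<delta>) * ln (ln (real n)))) / (2 * (1 + \<kappa>)\<^sup>2)"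
        by (simp only: mult_divide_mult_cancel_left_if) simp
      also have "\<dots> = (sqrt (2 * (1 + \<delta>) * ln (ln (real n))))\<^sup>2 / (2 * (1 + \<kappa>)\<^sup>2)"
        using that d by (simp only: mult.assoc) simp
      finally show ?thesis by simp
    qed
    have nn: "0 \<le> 2 * (log (1 + \<kappa> / 2) (real n * sqrt (sqrt (2 * (1 + \<delta>) * ln (ln (real n))))) + 1)"
      if "real n * sqrt (sqrt (c * ln (ln (real n)))) \<ge> 1" for n
      using that L unfolding L' c_def by simp
    show "eventually (\<lambda>n. 0 \<le> 2 * (log (1 + \<kappa> / 2) (real n * sqrt (sqrt (2 * (1 + \<delta>) * ln (ln (real n))))) + 1) *
     exp (- ((sqrt (2 * (1 + \<delta>) * ln (ln (real n))))\<^sup>2 / (2 * (1 + \<kappa>)\<^sup>2)))) at_top"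
      using ev by eventually_elim (intro mult_nonneg_nonneg[OF nn]; simp)
    show "eventually (\<lambda>n. 2 * (log (1 + \<kappa> / 2) (real n * sqrt (sqrt (2 * (1 + \<delta>) * ln (ln (real n))))) + 1) *
     exp (- ((sqrt (2 * (1 + \<delta>) * ln (ln (real n))))\<^sup>2 / (2 * (1 + \<kappa>)\<^sup>2))) \<le> ?f n) at_top"
      using ev
    proof eventually_elim
      case (elim n)
      show ?case unfolding L'[symmetric] c_def
        by (rule mult_left_mono[OF ee nn]) (use elim in simp_all)
    qed
  qed
qed

subsection \<open>The two tests as functions of the signed scores\<close>

text \<open>The sign g picks the statistic: 1 for \<open>T_minus\<close> and -1 for
  \<open>T_plus\<close>. Later bounds are proved once for both.\<close>

definition signed_scores :: "real \<Rightarrow> nat \<Rightarrow> nat \<Rightarrow> nat \<Rightarrow> (nat \<Rightarrow> real) \<Rightarrow> (nat \<Rightarrow> real) \<Rightarrow> data \<Rightarrow> nat \<Rightarrow> real" where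
  "signed_scores g n p q \<theta> \<eta> \<omega> = (\<lambda>i\<in>{..<n}. g * scores n p q \<theta> \<eta> \<omega> i)"

lemma prob_space_null_law [simp]: "prob_space (null_law s)"
  and prob_space_alt_law [simp]: "prob_space (alt_law s)"
  and sets_null_law [simp, measurable_cong]: "sets (null_law s) = sets borel"
  and sets_alt_law [simp, measurable_cong]: "sets (alt_law s) = sets borel"
  and space_null_law [simp]: "space (null_law s) = UNIV"
  and space_alt_law [simp]: "space (alt_law s) = UNIV"
  by (simp_all add: null_law_def alt_law_def)

lemma mult_measurable_law:
  assumes "sets M = sets borel"
  shows "(\<lambda>x. g * x) \<in> measurable M (if c then null_law s else alt_law s)"
proof -
  have "sets (if c then null_law s else alt_law s) = sets borel" by simp
  from measurable_cong_sets[OF assms this] show ?thesis by (simp only:) measurable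
qed

text \<open>Negating all scores interchanges the two laws, which has the same effect as negating z;
  so coordinate i is null precisely when \<open>g * z i = \<sigma> i\<close>.\<close>

lemma signed_scores_law:
  assumes s: "euclid_norm p \<theta> = s" "euclid_norm q \<eta> = s" "s > 0"
    and z: "z \<in> sign_vectors n" "\<sigma> \<in> sign_vectors n" and g: "g \<in> {-1, 1}"
  shows "signed_scores g n p q \<theta> \<eta> \<in> measurable (sample_law n p q \<theta> \<eta> z \<sigma>) (\<Pi>\<^sub>M i\<in>{..<n}. if g * z i = \<sigma> i then null_law s else alt_law s)"
    and "distr (sample_law n p q \<theta> \<eta> z \<sigma>) (\<Pi>\<^sub>M i\<in>{..<n}. if g * z i = \<sigma> i then null_law s else alt_law s) (signed_scores g n p q \<theta> \<eta>) =
    (\<Pi>\<^sub>M i\<in>{..<n}. if g * z i = \<sigma> i then null_law s else alt_law s)"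
proof -
  let ?L = "\<lambda>i. if g * z i = \<sigma> i then null_law s else alt_law s"
  let ?L1 = "\<lambda>i. if z i = \<sigma> i then null_law s else alt_law s"
  have sb: "sets (\<Pi>\<^sub>M i\<in>{..<n}. ?L i) = sets (\<Pi>\<^sub>M i\<in>{..<n}. borel)"
    by (intro sets_PiM_cong) auto
  have sc: "scores n p q \<theta> \<eta> \<in> measurable (sample_law n p q \<theta> \<eta> z \<sigma>) (\<Pi>\<^sub>M i\<in>{..<n}. borel)"
    by (simp add: measurable_cong_sets[OF sets_sample_law refl])
  have cm: "compose {..<n} (\<lambda>x. g * x) \<in> measurable (\<Pi>\<^sub>M i\<in>{..<n}. borel) (\<Pi>\<^sub>M i\<in>{..<n}. ?L i)"
    unfolding compose_def
    by (intro measurable_restrict measurable_compose[OF measurable_component_singleton mult_measurable_law]) auto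
  have sseq: "signed_scores g n p q \<theta> \<eta> = compose {..<n} (\<lambda>x. g * x) \<circ> scores n p q \<theta> \<eta>"
    by (rule ext) (simp add: signed_scores_def compose_def)
  show "signed_scores g n p q \<theta> \<eta> \<in> measurable (sample_law n p q \<theta> \<eta> z \<sigma>) (\<Pi>\<^sub>M i\<in>{..<n}. ?L i)"
    unfolding sseq by (rule measurable_comp[OF sc cm])
  have "distr (sample_law n p q \<theta> \<eta> z \<sigma>) (\<Pi>\<^sub>M i\<in>{..<n}. ?L i) (signed_scores g n p q \<theta> \<eta>) =
     distr (distr (sample_law n p q \<theta> \<eta> z \<sigma>) (\<Pi>\<^sub>M i\<in>{..<n}. borel) (scores n p q \<theta> \<eta>)) (\<Pi>\<^sub>M i\<in>{..<n}. ?L i) (compose {..<n} (\<lambda>x. g * x))"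
    unfolding sseq by (rule distr_distr[OF cm sc, symmetric])
  also have "\<dots> = (\<Pi>\<^sub>M i\<in>{..<n}. distr (?L1 i) (?L i) (\<lambda>x. g * x))"
    unfolding scores_law[OF s z] by (intro distr_PiM_finite_prob_space' mult_measurable_law) auto
  also have "\<dots> = (\<Pi>\<^sub>M i\<in>{..<n}. ?L i)"
  proof (rule PiM_cong[OF refl])
    fix i assume "i \<in> {..<n}"
    then have zi: "z i \<in> {-1, 1}" "\<sigma> i \<in> {-1, 1}" using z by (auto simp: sign_vectors_def PiE_iff)
    have id: "distr M N (\<lambda>x. x) = M" if "sets M = sets N" for M N :: "real measure"
      using that by (intro measure_eqI) (auto simp: emeasure_distr)
    have "distr (null_law s) (alt_law s) uminus = distr (null_law s) borel uminus"
      "distr (alt_law s) (null_law s) uminus = distr (alt_law s) borel uminus"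
      by (intro distr_cong; simp)+
    then have un: "distr (null_law s) (alt_law s) uminus = alt_law s" "distr (alt_law s) (null_law s) uminus = null_law s"
      unfolding null_law_def alt_law_def by (simp_all only: abs_gap_law_swap)
    show "distr (?L1 i) (?L i) (\<lambda>x. g * x) = ?L i"
    proof -
      have fe: "(*) (- 1 :: real) = uminus" "(*) (1 :: real) = (\<lambda>x. x)" by auto
      show ?thesis using zi g by (auto simp: id un fe)
    qed
  qed
  finally show "distr (sample_law n p q \<theta> \<eta> z \<sigma>) (\<Pi>\<^sub>M i\<in>{..<n}. ?L i) (signed_scores g n p q \<theta> \<eta>) = (\<Pi>\<^sub>M i\<in>{..<n}. ?L i)" .
qed

definition signed_stat :: "real \<Rightarrow> nat \<Rightarrow> nat \<Rightarrow> nat \<Rightarrow> (nat \<Rightarrow> real) \<Rightarrow> (nat \<Rightarrow> real) \<Rightarrow> data \<Rightarrow> ereal" where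
  "signed_stat g n p q \<theta> \<eta> \<omega> = sup_stat n (euclid_norm p \<theta>) (\<lambda>i. sqrt 2 * signed_scores g n p q \<theta> \<eta> \<omega> i)"

lemma sup_stat_cong: "(\<And>i. i < n \<Longrightarrow> D i = E i) \<Longrightarrow> sup_stat n s D = sup_stat n s E"
proof -
  assume "\<And>i. i < n \<Longrightarrow> D i = E i"
  then have "{i\<in>{..<n}. D i > x} = {i\<in>{..<n}. E i > x}" for x by auto
  then show ?thesis by (simp only: sup_stat_def)
qed

lemma T_eq_signed_stat:
  "T_minus n p q \<theta> \<eta> = signed_stat 1 n p q \<theta> \<eta>" "T_plus n p q \<theta> \<eta> = signed_stat (-1) n p q \<theta> \<eta>"
  unfolding T_minus_def T_plus_def signed_stat_def
  by (rule ext, clarsimp, rule sup_stat_cong, simp add: signed_scores_def scores_def gap_def)+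

lemma signed_stat_le:
  assumes n: "n \<ge> 1" and s: "euclid_norm p \<theta> = s" "s \<ge> 0"
    and le: "\<And>t. \<bar>real (card {i\<in>{..<n}. signed_scores g n p q \<theta> \<eta> \<omega> i > t}) - real n * S_fun s t\<bar> \<le> l * sqrt (real n * S_fun s t * (1 - S_fun s t))"
  shows "signed_stat g n p q \<theta> \<eta> \<omega> \<le> ereal l"
  unfolding signed_stat_def sup_stat_def s(1)
proof (rule SUP_least)
  fix t
  have "real n * S_fun s t * (1 - S_fun s t) > 0" using n S_fun_bounds[OF s(2), of t] by simp
  then show "ereal (\<bar>real (card {i\<in>{..<n}. sqrt 2 * signed_scores g n p q \<theta> \<eta> \<omega> i > sqrt 2 * t}) - real n * S_fun s t\<bar> /
      sqrt (real n * S_fun s t * (1 - S_fun s t))) \<le> ereal l"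
    using le[of t] by (simp add: pos_divide_le_eq)
qed

text \<open>A supremum below the threshold limits the count at each single level; this is all that
  the power estimate takes from acceptance.\<close>

lemma signed_stat_le_count:
  assumes n: "n \<ge> 1" and s: "euclid_norm p \<theta> = s" "s \<ge> 0" and l: "l \<ge> 0"
    and le: "signed_stat g n p q \<theta> \<eta> \<omega> \<le> ereal l"
  shows "real (card {i\<in>{..<n}. signed_scores g n p q \<theta> \<eta> \<omega> i > t}) \<le> real n * S_fun s t + l * sqrt (real n * S_fun s t)"
proof -
  let ?N = "real (card {i\<in>{..<n}. signed_scores g n p q \<theta> \<eta> \<omega> i > t})"
  have S: "0 < S_fun s t" "S_fun s t < 1" by (rule S_fun_bounds[OF s(2)])+
  then have pos: "real n * S_fun s t * (1 - S_fun s t) > 0" using n by simp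
  have "ereal (\<bar>?N - real n * S_fun s t\<bar> / sqrt (real n * S_fun s t * (1 - S_fun s t))) \<le> signed_stat g n p q \<theta> \<eta> \<omega>"
    unfolding signed_stat_def sup_stat_def s(1) by (rule SUP_upper2[of t]) auto
  then have "ereal (\<bar>?N - real n * S_fun s t\<bar> / sqrt (real n * S_fun s t * (1 - S_fun s t))) \<le> ereal l" using le by (rule order_trans)
  then have "\<bar>?N - real n * S_fun s t\<bar> \<le> l * sqrt (real n * S_fun s t * (1 - S_fun s t))"
    using pos by (simp add: pos_divide_le_eq)
  also have "\<dots> \<le> l * sqrt (real n * S_fun s t)"
    using S l mult_left_mono[of "1 - S_fun s t" 1 "real n * S_fun s t"] by (intro mult_left_mono real_sqrt_le_mono) auto
  finally show ?thesis by linarith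
qed

text \<open>\<open>ell n z \<sigma> = 0\<close> leaves a global sign g with \<sigma> = g * z, so the
  scores signed by g are an i.i.d. null sample. The minimum exceeds the threshold only if this
  statistic does, which confines rejection to the exceptional set.\<close>

lemma type_one_error:
  assumes s: "euclid_norm p \<theta> = s" "euclid_norm q \<eta> = s" "s > 0"
    and z: "z \<in> sign_vectors n" "\<sigma> \<in> sign_vectors n" and ell: "ell n z \<sigma> = 0"
    and n: "n \<ge> 1" and k: "0 < \<kappa>" "\<kappa> \<le> 1" and l: "sqrt (2 * (1 + \<delta>) * ln (ln (real n))) \<ge> 2"
  shows "(\<integral>\<^sup>+ \<omega>. ennreal (psi_check \<delta> n p q \<theta> \<eta> \<omega>) \<partial>sample_law n p q \<theta> \<eta> z \<sigma>) \<le>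
    ennreal (2 * emp_bound \<kappa> (sqrt (2 * (1 + \<delta>) * ln (ln (real n)))) (real n))"
proof -
  let ?l = "sqrt (2 * (1 + \<delta>) * ln (ln (real n)))"
  let ?P = "sample_law n p q \<theta> \<eta> z \<sigma>"
  have "{i\<in>{..<n}. z i \<noteq> \<sigma> i} = {} \<or> {i\<in>{..<n}. z i \<noteq> - \<sigma> i} = {}"
    using ell n unfolding ell_def by (auto simp: min_def split: if_splits)
  then obtain g :: real where g: "g \<in> {-1, 1}" "\<And>i. i < n \<Longrightarrow> g * z i = \<sigma> i"
  proof
    assume "{i\<in>{..<n}. z i \<noteq> \<sigma> i} = {}" then show ?thesis by (intro that[of 1]) auto
  next
    assume "{i\<in>{..<n}. z i \<noteq> - \<sigma> i} = {}" then show ?thesis by (intro that[of "-1"]) auto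
  qed
  have PL: "(\<Pi>\<^sub>M i\<in>{..<n}. if g * z i = \<sigma> i then null_law s else alt_law s) = (\<Pi>\<^sub>M i\<in>{..<n}. null_law s)"
    using g(2) by (intro PiM_cong) auto
  note ss = signed_scores_law[OF s z g(1), unfolded PL]
  obtain B where B: "B \<in> sets (\<Pi>\<^sub>M i\<in>{..<n}. null_law s)" "emeasure (\<Pi>\<^sub>M i\<in>{..<n}. null_law s) B \<le> ennreal (2 * emp_bound \<kappa> ?l (real n))"
    "\<And>\<omega> t. \<omega> \<in> space (\<Pi>\<^sub>M i\<in>{..<n}. null_law s) - B \<Longrightarrow>
       \<bar>real (card {i\<in>{..<n}. \<omega> i > t}) - real n * S_fun s t\<bar> \<le> ?l * sqrt (real n * S_fun s t * (1 - S_fun s t))"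
  proof (rule empirical_continuous[of "null_law s" "S_fun s" n \<kappa> ?l])
    show "S_fun s t = measure (null_law s) {t<..}" for t using s(3) by (intro S_fun_eq) simp
    then show "S_fun s t' < S_fun s t" if "t < t'" for t t'
      using abs_gap_law_tail_strict[OF that] by (simp add: null_law_def)
    show "measure (null_law s) {t} = 0" for t by (simp add: null_law_def abs_gap_law_atomless)
  qed (use n k l in auto)
  have "(\<integral>\<^sup>+ \<omega>. ennreal (psi_check \<delta> n p q \<theta> \<eta> \<omega>) \<partial>?P) \<le> (\<integral>\<^sup>+ \<omega>. indicator B (signed_scores g n p q \<theta> \<eta> \<omega>) \<partial>?P)"
  proof (rule nn_integral_mono)
    fix \<omega> assume w: "\<omega> \<in> space ?P"
    show "ennreal (psi_check \<delta> n p q \<theta> \<eta> \<omega>) \<le> indicator B (signed_scores g n p q \<theta> \<eta> \<omega>)"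
    proof (cases "signed_scores g n p q \<theta> \<eta> \<omega> \<in> B")
      case True then show ?thesis by (simp add: psi_check_def)
    next
      case False
      then have "signed_scores g n p q \<theta> \<eta> \<omega> \<in> space (\<Pi>\<^sub>M i\<in>{..<n}. null_law s) - B"
        using measurable_space[OF ss(1) w] by simp
      then have "signed_stat g n p q \<theta> \<eta> \<omega> \<le> ereal ?l"
        using s(3) by (intro signed_stat_le[OF n s(1)] B(3)) auto
      then have "min (T_minus n p q \<theta> \<eta> \<omega>) (T_plus n p q \<theta> \<eta> \<omega>) \<le> ereal ?l"
        unfolding T_eq_signed_stat using g(1) by (auto simp: min_le_iff_disj)
      then have nl: "\<not> min (T_minus n p q \<theta> \<eta> \<omega>) (T_plus n p q \<theta> \<eta> \<omega>) > ereal ?l" by (simp only: not_less)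
      show ?thesis unfolding psi_check_def by (simp only: nl of_bool_eq ennreal_0 zero_le)
    qed
  qed
  also have "\<dots> = emeasure (\<Pi>\<^sub>M i\<in>{..<n}. null_law s) B"
    using emeasure_distr_nn_integral[OF ss(1) B(1)] unfolding ss(2) by simp
  finally show ?thesis using B(2) by (rule order_trans)
qed

subsection \<open>Power\<close>

text \<open>Chernoff bound for independent indicators with unequal means. The lower tail of such a
  count is sub-Gaussian with its mean as variance proxy.\<close>

lemma count_lower_tail:
  fixes L :: "nat \<Rightarrow> real measure"
  assumes L: "\<And>i. prob_space (L i)" "\<And>i. sets (L i) = sets borel"
    and mu: "\<mu> = (\<Sum>i<n. measure (L i) {t<..})" "\<mu> > 0" and y: "y \<ge> 0"
  shows "{\<omega>\<in>space (PiM {..<n} L). real (card {i\<in>{..<n}. \<omega> i > t}) \<le> \<mu> - y} \<in> sets (PiM {..<n} L)"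
    and "emeasure (PiM {..<n} L) {\<omega>\<in>space (PiM {..<n} L). real (card {i\<in>{..<n}. \<omega> i > t}) \<le> \<mu> - y} \<le> ennreal (exp (- (y\<^sup>2 / (2 * \<mu>))))"
proof -
  interpret P: product_prob_space L "{..<n}" by (intro product_prob_spaceI L)
  note L(2)[measurable_cong]
  \<comment> \<open>The minimiser of - h * y + \<mu> * h^2 / 2.\<close>
  define h where "h = y / \<mu>"
  have h: "h \<ge> 0" using y mu by (simp add: h_def)
  have card_eq: "real (card {i\<in>{..<n}. \<omega> i > t}) = (\<Sum>i<n. indicator {t<..} (\<omega> i))" for \<omega> :: "nat \<Rightarrow> real"
    by (simp add: indicator_def sum.If_cases Int_def)
  have Nm[measurable]: "(\<lambda>\<omega>. real (card {i\<in>{..<n}. \<omega> i > t})) \<in> borel_measurable (PiM {..<n} L)"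
    unfolding card_eq by measurable
  show m: "{\<omega>\<in>space (PiM {..<n} L). real (card {i\<in>{..<n}. \<omega> i > t}) \<le> \<mu> - y} \<in> sets (PiM {..<n} L)"
    by measurable
  have one: "(\<integral>\<^sup>+x. ennreal (exp (- h * indicator {t<..} x)) \<partial>L i) \<le> ennreal (exp (- (measure (L i) {t<..} * (h - h\<^sup>2 / 2))))" for i
  proof -
    have spi: "space (L i) = UNIV" using sets_eq_imp_space_eq[OF L(2)[of i]] by simp
    let ?p = "measure (L i) {t<..}"
    have c: "emeasure (L i) {..t} = ennreal (1 - ?p)"
    proof -
      have "measure (L i) (space (L i) - {t<..}) = 1 - ?p" by (rule P.M.prob_compl) (simp add: L)
      moreover have "space (L i) - {t<..} = {..t}" using spi by auto
      ultimately show ?thesis by (simp add: P.M.emeasure_eq_measure)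
    qed
    have "(\<integral>\<^sup>+x. ennreal (exp (- h * indicator {t<..} x)) \<partial>L i) = (\<integral>\<^sup>+x. ennreal (exp (- h)) * indicator {t<..} x + 1 * indicator {..t} x \<partial>L i)"
      by (intro nn_integral_cong) (auto simp: indicator_def)
    also have "\<dots> = ennreal (exp (- h)) * ennreal ?p + ennreal (1 - ?p)"
      using L(2)[of i] by (subst nn_integral_add) (auto simp: nn_integral_cmult_indicator c simp flip: P.M.emeasure_eq_measure)
    also have "\<dots> = ennreal (1 + (- (?p * (1 - exp (- h)))))"
      by (simp add: ennreal_mult[symmetric] ennreal_plus[symmetric] algebra_simps del: ennreal_plus)
    also have "\<dots> \<le> ennreal (exp (- (?p * (1 - exp (- h)))))"
      by (intro ennreal_leI exp_ge_add_one_self)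
    also have "\<dots> \<le> ennreal (exp (- (?p * (h - h\<^sup>2 / 2))))"
    proof -
      \<comment> \<open>At a nonpositive argument the cubic remainder is nonpositive, so the
        quadratic Taylor polynomial is an upper bound with no extra constant.\<close>
      have "exp (- h) \<le> 1 - h + h\<^sup>2 / 2"
      proof -
        obtain u where u: "exp (- h) = (\<Sum>m<3. (- h) ^ m / fact m) + exp u / fact 3 * (- h) ^ 3"
          using Maclaurin_exp_le[of "- h" 3] by blast
        have "exp u / fact 3 * (- h) ^ 3 \<le> 0" using h by (intro mult_nonneg_nonpos) auto
        moreover have "(\<Sum>m<3. (- h) ^ m / fact m) = 1 - h + h\<^sup>2 / 2"
          by (simp add: numeral_3_eq_3 power2_eq_square)
        ultimately show ?thesis using u by linarith
      qed
      then show ?thesis by (intro ennreal_leI) (auto intro!: mult_left_mono)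
    qed
    finally show ?thesis .
  qed
  have "emeasure (PiM {..<n} L) {\<omega>\<in>space (PiM {..<n} L). real (card {i\<in>{..<n}. \<omega> i > t}) \<le> \<mu> - y} =
    (\<integral>\<^sup>+\<omega>. indicator {\<omega>\<in>space (PiM {..<n} L). real (card {i\<in>{..<n}. \<omega> i > t}) \<le> \<mu> - y} \<omega> \<partial>PiM {..<n} L)"
    using m by simp
  also have "\<dots> \<le> (\<integral>\<^sup>+\<omega>. ennreal (exp (h * (\<mu> - y))) * (\<Prod>i<n. ennreal (exp (- h * indicator {t<..} (\<omega> i)))) \<partial>PiM {..<n} L)"
  proof (rule nn_integral_mono)
    fix \<omega>
    have "h * (\<mu> - y) + (\<Sum>i<n. - h * indicator {t<..} (\<omega> i)) = h * (\<mu> - y - real (card {i\<in>{..<n}. \<omega> i > t}))"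
      unfolding card_eq by (simp add: sum_distrib_left algebra_simps sum_negf)
    then have "ennreal (exp (h * (\<mu> - y))) * (\<Prod>i<n. ennreal (exp (- h * indicator {t<..} (\<omega> i)))) =
      ennreal (exp (h * (\<mu> - y - real (card {i\<in>{..<n}. \<omega> i > t}))))"
      by (simp only: prod_ennreal exp_ge_zero ennreal_mult[symmetric] exp_sum[symmetric] finite_lessThan exp_add[symmetric] prod_nonneg)
    then show "indicator {\<omega>\<in>space (PiM {..<n} L). real (card {i\<in>{..<n}. \<omega> i > t}) \<le> \<mu> - y} \<omega> \<le>
      ennreal (exp (h * (\<mu> - y))) * (\<Prod>i<n. ennreal (exp (- h * indicator {t<..} (\<omega> i))))"
      using h by (auto simp: indicator_def)
  qed
  also have "\<dots> = ennreal (exp (h * (\<mu> - y))) * (\<Prod>i<n. \<integral>\<^sup>+x. ennreal (exp (- h * indicator {t<..} x)) \<partial>L i)"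
    by (subst nn_integral_cmult) (auto intro!: P.product_nn_integral_prod arg_cong[where f="\<lambda>x. _ * x"])
  also have "\<dots> \<le> ennreal (exp (h * (\<mu> - y))) * (\<Prod>i<n. ennreal (exp (- (measure (L i) {t<..} * (h - h\<^sup>2 / 2)))))"
    by (intro mult_left_mono prod_mono_ennreal one) simp_all
  also have "\<dots> = ennreal (exp (h * (\<mu> - y) + - (\<mu> * (h - h\<^sup>2 / 2))))"
    by (simp add: prod_ennreal exp_sum[symmetric] ennreal_mult[symmetric] exp_add[symmetric] mu(1) sum_distrib_right sum_negf)
  also have "h * (\<mu> - y) + - (\<mu> * (h - h\<^sup>2 / 2)) = - (y\<^sup>2 / (2 * \<mu>))"
    using mu(2) by (simp add: h_def power2_eq_square field_simps)
  finally show "emeasure (PiM {..<n} L) {\<omega>\<in>space (PiM {..<n} L). real (card {i\<in>{..<n}. \<omega> i > t}) \<le> \<mu> - y} \<le> ennreal (exp (- (y\<^sup>2 / (2 * \<mu>))))" .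
qed

text \<open>M bounds the expected number of flipped exceedances from below. Since
  \<open>2 * S_fun s t \<le> A\<close>, at least half of that number is excess over the null mean.
  The condition with \<open>l\<^sup>2\<close> makes the critical deviation at most M / 4; the two
  upper bounds on K push the Chernoff exponent above K / 64, whether flips or null scores dominate
  the mean.\<close>

lemma signed_stat_power:
  assumes s: "euclid_norm p \<theta> = s" "euclid_norm q \<eta> = s" "s > 0"
    and z: "z \<in> sign_vectors n" "\<sigma> \<in> sign_vectors n" and g: "g \<in> {-1, 1}"
    and n: "n \<ge> 1" and l: "l \<ge> 0"
    and m: "real (card {i\<in>{..<n}. g * z i \<noteq> \<sigma> i}) * A \<ge> M" and M: "M > 0" and A: "A = measure (alt_law s) {t<..}"
    and SA: "2 * S_fun s t \<le> A"
    and K: "M \<ge> K" "M\<^sup>2 \<ge> K * (real n * S_fun s t)" "M\<^sup>2 \<ge> 16 * l\<^sup>2 * (real n * S_fun s t)" "K \<ge> 0"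
  obtains B where "B \<in> sets (sample_law n p q \<theta> \<eta> z \<sigma>)" "emeasure (sample_law n p q \<theta> \<eta> z \<sigma>) B \<le> ennreal (exp (- (K / 64)))"
    "\<And>\<omega>. \<omega> \<in> space (sample_law n p q \<theta> \<eta> z \<sigma>) \<Longrightarrow> signed_stat g n p q \<theta> \<eta> \<omega> \<le> ereal l \<Longrightarrow> \<omega> \<in> B"
proof -
  let ?P = "sample_law n p q \<theta> \<eta> z \<sigma>"
  let ?L = "\<lambda>i. if g * z i = \<sigma> i then null_law s else alt_law s"
  define S where "S = S_fun s t"
  define a where "a = real (card {i\<in>{..<n}. g * z i \<noteq> \<sigma> i})"
  note ss = signed_scores_law[OF s z g]
  have S: "S > 0" "S = measure (null_law s) {t<..}" using S_fun_bounds(1)[of s t] S_fun_eq[of s t] s(3) by (simp_all add: S_def)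
  have "a * A > 0" using m M by (simp add: a_def)
  have a0: "a \<ge> 0" by (simp add: a_def)
  have A0: "A > 0" using \<open>a * A > 0\<close> a0 zero_less_mult_pos2[of a A] by (metis mult_zero_left not_less_iff_gr_or_eq order_le_less zero_less_mult_pos)
  define \<mu> where "\<mu> = (\<Sum>i<n. measure (?L i) {t<..})"
  have mu: "\<mu> = real n * S + a * (A - S)"
  proof -
    have "\<mu> = (\<Sum>i<n. S + (if g * z i \<noteq> \<sigma> i then A - S else 0))"
      unfolding \<mu>_def S(2) A by (intro sum.cong) auto
    also have "\<dots> = real n * S + a * (A - S)"
      unfolding a_def by (simp add: sum.distrib sum.If_cases Int_def)
    finally show ?thesis .
  qed
  \<comment> \<open>The excess over the null mean is split evenly: one half covers the critical
    deviation, the other is the deviation in the lower-tail bound.\<close>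
  define y where "y = a * (A - S) / 2"
  have AS: "A - S \<ge> A / 2" using SA by (simp add: S_def)
  have y4: "y \<ge> a * A / 4" using mult_left_mono[OF AS a0] by (simp add: y_def mult.commute)
  have y: "y \<ge> M / 4" using y4 m by (simp add: a_def)
  have mu0: "\<mu> > 0" using mu S(1) n y M by (simp add: y_def add_pos_pos)
  have L12: "prob_space (?L i)" "sets (?L i) = sets borel" for i by simp_all
  have y0: "y \<ge> 0" using y M by simp
  define Bq where "Bq = {\<omega>\<in>space (PiM {..<n} ?L). real (card {i\<in>{..<n}. \<omega> i > t}) \<le> \<mu> - y}"
  have Bq: "Bq \<in> sets (PiM {..<n} ?L)" "emeasure (PiM {..<n} ?L) Bq \<le> ennreal (exp (- (y\<^sup>2 / (2 * \<mu>))))"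
    unfolding Bq_def by (rule count_lower_tail[OF L12 \<mu>_def mu0 y0])+
  show thesis
  proof (rule that)
    show "signed_scores g n p q \<theta> \<eta> -` Bq \<inter> space ?P \<in> sets ?P" by (rule measurable_sets[OF ss(1) Bq(1)])
    have "emeasure ?P (signed_scores g n p q \<theta> \<eta> -` Bq \<inter> space ?P) = emeasure (PiM {..<n} ?L) Bq"
      using emeasure_distr[OF ss(1) Bq(1)] unfolding ss(2) by simp
    also have "\<dots> \<le> ennreal (exp (- (y\<^sup>2 / (2 * \<mu>))))" by (rule Bq)
    also have "\<dots> \<le> ennreal (exp (- (K / 64)))"
    proof -
      define x where "x = a * A"
      have xM: "x \<ge> M" using m by (simp add: x_def a_def)
      have "K * \<mu> \<le> K * (real n * S + x)"
      proof (rule mult_left_mono)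
        have "a * S \<ge> 0" using a0 S(1) by simp
        then show "\<mu> \<le> real n * S + x" unfolding mu x_def by (simp add: right_diff_distrib)
      qed (rule K(4))
      also have "\<dots> \<le> x\<^sup>2 + x\<^sup>2"
      proof -
        have "K * (real n * S) \<le> x\<^sup>2" using K(2) power_mono[OF xM, of 2] M by (simp add: S_def)
        moreover have "K * x \<le> x\<^sup>2" unfolding power2_eq_square using K(1) xM M by (intro mult_right_mono) auto
        ultimately show ?thesis by (simp add: distrib_left)
      qed
      also have "x\<^sup>2 \<le> (4 * y)\<^sup>2" using y4 xM M by (intro power_mono) (auto simp: x_def)
      finally have "K * \<mu> \<le> 32 * y\<^sup>2" by (simp add: power_mult_distrib)
      then have "K / 64 \<le> y\<^sup>2 / (2 * \<mu>)" using mu0 by (simp add: field_simps)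
      then show ?thesis by (intro ennreal_leI) simp
    qed
    finally show "emeasure ?P (signed_scores g n p q \<theta> \<eta> -` Bq \<inter> space ?P) \<le> ennreal (exp (- (K / 64)))" .
  next
    fix \<omega> assume w: "\<omega> \<in> space ?P" "signed_stat g n p q \<theta> \<eta> \<omega> \<le> ereal l"
    have "real (card {i\<in>{..<n}. signed_scores g n p q \<theta> \<eta> \<omega> i > t}) \<le> real n * S + l * sqrt (real n * S)"
      unfolding S_def using signed_stat_le_count[OF n s(1) _ l w(2)] s(3) by simp
    also have "l * sqrt (real n * S) \<le> M / 4"
    proof (rule power2_le_imp_le)
      show "(l * sqrt (real n * S))\<^sup>2 \<le> (M / 4)\<^sup>2" using K(3) S(1) by (simp add: power_mult_distrib power_divide S_def)
    qed (use M in simp)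
    also have "real n * S + M / 4 \<le> \<mu> - y" using y unfolding mu y_def by simp
    finally show "\<omega> \<in> signed_scores g n p q \<theta> \<eta> -` Bq \<inter> space ?P"
      using w(1) measurable_space[OF ss(1) w(1)] by (simp add: Bq_def)
  qed
qed

subsection \<open>Tails of the score laws\<close>

text \<open>An exceedance needs U large and V small at once, which explains the extra s^2 in the
  exponent. After tilting V to a centred normal, its factor is at most exp (\<mu> * |v|); on the
  event, \<mu> \<le> t bounds this by exp (t * (|u| - t)), and the moment generating function of U
  finishes.\<close>

lemma null_law_tail_upper:
  assumes t: "sqrt 2 * s \<le> t" "s \<ge> 0"
  shows "measure (null_law s) {t<..} \<le> 2 * exp (- (t\<^sup>2 / 2 + s\<^sup>2))"
proof -
  define \<mu> where "\<mu> = sqrt 2 * s"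
  have mu: "0 \<le> \<mu>" "\<mu> \<le> t" "\<mu>\<^sup>2 = 2 * s\<^sup>2" using t by (auto simp: \<mu>_def power_mult_distrib)
  interpret N: prob_space "null_law s" by simp
  interpret n0: prob_space "normal_law 0" by simp
  let ?A = "{(u, v). \<bar>u\<bar> - \<bar>v\<bar> \<in> {t<..}} :: (real \<times> real) set"
  have Am: "?A \<in> sets (normal_law 0 \<Otimes>\<^sub>M normal_law \<mu>)" by (rule sets_abs_gap_vimage) simp
  then have Am'[measurable]: "?A \<in> sets (borel \<Otimes>\<^sub>M borel)" by (simp cong: sets_pair_measure_cong)
  interpret nm: prob_space "normal_law \<mu>" by simp
  have "emeasure (null_law s) {t<..} = emeasure (normal_law 0 \<Otimes>\<^sub>M normal_law \<mu>) ?A"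
    unfolding null_law_def \<mu>_def by (rule emeasure_abs_gap_law) simp
  also have "\<dots> = (\<integral>\<^sup>+u. \<integral>\<^sup>+v. indicator ?A (u, v) \<partial>normal_law \<mu> \<partial>normal_law 0)"
    using Am by (subst nm.nn_integral_fst) auto
  also have "\<dots> \<le> (\<integral>\<^sup>+u. ennreal (exp (- \<mu>\<^sup>2 / 2 - t\<^sup>2)) * (ennreal (exp (t * u)) + ennreal (exp (- t * u))) \<partial>normal_law 0)"
  proof (rule nn_integral_mono)
    fix u
    have "(\<integral>\<^sup>+v. indicator ?A (u, v) \<partial>normal_law \<mu>) = (\<integral>\<^sup>+v. ennreal (exp (\<mu> * v - \<mu>\<^sup>2 / 2)) * indicator ?A (u, v) \<partial>normal_law 0)"
      by (subst normal_law_tilt[of \<mu>], subst nn_integral_density) auto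
    also have "\<dots> \<le> (\<integral>\<^sup>+v. ennreal (exp (- \<mu>\<^sup>2 / 2 - t\<^sup>2)) * (ennreal (exp (t * u)) + ennreal (exp (- t * u))) \<partial>normal_law 0)"
    proof (rule nn_integral_mono)
      fix v
      show "ennreal (exp (\<mu> * v - \<mu>\<^sup>2 / 2)) * indicator ?A (u, v) \<le> ennreal (exp (- \<mu>\<^sup>2 / 2 - t\<^sup>2)) * (ennreal (exp (t * u)) + ennreal (exp (- t * u)))"
      proof (cases "(u, v) \<in> ?A")
        case True
        then have uv: "\<bar>u\<bar> \<ge> t + \<bar>v\<bar>" by auto
        have "\<mu> * v \<le> \<mu> * \<bar>v\<bar>" using mu by (intro mult_left_mono) auto
        also have "\<dots> \<le> t * \<bar>v\<bar>" using mu by (intro mult_right_mono) auto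
        also have "\<dots> \<le> t * (\<bar>u\<bar> - t)" using uv mu by (intro mult_left_mono) auto
        finally have "\<mu> * v - \<mu>\<^sup>2 / 2 \<le> (- \<mu>\<^sup>2 / 2 - t\<^sup>2) + t * \<bar>u\<bar>" by (simp add: power2_eq_square algebra_simps)
        then have "exp (\<mu> * v - \<mu>\<^sup>2 / 2) \<le> exp (- \<mu>\<^sup>2 / 2 - t\<^sup>2) * exp (t * \<bar>u\<bar>)" unfolding exp_add[symmetric] by simp
        also have "\<dots> \<le> exp (- \<mu>\<^sup>2 / 2 - t\<^sup>2) * (exp (t * u) + exp (- t * u))"
          by (intro mult_left_mono) (auto simp: abs_if)
        finally show ?thesis using True by (simp add: ennreal_mult[symmetric] ennreal_plus[symmetric] del: ennreal_plus)
      qed simp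
    qed
    also have "\<dots> = ennreal (exp (- \<mu>\<^sup>2 / 2 - t\<^sup>2)) * (ennreal (exp (t * u)) + ennreal (exp (- t * u)))"
      using n0.emeasure_space_1 by simp
    finally show "(\<integral>\<^sup>+v. indicator ?A (u, v) \<partial>normal_law \<mu>) \<le> ennreal (exp (- \<mu>\<^sup>2 / 2 - t\<^sup>2)) * (ennreal (exp (t * u)) + ennreal (exp (- t * u)))" .
  qed
  also have "\<dots> = ennreal (exp (- \<mu>\<^sup>2 / 2 - t\<^sup>2)) * (ennreal (exp (t\<^sup>2 / 2)) + ennreal (exp (t\<^sup>2 / 2)))"
    using normal_law_mgf[of t] normal_law_mgf[of "- t"] by (simp add: nn_integral_cmult nn_integral_add)
  also have "\<dots> = ennreal (2 * exp (- (t\<^sup>2 / 2 + s\<^sup>2)))"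
    using mu(3) by (simp add: ennreal_mult[symmetric] ennreal_plus[symmetric] exp_add[symmetric] del: ennreal_plus)
  finally show ?thesis by (simp add: N.emeasure_eq_measure)
qed

lemma normal_law_interval_lower:
  assumes "m \<le> x"
  shows "emeasure (normal_law m) {x<..<x + 1} \<ge> ennreal (1 / sqrt (2 * pi) * exp (- ((x + 1 - m)\<^sup>2 / 2)))"
proof -
  let ?c = "1 / sqrt (2 * pi) * exp (- ((x + 1 - m)\<^sup>2 / 2))"
  have "ennreal ?c = (\<integral>\<^sup>+z. ennreal ?c * indicator {x<..<x + 1} z \<partial>lborel)"
    by (simp add: nn_integral_cmult_indicator)
  also have "\<dots> \<le> (\<integral>\<^sup>+z. ennreal (normal_density m 1 z) * indicator {x<..<x + 1} z \<partial>lborel)"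
  proof (rule nn_integral_mono)
    fix z
    show "ennreal ?c * indicator {x<..<x + 1} z \<le> ennreal (normal_density m 1 z) * indicator {x<..<x + 1} z"
    proof (cases "z \<in> {x<..<x + 1}")
      case True
      then have "(z - m)\<^sup>2 \<le> (x + 1 - m)\<^sup>2" using assms by (intro power_mono) auto
      then have "?c \<le> normal_density m 1 z" unfolding normal_density_def by (simp add: divide_right_mono)
      then show ?thesis using True by (simp add: ennreal_leI)
    qed simp
  qed
  also have "\<dots> = emeasure (normal_law m) {x<..<x + 1}"
    unfolding normal_law_def by (subst emeasure_density) auto
  finally show ?thesis .
qed

text \<open>The unit square with t + 1 < u < t + 2 and 0 < v < 1 lies in the event. Its Gaussian
  cost involves (x + 2)^2 with x = t - \<open>sqrt 2 * s\<close>; Young's inequality with weight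
  \<kappa> absorbs the cross term, at the price of the constant in 1 / \<kappa>.\<close>

lemma alt_law_tail_lower:
  assumes t: "sqrt 2 * s \<le> t" "s \<ge> 0" and k: "\<kappa> > 0"
  shows "measure (alt_law s) {t<..} \<ge> 1 / (2 * pi) * exp (- 1 / 2 - 2 * (1 + 1 / \<kappa>)) * exp (- ((1 + \<kappa>) * (t - sqrt 2 * s)\<^sup>2 / 2))"
proof -
  define \<mu> where "\<mu> = sqrt 2 * s"
  have mu: "0 \<le> \<mu>" "\<mu> \<le> t" using t by (auto simp: \<mu>_def)
  interpret N: prob_space "alt_law s" by simp
  let ?w = "1 / sqrt (2 * pi)"
  define x where "x = t - \<mu>"
  have "(2 * x) * 2 \<le> \<kappa> * x\<^sup>2 + 4 / \<kappa>"
  proof -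
    have "0 \<le> (sqrt \<kappa> * x - 2 / sqrt \<kappa>)\<^sup>2" by simp
    also have "\<dots> = \<kappa> * x\<^sup>2 + 4 / \<kappa> - 4 * x" using k by (simp add: power2_diff power_mult_distrib power_divide)
    finally show ?thesis by simp
  qed
  then have q: "(x + 2)\<^sup>2 \<le> (1 + \<kappa>) * x\<^sup>2 + 4 * (1 + 1 / \<kappa>)" by (simp add: power2_eq_square algebra_simps)
  have "ennreal ((?w * exp (- ((x + 2)\<^sup>2 / 2))) * (?w * exp (- 1 / 2))) \<le>
    emeasure (normal_law \<mu>) {t + 1<..<t + 1 + 1} * emeasure (normal_law 0) {0<..<0 + 1}"
  proof (subst ennreal_mult)
    show "ennreal (?w * exp (- ((x + 2)\<^sup>2 / 2))) * ennreal (?w * exp (- 1 / 2)) \<le>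
       emeasure (normal_law \<mu>) {t + 1<..<t + 1 + 1} * emeasure (normal_law 0) {0<..<0 + 1}"
      using normal_law_interval_lower[of \<mu> "t + 1"] normal_law_interval_lower[of 0 0] mu
      by (intro mult_mono) (auto simp: x_def algebra_simps)
  qed auto
  also have "\<dots> \<le> emeasure (abs_gap_law \<mu> 0) {t<..}"
    using mu by (intro abs_gap_law_box) auto
  finally have "(?w * exp (- ((x + 2)\<^sup>2 / 2))) * (?w * exp (- 1 / 2)) \<le> measure (alt_law s) {t<..}"
    using N.emeasure_eq_measure by (simp add: alt_law_def \<mu>_def)
  moreover have "(?w * exp (- ((x + 2)\<^sup>2 / 2))) * (?w * exp (- 1 / 2)) = 1 / (2 * pi) * exp (- 1 / 2 - (x + 2)\<^sup>2 / 2)"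
    by (simp add: exp_add[symmetric] exp_diff exp_minus field_simps)
  moreover have "1 / (2 * pi) * exp (- 1 / 2 - 2 * (1 + 1 / \<kappa>)) * exp (- ((1 + \<kappa>) * x\<^sup>2 / 2)) \<le> 1 / (2 * pi) * exp (- 1 / 2 - (x + 2)\<^sup>2 / 2)"
    unfolding mult.assoc exp_add[symmetric] using q by (intro mult_left_mono) (auto simp: field_simps)
  ultimately show ?thesis by (simp add: x_def \<mu>_def)
qed

section \<open>Choice of the level below the detection boundary\<close>

lemma beta_star_middle:
  assumes "1 / 5 < r" "r < 1 / 2"
  shows "beta_star r = 2 * (sqrt r * sqrt (1 - r))"
proof -
  have "1 - (max (1 - 2 * r) 0)\<^sup>2 = (2 * (sqrt r * sqrt (1 - r)))\<^sup>2"
    using assms by (simp add: power_mult_distrib) (simp add: power2_eq_square algebra_simps)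
  then have "sqrt (1 - (max (1 - 2 * r) 0)\<^sup>2) = \<bar>2 * (sqrt r * sqrt (1 - r))\<bar>" by (simp only: real_sqrt_abs)
  then show ?thesis using assms by (simp add: beta_star_def)
qed

text \<open>After \<open>a \<ge> sqrt r\<close>, the conditions say that flipped exceedances grow in
  number, that the square of this number beats the null exceedances, and that the alternative tail
  dominates the null tail. The value 2 * sqrt r is the unconstrained optimum of the second of these.
  In the middle range a^2 + r = 1, where the first two coincide. For large r the level sits at the
  centre \<open>sqrt r\<close> of the alternative.\<close>

lemma detection_exponents:
  assumes "0 < \<beta>" "\<beta> < 1" "0 < r" "\<beta> < beta_star r"
  obtains a where "a \<ge> sqrt r" "\<beta> + (a - sqrt r)\<^sup>2 < 1" "2 * \<beta> + 2 * (a - sqrt r)\<^sup>2 < 1 + a\<^sup>2 + r" "(a - sqrt r)\<^sup>2 < a\<^sup>2 + r"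
proof -
  define x where "x = sqrt r"
  have x: "x > 0" "x\<^sup>2 = r" using assms by (auto simp: x_def)
  have last: "(a - x)\<^sup>2 < a\<^sup>2 + r" if "a \<ge> x" for a
  proof -
    have "a * x > 0" using that x by (simp add: zero_less_mult_iff)
    then show ?thesis using x(2) by (simp add: power2_diff)
  qed
  consider "r \<le> 1/5" | "1/5 < r" "r < 1/2" | "r \<ge> 1/2" by linarith
  then show thesis
  proof cases
    case 1
    then have "\<beta> < (1 + 3 * r) / 2" using assms by (simp add: beta_star_def)
    then show ?thesis using 1 x last[of "2 * x"]
      by (intro that[of "2 * x"]) (auto simp: x_def[symmetric] power_mult_distrib)
  next
    case 2
    define y where "y = sqrt (1 - r)"
    have y: "y > 0" "y\<^sup>2 = 1 - r" "y \<ge> x" using 2 by (auto simp: y_def x_def)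
    have "\<beta> < 2 * (x * y)" using assms beta_star_middle[OF 2] by (simp add: x_def y_def)
    then show ?thesis using y x last[OF y(3)]
      by (intro that[of y]) (auto simp: x_def[symmetric] power2_diff mult_ac)
  next
    case 3
    then show ?thesis using assms x last[of x]
      by (intro that[of x]) (auto simp: x_def[symmetric])
  qed
qed

subsection \<open>Consistency of the test below the boundary\<close>

text \<open>Acceptance means that at least one of the two statistics stays below the threshold.
  \<open>ell\<close> above \<epsilon> bounds both Hamming distances from below, so
  \<open>signed_stat_power\<close> applies to each sign and a union bound gives the factor
  2.\<close>

lemma type_two_error:
  assumes s: "euclid_norm p \<theta> = s" "euclid_norm q \<eta> = s" "s > 0"
    and z: "z \<in> sign_vectors n" "\<sigma> \<in> sign_vectors n" and ell: "ell n z \<sigma> > \<epsilon>"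
    and n: "n \<ge> 1" and l: "0 \<le> 2 * (1 + \<delta>) * ln (ln (real n))"
    and M: "M > 0" "M \<le> real n * \<epsilon> * measure (alt_law s) {t<..}"
    and SA: "2 * S_fun s t \<le> measure (alt_law s) {t<..}"
    and K: "M \<ge> K" "M\<^sup>2 \<ge> K * (real n * S_fun s t)" "M\<^sup>2 \<ge> 16 * (2 * (1 + \<delta>) * ln (ln (real n))) * (real n * S_fun s t)" "K \<ge> 0"
  shows "(\<integral>\<^sup>+ \<omega>. ennreal (1 - psi_check \<delta> n p q \<theta> \<eta> \<omega>) \<partial>sample_law n p q \<theta> \<eta> z \<sigma>) \<le> ennreal (2 * exp (- (K / 64)))"
proof -
  let ?P = "sample_law n p q \<theta> \<eta> z \<sigma>"
  let ?l = "sqrt (2 * (1 + \<delta>) * ln (ln (real n)))"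
  let ?A = "measure (alt_law s) {t<..}"
  have ex: "\<exists>B. B \<in> sets ?P \<and> emeasure ?P B \<le> ennreal (exp (- (K / 64))) \<and>
    (\<forall>\<omega>\<in>space ?P. signed_stat g n p q \<theta> \<eta> \<omega> \<le> ereal ?l \<longrightarrow> \<omega> \<in> B)" if g: "g \<in> {-1, 1}" for g
  proof -
    have "{i\<in>{..<n}. g * z i \<noteq> \<sigma> i} = (if g = 1 then {i\<in>{..<n}. z i \<noteq> \<sigma> i} else {i\<in>{..<n}. z i \<noteq> - \<sigma> i})"
      using g by auto
    then have "\<epsilon> < real (card {i\<in>{..<n}. g * z i \<noteq> \<sigma> i}) / real n" using ell by (simp add: ell_def)
    then have "real n * \<epsilon> \<le> real (card {i\<in>{..<n}. g * z i \<noteq> \<sigma> i})" using n by (simp add: field_simps)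
    then have m: "real (card {i\<in>{..<n}. g * z i \<noteq> \<sigma> i}) * ?A \<ge> M"
      using M(2) mult_right_mono[of "real n * \<epsilon>" _ ?A] by (meson measure_nonneg order_trans)
    have l2: "?l \<ge> 0" "?l\<^sup>2 = 2 * (1 + \<delta>) * ln (ln (real n))" using l by simp_all
    show ?thesis
      using signed_stat_power[OF s z g n l2(1) m M(1) refl SA K(1,2) _ K(4)] K(3) unfolding l2(2) by metis
  qed
  obtain B1 where B1: "B1 \<in> sets ?P" "emeasure ?P B1 \<le> ennreal (exp (- (K / 64)))"
    "\<And>\<omega>. \<omega> \<in> space ?P \<Longrightarrow> signed_stat 1 n p q \<theta> \<eta> \<omega> \<le> ereal ?l \<Longrightarrow> \<omega> \<in> B1"
    using ex[of 1] by auto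
  obtain B2 where B2: "B2 \<in> sets ?P" "emeasure ?P B2 \<le> ennreal (exp (- (K / 64)))"
    "\<And>\<omega>. \<omega> \<in> space ?P \<Longrightarrow> signed_stat (-1) n p q \<theta> \<eta> \<omega> \<le> ereal ?l \<Longrightarrow> \<omega> \<in> B2"
    using ex[of "-1"] by auto
  have "(\<integral>\<^sup>+ \<omega>. ennreal (1 - psi_check \<delta> n p q \<theta> \<eta> \<omega>) \<partial>?P) \<le> (\<integral>\<^sup>+ \<omega>. indicator B1 \<omega> + indicator B2 \<omega> \<partial>?P)"
  proof (rule nn_integral_mono)
    fix \<omega> assume w: "\<omega> \<in> space ?P"
    show "ennreal (1 - psi_check \<delta> n p q \<theta> \<eta> \<omega>) \<le> indicator B1 \<omega> + indicator B2 \<omega>"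
    proof (cases "min (T_minus n p q \<theta> \<eta> \<omega>) (T_plus n p q \<theta> \<eta> \<omega>) > ereal ?l")
      case True
      then have "psi_check \<delta> n p q \<theta> \<eta> \<omega> = 1" unfolding psi_check_def by (simp only: of_bool_eq)
      then show ?thesis by simp
    next
      case False
      then have "signed_stat 1 n p q \<theta> \<eta> \<omega> \<le> ereal ?l \<or> signed_stat (-1) n p q \<theta> \<eta> \<omega> \<le> ereal ?l"
        unfolding T_eq_signed_stat by (simp only: not_less min_le_iff_disj)
      then have "\<omega> \<in> B1 \<or> \<omega> \<in> B2" using B1(3)[OF w] B2(3)[OF w] by blast
      then have "1 \<le> (indicator B1 \<omega> + indicator B2 \<omega> :: ennreal)" by (auto simp: indicator_def)
      moreover have "ennreal (1 - psi_check \<delta> n p q \<theta> \<eta> \<omega>) \<le> 1" by (simp add: psi_check_def)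
      ultimately show ?thesis by (rule order_trans[rotated])
    qed
  qed
  also have "\<dots> = emeasure ?P B1 + emeasure ?P B2" using B1(1) B2(1) by (subst nn_integral_add) auto
  also have "\<dots> \<le> ennreal (exp (- (K / 64))) + ennreal (exp (- (K / 64)))" by (intro add_mono B1 B2)
  also have "\<dots> = ennreal (2 * exp (- (K / 64)))" by (subst ennreal_plus[symmetric]) auto
  finally show ?thesis .
qed

lemma emp_bound_limit:
  fixes \<kappa> \<delta> :: real
  assumes k: "0 < \<kappa>" and d: "0 < \<delta>" and kd: "(1 + \<kappa>)\<^sup>2 * (1 + \<delta> / 2) \<le> 1 + \<delta>"
  shows "(\<lambda>n. emp_bound \<kappa> (sqrt (2 * (1 + \<delta>) * ln (ln (real n)))) (real n)) \<longlonglongrightarrow> 0"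
proof -
  define c where "c = 2 * (1 + \<delta>)"
  define L where "L = ln (1 + \<kappa> / 2)"
  define L' where "L' = ln (1 + \<kappa>)"
  define Q where "Q = 2 * (1 + \<kappa> / 2)"
  define W where "W = sqrt (1 + \<kappa> / 2) - 1"
  have c: "c > 0" "L' > 0" "Q > 0" "W > 0" using d k by (auto simp: c_def L'_def Q_def W_def)
  have "(\<lambda>n. 1 / sqrt (sqrt (c * ln (ln (real n))))) \<longlonglongrightarrow> 0" using c by real_asymp
  moreover have "(\<lambda>n. 96 / (L' * sqrt (c * ln (ln (real n)))) * (sqrt (Q * sqrt (sqrt (c * ln (ln (real n))))) / W)) \<longlonglongrightarrow> 0"
    using c by real_asymp
  ultimately show ?thesis
    unfolding emp_bound_def
    using tendsto_add[OF tendsto_add[OF _ log_log_threshold_limit[OF k d kd]]]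
    by (fastforce simp: c_def L'_def Q_def W_def)
qed

lemma powr_ln_exp: "n > 0 \<Longrightarrow> exp (- (x * ln n)) = n powr (- x)" for n :: real
  by (simp add: powr_def)

theorem test_error_limit:
  fixes \<beta> r \<delta> :: real
  assumes b: "0 < \<beta>" "\<beta> < 1" and r: "0 < r" and d: "0 < \<delta>"
    and eps: "\<And>n. n \<ge> 1 \<Longrightarrow> \<epsilon> n = real n powr (- \<beta>)"
    and th: "\<And>n. n \<ge> 1 \<Longrightarrow> euclid_norm (p n) (\<theta> n) = sqrt (r * ln (real n))"
    and et: "\<And>n. n \<ge> 1 \<Longrightarrow> euclid_norm (q n) (\<eta> n) = sqrt (r * ln (real n))"
    and lt: "\<beta> < beta_star r"
  shows "(\<lambda>n. test_error n (p n) (q n) (psi_check \<delta> n (p n) (q n) (\<theta> n) (\<eta> n)) (\<theta> n) (\<eta> n) (\<epsilon> n)) \<longlonglongrightarrow> 0"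
proof -
  obtain a where a: "a \<ge> sqrt r" "\<beta> + (a - sqrt r)\<^sup>2 < 1" "2 * \<beta> + 2 * (a - sqrt r)\<^sup>2 < 1 + a\<^sup>2 + r" "(a - sqrt r)\<^sup>2 < a\<^sup>2 + r"
    using detection_exponents[OF b r lt] by blast
  define D where "D = (a - sqrt r)\<^sup>2"
  define e where "e = a\<^sup>2 + r"
  \<comment> \<open>The minimum is the slack in the strict inequalities for a. Dividing by D + 1,
    rather than by D, keeps \<kappa> * D below it even when D = 0.\<close>
  define \<kappa> where "\<kappa> = min (min (1 - \<beta> - D) ((1 + e - 2 * \<beta> - 2 * D) / 2)) (e - D) / (D + 1)"
  have D: "D \<ge> 0" by (simp add: D_def)
  have gap: "min (min (1 - \<beta> - D) ((1 + e - 2 * \<beta> - 2 * D) / 2)) (e - D) > 0" using a by (simp add: D_def e_def)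
  have k: "\<kappa> > 0" using gap D by (simp add: \<kappa>_def)
  have kD: "\<kappa> * D < min (min (1 - \<beta> - D) ((1 + e - 2 * \<beta> - 2 * D) / 2)) (e - D)"
  proof -
    have "\<kappa> * D < \<kappa> * (D + 1)" using k by simp
    also have "\<dots> = min (min (1 - \<beta> - D) ((1 + e - 2 * \<beta> - 2 * D) / 2)) (e - D)" using D by (simp add: \<kappa>_def)
    finally show ?thesis .
  qed
  \<comment> \<open>The guaranteed number M of flipped exceedances has order n^a1, and the null mean
    n * S is at most of order n^(1 - e); the exponent 2 * a1 - 1 + e compares the square of the
    first with the second.\<close>
  define a1 where "a1 = 1 - \<beta> - (1 + \<kappa>) * D"
  have a1: "a1 > 0" "2 * a1 - 1 + e > 0" "e - (1 + \<kappa>) * D > 0" using kD by (auto simp: a1_def algebra_simps)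
  define mn where "mn = min a1 (2 * a1 - 1 + e)"
  have mn: "mn > 0" "mn \<le> a1" "mn \<le> 2 * a1 - 1 + e" using a1 by (auto simp: mn_def)
  \<comment> \<open>K = n^k' has to tend to infinity and yet stay below M and below M^2 / (n * S);
    half of the slack achieves both.\<close>
  define k' where "k' = mn / 2"
  have k': "k' > 0" "a1 - k' > 0" "2 * a1 - k' - 1 + e > 0" using mn by (auto simp: k'_def)
  define c where "c = 1 / (2 * pi) * exp (- 1 / 2 - 2 * (1 + 1 / \<kappa>))"
  have c: "c > 0" by (simp add: c_def)
  \<comment> \<open>For \<kappa>' \<le> 1 the square (1 + \<kappa>')^2 is at most 1 + 3 * \<kappa>',
    so 3 * \<kappa>' * (1 + \<delta> / 2) \<le> \<delta> / 2 is enough; solving for \<kappa>' gives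
    this value.\<close>
  define \<kappa>' where "\<kappa>' = min 1 (\<delta> / (6 + 3 * \<delta>))"
  have kp: "0 < \<kappa>'" "\<kappa>' \<le> 1" using d by (auto simp: \<kappa>'_def)
  have kp2: "(1 + \<kappa>')\<^sup>2 * (1 + \<delta> / 2) \<le> 1 + \<delta>"
  proof -
    have "(1 + \<kappa>')\<^sup>2 \<le> 1 + 3 * \<kappa>'" using mult_left_mono[OF kp(2), of \<kappa>'] kp by (simp add: power2_eq_square algebra_simps)
    then have "(1 + \<kappa>')\<^sup>2 * (1 + \<delta> / 2) \<le> (1 + 3 * \<kappa>') * (1 + \<delta> / 2)" using d by (intro mult_right_mono) auto
    also have "\<dots> = 1 + \<delta> / 2 + \<kappa>' * (6 + 3 * \<delta>) / 2" by (simp add: algebra_simps)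
    also have "\<kappa>' * (6 + 3 * \<delta>) \<le> \<delta>" using d by (simp add: \<kappa>'_def min_def field_simps)
    finally show ?thesis by simp
  qed
  let ?l = "\<lambda>n. sqrt (2 * (1 + \<delta>) * ln (ln (real n)))"
  let ?u = "\<lambda>n. ennreal (2 * emp_bound \<kappa>' (?l n) (real n)) + ennreal (2 * exp (- (real n powr k' / 64)))"
  have big: "eventually (\<lambda>n. real n powr x \<ge> C) sequentially" if "x > 0" for x C :: real
  proof -
    have "filterlim (\<lambda>n. real n powr x) at_top sequentially" using that by real_asymp
    then show ?thesis by (simp add: filterlim_at_top)
  qed
  have e3: "eventually (\<lambda>n. c\<^sup>2 * real n powr (2 * a1 - 1 + e) \<ge> 16 * (2 * (1 + \<delta>) * ln (ln (real n))) * 2) sequentially"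
  proof -
    define b3 where "b3 = 2 * a1 - 1 + e"
    define C where "C = 64 * (1 + \<delta>)"
    have "b3 > 0" "c\<^sup>2 > 0" "C > 0" using a1 c d by (auto simp: b3_def C_def)
    then have "eventually (\<lambda>n. c\<^sup>2 * real n powr b3 \<ge> C * ln (ln (real n))) sequentially" by real_asymp
    then show ?thesis by (rule eventually_mono) (simp add: b3_def C_def algebra_simps)
  qed
  \<comment> \<open>The value 4 under the root yields the bound l \<ge> 2 that the empirical-process
    estimate asks for.\<close>
  have e4: "eventually (\<lambda>n. 2 * (1 + \<delta>) * ln (ln (real n)) \<ge> 4) sequentially"
  proof -
    define C where "C = 2 * (1 + \<delta>)"
    have "C > 0" using d by (simp add: C_def)
    then have "filterlim (\<lambda>n. C * ln (ln (real n))) at_top sequentially" by real_asymp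
    then show ?thesis by (simp add: filterlim_at_top C_def)
  qed
  have ev: "eventually (\<lambda>n. test_error n (p n) (q n) (psi_check \<delta> n (p n) (q n) (\<theta> n) (\<eta> n)) (\<theta> n) (\<eta> n) (\<epsilon> n) \<le> ?u n) sequentially"
    \<comment> \<open>From n = 2 on, ln n is positive and so are the norms of the two mean
      vectors.\<close>
    using eventually_ge_at_top[of "2::nat"] e3 e4 big[OF k'(2), of "1 / c"] big[OF k'(3), of "2 / c\<^sup>2"] big[OF a1(3), of "4 / c"]
  proof eventually_elim
    case (elim n)
    define N where "N = real n"
    define s where "s = sqrt (r * ln N)"
    have n: "n \<ge> 1" "N > 1" using elim(1) by (auto simp: N_def)
    have lnN: "ln N > 0" using n by simp
    have s0: "s > 0" using r lnN by (simp add: s_def)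
    have s: "euclid_norm (p n) (\<theta> n) = s" "euclid_norm (q n) (\<eta> n) = s" using th[OF n(1)] et[OF n(1)] by (simp_all add: s_def N_def)
    define t where "t = a * sqrt (2 * ln N)"
    have s2: "sqrt 2 * s = sqrt r * sqrt (2 * ln N)" by (simp add: s_def real_sqrt_mult)
    have st: "sqrt 2 * s \<le> t" unfolding s2 t_def using a(1) lnN by (intro mult_right_mono) auto
    define S where "S = S_fun s t"
    define A where "A = measure (alt_law s) {t<..}"
    have S: "S \<le> 2 * N powr (- e)"
    proof -
      have "S \<le> 2 * exp (- (t\<^sup>2 / 2 + s\<^sup>2))"
        unfolding S_def S_fun_eq[OF less_imp_le[OF s0]] using null_law_tail_upper[OF st] s0 by simp
      also have "t\<^sup>2 / 2 + s\<^sup>2 = e * ln N" using lnN r by (simp add: t_def s_def e_def power_mult_distrib algebra_simps)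
      finally show ?thesis using n by (simp add: powr_ln_exp)
    qed
    have A: "A \<ge> c * N powr (- ((1 + \<kappa>) * D))"
    proof -
      have "A \<ge> c * exp (- ((1 + \<kappa>) * (t - sqrt 2 * s)\<^sup>2 / 2))"
        unfolding A_def c_def using s0 by (intro alt_law_tail_lower st k) simp
      also have "(t - sqrt 2 * s)\<^sup>2 = D * (2 * ln N)" unfolding s2 t_def D_def
        using lnN by (simp add: left_diff_distrib[symmetric] power_mult_distrib)
      also have "(1 + \<kappa>) * (D * (2 * ln N)) / 2 = ((1 + \<kappa>) * D) * ln N" by simp
      finally show ?thesis using n by (simp only: powr_ln_exp)
    qed
    define M where "M = c * N powr a1"
    have M0: "M > 0" using c n by (simp add: M_def)
    have MA: "M \<le> real n * \<epsilon> n * A"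
    proof -
      have "M = (N * N powr (- \<beta>)) * (c * N powr (- ((1 + \<kappa>) * D)))"
        using n by (simp add: M_def a1_def powr_diff powr_minus field_simps powr_add)
      also have "\<dots> \<le> (N * N powr (- \<beta>)) * A" using n by (intro mult_left_mono A) auto
      finally show ?thesis using eps[OF n(1)] by (simp add: N_def)
    qed
    have SA: "2 * S \<le> A"
    proof -
      have "4 / c \<le> N powr (e - (1 + \<kappa>) * D)" using elim by (simp add: N_def)
      then have "4 \<le> c * (N powr e * N powr (- ((1 + \<kappa>) * D)))" using c by (simp add: field_simps powr_add[symmetric])
      from mult_right_mono[OF this, of "N powr (- e)"] have "4 * N powr (- e) \<le> c * N powr (- ((1 + \<kappa>) * D))"
        using n by (simp add: powr_minus field_simps)
      then show ?thesis using S A by linarith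
    qed
    define K where "K = N powr k'"
    have K0: "K \<ge> 0" by (simp add: K_def)
    have KM: "K \<le> M"
    proof -
      have "1 / c \<le> N powr (a1 - k')" using elim by (simp add: N_def)
      then have "1 \<le> c * N powr (a1 - k')" using c by (simp add: field_simps)
      from mult_right_mono[OF this, of "N powr k'"] show ?thesis using n by (simp add: K_def M_def mult.assoc powr_add[symmetric])
    qed
    have M2: "M\<^sup>2 = c\<^sup>2 * N powr (2 * a1)" using n by (simp add: M_def power_mult_distrib power2_eq_square powr_add[symmetric])
    have NS: "real n * S \<le> 2 * N powr (1 - e)"
    proof -
      have "real n * S \<le> N * (2 * N powr (- e))" unfolding N_def[symmetric] using n by (intro mult_left_mono S) auto
      then show ?thesis using n by (simp add: powr_diff powr_minus field_simps)
    qed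
    have K2: "K * (real n * S) \<le> M\<^sup>2"
    proof -
      have "2 / c\<^sup>2 \<le> N powr (2 * a1 - k' - 1 + e)" using elim by (simp add: N_def)
      then have "2 \<le> c\<^sup>2 * N powr (2 * a1 - k' - 1 + e)" using c by (simp add: field_simps)
      from mult_right_mono[OF this, of "N powr (k' + (1 - e))"]
      have "2 * N powr (k' + (1 - e)) \<le> M\<^sup>2" using n by (simp add: M2 powr_add[symmetric] mult.assoc)
      moreover have "K * (real n * S) \<le> K * (2 * N powr (1 - e))" by (intro mult_left_mono NS K0)
      ultimately show ?thesis by (simp add: K_def powr_add)
    qed
    have K3: "16 * (2 * (1 + \<delta>) * ln (ln (real n))) * (real n * S) \<le> M\<^sup>2"
    proof -
      have "16 * (2 * (1 + \<delta>) * ln (ln (real n))) * (real n * S) \<le> 16 * (2 * (1 + \<delta>) * ln (ln (real n))) * (2 * N powr (1 - e))"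
        using elim by (intro mult_left_mono NS) auto
      also have "\<dots> \<le> c\<^sup>2 * N powr (2 * a1 - 1 + e) * N powr (1 - e)"
        using elim mult_right_mono[of "16 * (2 * (1 + \<delta>) * ln (ln (real n))) * 2" "c\<^sup>2 * N powr (2 * a1 - 1 + e)" "N powr (1 - e)"]
        by (simp add: N_def mult.assoc)
      also have "\<dots> = M\<^sup>2" by (simp add: M2 powr_add[symmetric] mult.assoc)
      finally show ?thesis .
    qed
    have l4: "2 * (1 + \<delta>) * ln (ln (real n)) \<ge> 4" by fact
    then have "sqrt 4 \<le> ?l n" by (rule real_sqrt_le_mono)
    then have l2: "?l n \<ge> 2" by simp
    have l0: "0 \<le> 2 * (1 + \<delta>) * ln (ln (real n))" using l4 by linarith
    show ?case unfolding test_error_def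
    proof (intro add_mono SUP_least; clarify)
      fix z \<sigma> assume z: "z \<in> sign_vectors n" "\<sigma> \<in> sign_vectors n"
      { assume "ell n z \<sigma> = 0"
        then show "(\<integral>\<^sup>+ x. ennreal (psi_check \<delta> n (p n) (q n) (\<theta> n) (\<eta> n) x) \<partial>sample_law n (p n) (q n) (\<theta> n) (\<eta> n) z \<sigma>) \<le>
           ennreal (2 * emp_bound \<kappa>' (?l n) (real n))"
          by (rule type_one_error[OF s s0 z _ n(1) kp l2]) }
      { assume ell: "ell n z \<sigma> > \<epsilon> n"
        show "(\<integral>\<^sup>+ x. ennreal (1 - psi_check \<delta> n (p n) (q n) (\<theta> n) (\<eta> n) x) \<partial>sample_law n (p n) (q n) (\<theta> n) (\<eta> n) z \<sigma>) \<le>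
           ennreal (2 * exp (- (real n powr k' / 64)))"
          using type_two_error[OF s s0 z ell n(1) l0 M0 MA[unfolded A_def] SA[unfolded A_def S_def] KM
             K2[unfolded S_def] K3[unfolded S_def] K0]
          by (simp add: K_def N_def) }
    qed
  qed
  have lim: "?u \<longlonglongrightarrow> 0"
  proof -
    have "(\<lambda>n. 2 * emp_bound \<kappa>' (?l n) (real n)) \<longlonglongrightarrow> 2 * 0" by (intro tendsto_mult_left emp_bound_limit kp d kp2)
    moreover have "(\<lambda>n. 2 * exp (- (real n powr k' / 64))) \<longlonglongrightarrow> 0" using k'(1) by real_asymp
    ultimately have "?u \<longlonglongrightarrow> ennreal (2 * 0) + ennreal 0" by (intro tendsto_add tendsto_ennrealI)
    then show ?thesis by simp
  qed
  show ?thesis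
    by (rule tendsto_sandwich[OF _ ev tendsto_const lim]) simp
qed

subsection \<open>The likelihood of the sample\<close>

lemma normal_vec_law_tilt:
  "normal_vec_law d (\<lambda>j. c * \<theta> j) =
    density (normal_vec_law d (\<lambda>j. 0)) (\<lambda>x. ennreal (exp (c * dot d \<theta> x - c\<^sup>2 * (euclid_norm d \<theta>)\<^sup>2 / 2)))"
proof -
  let ?f = "\<lambda>j x. ennreal (exp (c * \<theta> j * x - (c * \<theta> j)\<^sup>2 / 2))"
  have "normal_vec_law d (\<lambda>j. c * \<theta> j) = (\<Pi>\<^sub>M j\<in>{..<d}. density (normal_law 0) (?f j))"
    unfolding normal_vec_law_def by (intro PiM_cong refl normal_law_tilt)
  also have "\<dots> = density (\<Pi>\<^sub>M j\<in>{..<d}. normal_law 0) (\<lambda>x. \<Prod>j<d. ?f j (x j))"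
    by (intro PiM_density) (auto simp flip: normal_law_tilt)
  also have "\<dots> = density (normal_vec_law d (\<lambda>j. 0)) (\<lambda>x. ennreal (exp (c * dot d \<theta> x - c\<^sup>2 * (euclid_norm d \<theta>)\<^sup>2 / 2)))"
  proof -
    have "(\<Prod>j<d. ?f j (x j)) = ennreal (exp (c * dot d \<theta> x - c\<^sup>2 * (euclid_norm d \<theta>)\<^sup>2 / 2))" for x
    proof -
      have "(euclid_norm d \<theta>)\<^sup>2 = (\<Sum>j<d. (\<theta> j)\<^sup>2)" by (simp add: euclid_norm_def L2_set_def sum_nonneg)
      then have "(\<Sum>j<d. c * \<theta> j * x j - (c * \<theta> j)\<^sup>2 / 2) = c * dot d \<theta> x - c\<^sup>2 * (euclid_norm d \<theta>)\<^sup>2 / 2"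
        by (simp add: dot_def sum_subtractf sum_distrib_left power_mult_distrib sum_divide_distrib mult.assoc)
      then show ?thesis by (simp add: prod_ennreal exp_sum[symmetric])
    qed
    then show ?thesis by (simp add: normal_vec_law_def)
  qed
  finally show ?thesis .
qed

text \<open>Reference law with all means zero, dominating the sample laws of all sign patterns
  simultaneously.\<close>

definition base_law :: "nat \<Rightarrow> nat \<Rightarrow> nat \<Rightarrow> data measure" where
  "base_law n p q = (\<Pi>\<^sub>M i\<in>{..<n}. normal_vec_law p (\<lambda>j. 0)) \<Otimes>\<^sub>M (\<Pi>\<^sub>M i\<in>{..<n}. normal_vec_law q (\<lambda>j. 0))"

text \<open>Likelihood ratio of one observed pair against the reference law, as a function of its
  two inner products. The constant collects a^2 * s^2 / 2 and b^2 * s^2 / 2, which for signs a and b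
  add up to s^2.\<close>

definition lik :: "real \<Rightarrow> real \<Rightarrow> real \<Rightarrow> real \<times> real \<Rightarrow> real" where
  "lik s a b = (\<lambda>(x, y). exp (a * x + b * y - s\<^sup>2))"

abbreviation inner_pair :: "nat \<Rightarrow> nat \<Rightarrow> (nat \<Rightarrow> real) \<Rightarrow> (nat \<Rightarrow> real) \<Rightarrow> data \<Rightarrow> nat \<Rightarrow> real \<times> real" where
  "inner_pair p q \<theta> \<eta> \<omega> i \<equiv> (dot p \<theta> (fst \<omega> i), dot q \<eta> (snd \<omega> i))"

lemma sets_base_law [measurable_cong]: "sets (base_law n p q) = sets (sample_space n p q)"
  unfolding base_law_def sample_space_def by (intro sets_pair_measure_cong sets_PiM_cong) auto

lemma dot_measurable [measurable]: "dot d \<theta> \<in> borel_measurable (\<Pi>\<^sub>M j\<in>{..<d}. borel)"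
  unfolding dot_def by measurable

lemma lik_measurable [measurable]: "lik s a b \<in> borel_measurable (borel \<Otimes>\<^sub>M borel)"
  unfolding lik_def by measurable

lemma inner_pair_measurable:
  assumes "i < n"
  shows "(\<lambda>\<omega>. inner_pair p q \<theta> \<eta> \<omega> i) \<in> measurable (base_law n p q) (borel \<Otimes>\<^sub>M borel)"
proof -
  have [measurable]: "i \<in> {..<n}" using assms by simp
  have "(\<lambda>\<omega>. inner_pair p q \<theta> \<eta> \<omega> i) \<in> measurable (sample_space n p q) (borel \<Otimes>\<^sub>M borel)"
    unfolding sample_space_def by measurable
  then show ?thesis by (simp add: measurable_cong_sets[OF sets_base_law refl])
qed

lemma sample_law_density:
  assumes s: "euclid_norm p \<theta> = s" "euclid_norm q \<eta> = s"
    and z: "z \<in> sign_vectors n" "\<sigma> \<in> sign_vectors n"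
  shows "sample_law n p q \<theta> \<eta> z \<sigma> =
    density (base_law n p q) (\<lambda>\<omega>. \<Prod>i<n. ennreal (lik s (z i) (\<sigma> i) (inner_pair p q \<theta> \<eta> \<omega> i)))"
proof -
  let ?f = "\<lambda>i x. ennreal (exp (z i * dot p \<theta> x - (z i)\<^sup>2 * s\<^sup>2 / 2))"
  let ?g = "\<lambda>i x. ennreal (exp (\<sigma> i * dot q \<eta> x - (\<sigma> i)\<^sup>2 * s\<^sup>2 / 2))"
  let ?P = "normal_vec_law p (\<lambda>j. 0)" and ?Q = "normal_vec_law q (\<lambda>j. 0)"
  have P: "normal_vec_law p (\<lambda>j. z i * \<theta> j) = density ?P (?f i)" for i
    using normal_vec_law_tilt[of p "z i" \<theta>] s by simp
  have Q: "normal_vec_law q (\<lambda>j. \<sigma> i * \<eta> j) = density ?Q (?g i)" for i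
    using normal_vec_law_tilt[of q "\<sigma> i" \<eta>] s by simp
  have Pd: "(\<Pi>\<^sub>M i\<in>{..<n}. density ?P (?f i)) = density (\<Pi>\<^sub>M i\<in>{..<n}. ?P) (\<lambda>x. \<Prod>i<n. ?f i (x i))"
    by (intro PiM_density) (auto simp flip: P)
  have Qd: "(\<Pi>\<^sub>M i\<in>{..<n}. density ?Q (?g i)) = density (\<Pi>\<^sub>M i\<in>{..<n}. ?Q) (\<lambda>x. \<Prod>i<n. ?g i (x i))"
    by (intro PiM_density) (auto simp flip: Q)
  have sf: "sigma_finite_measure (\<Pi>\<^sub>M i\<in>{..<n}. ?Q)"
    by (intro prob_space_imp_sigma_finite prob_space_PiM) auto
  have sfd: "sigma_finite_measure (density (\<Pi>\<^sub>M i\<in>{..<n}. ?Q) (\<lambda>x. \<Prod>i<n. ?g i (x i)))"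
    unfolding Qd[symmetric] by (intro prob_space_imp_sigma_finite prob_space_PiM) (auto simp flip: Q)
  have "sample_law n p q \<theta> \<eta> z \<sigma> = density (base_law n p q) (\<lambda>(x, y). (\<Prod>i<n. ?f i (x i)) * (\<Prod>i<n. ?g i (y i)))"
    unfolding sample_law_def base_law_def P Q Pd Qd
    by (rule pair_measure_density[OF _ _ sf sfd]) measurable
  also have "(\<lambda>(x, y). (\<Prod>i<n. ?f i (x i)) * (\<Prod>i<n. ?g i (y i))) =
     (\<lambda>\<omega>. \<Prod>i<n. ennreal (lik s (z i) (\<sigma> i) (inner_pair p q \<theta> \<eta> \<omega> i)))"
  proof (rule ext, clarify)
    fix x y
    have e: "?f i (x i) * ?g i (y i) = ennreal (lik s (z i) (\<sigma> i) (inner_pair p q \<theta> \<eta> (x, y) i))" if "i < n" for i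
    proof -
      have "z i \<in> {-1, 1}" "\<sigma> i \<in> {-1, 1}" using z that by (auto simp: sign_vectors_def PiE_iff)
      then have "(z i)\<^sup>2 = 1" "(\<sigma> i)\<^sup>2 = 1" by auto
      then show ?thesis by (simp add: lik_def ennreal_mult[symmetric] exp_add[symmetric] algebra_simps)
    qed
    show "(\<Prod>i<n. ?f i (x i)) * (\<Prod>i<n. ?g i (y i)) = (\<Prod>i<n. ennreal (lik s (z i) (\<sigma> i) (inner_pair p q \<theta> \<eta> (x, y) i)))"
      unfolding prod.distrib[symmetric] by (intro prod.cong refl e) simp
  qed
  finally show ?thesis .
qed

text \<open>Under the reference law the inner products are s times independent standard normals, so
  of the mean vectors and the dimensions only s survives.\<close>

lemma base_law_integral_prod:
  assumes s: "euclid_norm p \<theta> = s" "euclid_norm q \<eta> = s" "s > 0"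
    and [measurable]: "h \<in> borel_measurable (borel \<Otimes>\<^sub>M borel)"
  shows "(\<integral>\<^sup>+\<omega>. (\<Prod>i<n. h (inner_pair p q \<theta> \<eta> \<omega> i)) \<partial>base_law n p q) =
    (\<integral>\<^sup>+(x, y). h (s * x, s * y) \<partial>(normal_law 0 \<Otimes>\<^sub>M normal_law 0)) ^ n"
proof -
  let ?P = "normal_vec_law p (\<lambda>j. 0)" and ?Q = "normal_vec_law q (\<lambda>j. 0)"
  have dp: "dot p \<theta> x = s * proj p \<theta> x" "dot q \<eta> x = s * proj q \<eta> x" for x
    using s by (simp_all add: proj_def)
  have "(\<integral>\<^sup>+\<omega>. (\<Prod>i<n. h (inner_pair p q \<theta> \<eta> \<omega> i)) \<partial>base_law n p q) =
    (\<Prod>i<n. \<integral>\<^sup>+(x, y). h (dot p \<theta> x, dot q \<eta> y) \<partial>(?P \<Otimes>\<^sub>M ?Q))"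
    unfolding base_law_def
    using nn_integral_pair_PiM_prod[of "{..<n}" "\<lambda>_. ?P" "\<lambda>_. ?Q" "\<lambda>i (x, y). h (dot p \<theta> x, dot q \<eta> y)"] by simp
  also have "(\<integral>\<^sup>+(x, y). h (dot p \<theta> x, dot q \<eta> y) \<partial>(?P \<Otimes>\<^sub>M ?Q)) =
    (\<integral>\<^sup>+(x, y). h (s * x, s * y) \<partial>distr (?P \<Otimes>\<^sub>M ?Q) (borel \<Otimes>\<^sub>M borel) (\<lambda>(x, y). (proj p \<theta> x, proj q \<eta> y)))"
    by (subst nn_integral_distr) (auto simp: dp split_beta')
  also have "distr (?P \<Otimes>\<^sub>M ?Q) (borel \<Otimes>\<^sub>M borel) (\<lambda>(x, y). (proj p \<theta> x, proj q \<eta> y)) = normal_law 0 \<Otimes>\<^sub>M normal_law 0"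
    using proj_pair_law[of p \<theta> q \<eta> 0 0] s by simp
  finally show ?thesis by simp
qed

lemma normal_pair_mgf:
  "(\<integral>\<^sup>+(x, y). ennreal (exp (a * x + b * y + c)) \<partial>(normal_law 0 \<Otimes>\<^sub>M normal_law 0)) = ennreal (exp (a\<^sup>2 / 2 + b\<^sup>2 / 2 + c))"
proof -
  interpret n0: prob_space "normal_law 0" by simp
  have "(\<integral>\<^sup>+(x, y). ennreal (exp (a * x + b * y + c)) \<partial>(normal_law 0 \<Otimes>\<^sub>M normal_law 0)) =
    (\<integral>\<^sup>+x. \<integral>\<^sup>+y. ennreal (exp (a * x + c)) * ennreal (exp (b * y)) \<partial>normal_law 0 \<partial>normal_law 0)"
    by (subst n0.nn_integral_fst[symmetric]) (auto simp: ennreal_mult[symmetric] exp_add[symmetric] algebra_simps intro!: nn_integral_cong)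
  also have "\<dots> = (\<integral>\<^sup>+x. ennreal (exp c) * (ennreal (exp (b\<^sup>2 / 2)) * ennreal (exp (a * x))) \<partial>normal_law 0)"
  proof (rule nn_integral_cong)
    fix x
    show "(\<integral>\<^sup>+y. ennreal (exp (a * x + c)) * ennreal (exp (b * y)) \<partial>normal_law 0) =
      ennreal (exp c) * (ennreal (exp (b\<^sup>2 / 2)) * ennreal (exp (a * x)))"
      by (simp add: nn_integral_cmult normal_law_mgf) (simp add: exp_add ennreal_mult mult_ac)
  qed
  also have "\<dots> = ennreal (exp (a\<^sup>2 / 2 + b\<^sup>2 / 2 + c))"
    by (simp add: nn_integral_cmult normal_law_mgf) (simp add: exp_add ennreal_mult mult_ac)
  finally show ?thesis .
qed

lemma lik_integral:
  assumes "a \<in> {-1, 1}" "b \<in> {-1, 1}"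
  shows "(\<integral>\<^sup>+(x, y). ennreal (lik s a b (s * x, s * y)) \<partial>(normal_law 0 \<Otimes>\<^sub>M normal_law 0)) = 1"
proof -
  have "a\<^sup>2 = 1" "b\<^sup>2 = 1" using assms by auto
  then show ?thesis using normal_pair_mgf[of "a * s" "b * s" "- s\<^sup>2"]
    by (simp add: lik_def mult.assoc power_mult_distrib)
qed

subsection \<open>The mixture and its affinity\<close>

definition match_density :: "real \<Rightarrow> real \<times> real \<Rightarrow> real" where
  "match_density s v = (lik s 1 1 v + lik s (-1) (-1) v) / 2"

text \<open>Density of one pair when the first sign is uniform and the second is flipped with
  probability e; at e = 0 it is \<open>match_density\<close>. Averaging over the common sign is what
  produces the hyperbolic cosines of \<open>densities_cosh\<close>.\<close>

definition mixed_density :: "real \<Rightarrow> real \<Rightarrow> real \<times> real \<Rightarrow> real" where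
  "mixed_density e s v = (1 - e) * match_density s v + e * ((lik s 1 (-1) v + lik s (-1) 1 v) / 2)"

text \<open>With g = sqrt f the left side exceeds g by (g - 1)^2 / 2, and (g - 1)^2 is at most both
  |f - 1|^2 and |f - 1|. Every power with exponent between 1 and 2 lies above the smaller of
  these.\<close>

lemma sqrt_lower_bound:
  assumes f: "f \<ge> 0" and w: "1 \<le> w" "w \<le> 2"
  shows "(1 + f) / 2 \<le> sqrt f + \<bar>f - 1\<bar> powr w"
proof -
  define g where "g = sqrt f"
  have g: "g \<ge> 0" "f = g\<^sup>2" using f by (auto simp: g_def)
  have fg: "f - 1 = (g - 1) * (g + 1)" using g by (simp add: power2_eq_square algebra_simps)
  have a1: "\<bar>g - 1\<bar> \<le> \<bar>f - 1\<bar>"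
    unfolding fg abs_mult using g mult_left_mono[of 1 "\<bar>g + 1\<bar>" "\<bar>g - 1\<bar>"] by simp
  have "(g - 1)\<^sup>2 \<le> \<bar>f - 1\<bar> powr w"
  proof (cases "\<bar>f - 1\<bar> \<le> 1")
    case True
    have "(g - 1)\<^sup>2 \<le> \<bar>f - 1\<bar>\<^sup>2" using a1 by (metis abs_ge_zero power2_abs power_mono)
    also have "\<dots> \<le> \<bar>f - 1\<bar> powr w"
    proof (cases "f = 1")
      case False
      then have "\<bar>f - 1\<bar>\<^sup>2 = \<bar>f - 1\<bar> powr 2" by (simp add: powr_numeral)
      also have "\<dots> \<le> \<bar>f - 1\<bar> powr w" using w True by (intro powr_mono') auto
      finally show ?thesis .
    qed simp
    finally show ?thesis .
  next
    case False
    have "(g - 1)\<^sup>2 = \<bar>g - 1\<bar> * \<bar>g - 1\<bar>" by (simp add: power2_eq_square)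
    also have "\<dots> \<le> \<bar>g - 1\<bar> * \<bar>g + 1\<bar>" using g by (intro mult_left_mono) auto
    also have "\<dots> = \<bar>f - 1\<bar>" by (simp add: fg abs_mult)
    also have "\<dots> \<le> \<bar>f - 1\<bar> powr w" using False w powr_mono[of 1 w "\<bar>f - 1\<bar>"] by simp
    finally show ?thesis .
  qed
  moreover have "(1 + f) / 2 - g = (g - 1)\<^sup>2 / 2" using g by (simp add: power2_diff field_simps)
  ultimately show ?thesis using powr_ge_zero[of "\<bar>f - 1\<bar>" w] unfolding g_def[symmetric] by linarith
qed

lemma cosh_powr_le:
  fixes x w :: real
  assumes "w \<ge> 1"
  shows "cosh x powr w \<le> exp (w * x) + exp (- (w * x))"
proof -
  have "cosh x \<le> exp \<bar>x\<bar>" by (auto simp: cosh_def abs_if field_simps)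
  then have "cosh x powr w \<le> exp \<bar>x\<bar> powr w" using assms by (intro powr_mono2) (auto simp: cosh_real_nonneg)
  also have "\<dots> = exp (w * \<bar>x\<bar>)" by (simp add: powr_def)
  also have "\<dots> \<le> exp (w * x) + exp (- (w * x))" by (auto simp: abs_if)
  finally show ?thesis .
qed

lemma densities_cosh:
  "match_density s (x, y) = exp (- s\<^sup>2) * cosh (x + y)"
  "mixed_density e s (x, y) = exp (- s\<^sup>2) * ((1 - e) * cosh (x + y) + e * cosh (x - y))"
  by (simp_all add: match_density_def mixed_density_def lik_def cosh_def exp_add exp_diff exp_minus field_simps)

text \<open>With k and c the hyperbolic cosines of x + y and x - y, the density ratio f satisfies f
  - 1 = e * (c / k - 1). Weakening (c / k)^w to c^w / k, by k \<ge> 1, lets the factor k of the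
  matched density cancel and leaves exponentials with explicit Gaussian integrals.\<close>

lemma affinity_pointwise:
  assumes e: "0 \<le> e" "e \<le> 1" and w: "1 \<le> w" "w \<le> 2"
  shows "(match_density s v + mixed_density e s v) / 2 \<le> sqrt (match_density s v * mixed_density e s v) +
    e powr w * (match_density s v + exp (- s\<^sup>2) * (exp (w * (fst v - snd v)) + exp (- (w * (fst v - snd v)))))"
proof -
  obtain x y where v: "v = (x, y)" by (cases v)
  define k where "k = cosh (x + y)"
  define c where "c = cosh (x - y)"
  define m where "m = match_density s v"
  define f where "f = 1 - e + e * (c / k)"
  have k: "k \<ge> 1" and c: "c \<ge> 1" by (auto simp: k_def c_def cosh_real_ge_1)
  have m: "m = exp (- s\<^sup>2) * k" "m > 0" using k by (auto simp: m_def v k_def densities_cosh)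
  have mx: "mixed_density e s v = m * f" unfolding m f_def v densities_cosh k_def[symmetric] c_def[symmetric]
    using k by (simp add: field_simps)
  have f: "f \<ge> 0" using e k c by (auto simp: f_def)
  have "(m + m * f) / 2 = m * ((1 + f) / 2)" by (simp add: algebra_simps)
  also have "\<dots> \<le> m * (sqrt f + \<bar>f - 1\<bar> powr w)" using m by (intro mult_left_mono sqrt_lower_bound f w) auto
  also have "m * (sqrt f + \<bar>f - 1\<bar> powr w) = sqrt (m * (m * f)) + m * \<bar>f - 1\<bar> powr w"
    using m(2) by (simp add: real_sqrt_mult distrib_left)
  also have "m * \<bar>f - 1\<bar> powr w \<le> e powr w * (m + exp (- s\<^sup>2) * (exp (w * (x - y)) + exp (- (w * (x - y)))))"
  proof -
    have "f - 1 = e * (c / k - 1)" by (simp add: f_def algebra_simps)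
    then have "\<bar>f - 1\<bar> powr w = e powr w * \<bar>c / k - 1\<bar> powr w" using e by (simp add: abs_mult powr_mult)
    also have "\<bar>c / k - 1\<bar> powr w \<le> 1 + c powr w / k"
    proof (cases "c / k \<le> 1")
      case True
      have "\<bar>c / k - 1\<bar> \<le> 1" using True k c by (simp add: abs_if)
      then have "\<bar>c / k - 1\<bar> powr w \<le> 1" using w by (intro powr_le1) auto
      moreover have "0 \<le> c powr w / k" using k by simp
      ultimately show ?thesis by linarith
    next
      case False
      then have "\<bar>c / k - 1\<bar> powr w \<le> (c / k) powr w" using w by (intro powr_mono2) auto
      also have "\<dots> = c powr w / k powr w" using k c by (simp add: powr_divide)
      also have "\<dots> \<le> c powr w / k" using k w powr_mono[of 1 w k] by (intro divide_left_mono) auto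
      finally show ?thesis by simp
    qed
    finally have "m * \<bar>f - 1\<bar> powr w \<le> m * (e powr w * (1 + c powr w / k))" using m(2)
      by (simp add: mult_left_mono)
    also have "\<dots> = e powr w * (m + exp (- s\<^sup>2) * c powr w)" using k unfolding m(1) by (simp add: field_simps)
    also have "\<dots> \<le> e powr w * (m + exp (- s\<^sup>2) * (exp (w * (x - y)) + exp (- (w * (x - y)))))"
      unfolding c_def using w by (intro mult_left_mono add_left_mono cosh_powr_le) auto
    finally show ?thesis .
  qed
  finally show ?thesis unfolding mx m_def[symmetric] by (simp add: v m_def)
qed

text \<open>Integrate the pointwise bound: both densities have mass one, and each of the two
  exponential terms contributes exp ((w * s)^2 - s^2). The last summand thus bounds the affinity
  defect of a single coordinate.\<close>

lemma affinity_lower: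
  assumes e: "0 \<le> e" "e \<le> 1" and w: "1 \<le> w" "w \<le> 2"
  shows "1 \<le> (\<integral>\<^sup>+(x, y). ennreal (sqrt (match_density s (s * x, s * y) * mixed_density e s (s * x, s * y))) \<partial>(normal_law 0 \<Otimes>\<^sub>M normal_law 0))
     + ennreal (e powr w * (1 + 2 * exp (s\<^sup>2 * (w\<^sup>2 - 1))))"
proof -
  let ?N = "normal_law 0 \<Otimes>\<^sub>M normal_law 0"
  define E where "E a b = (\<lambda>(x, y). ennreal (lik s a b (s * x, s * y)))" for a b
  have Em[measurable]: "E a b \<in> borel_measurable (borel \<Otimes>\<^sub>M borel)" for a b
    unfolding E_def by measurable
  have EI: "integral\<^sup>N ?N (E a b) = 1" if "a \<in> {-1, 1}" "b \<in> {-1, 1}" for a b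
    unfolding E_def by (rule lik_integral[OF that])
  have l0: "lik s a b v > 0" for a b v by (simp add: lik_def split_beta')
  define hf :: real where "hf = 1 / 2"
  define he where "he = e / 2"
  have hf: "hf \<ge> 0" "hf * 2 = 1" and he: "he \<ge> 0" "he * 2 = e" using e by (auto simp: hf_def he_def)
  have half: "ennreal hf * 2 = 1"
    using ennreal_mult[of hf 2] hf by simp
  have half2: "ennreal hf + ennreal hf = 1" using half by (simp add: mult_2_right)
  have ehalf: "ennreal he * 2 = ennreal e"
    using ennreal_mult[of he 2] he by simp
  define F where "F c = (\<lambda>(x, y). ennreal (exp (c * x + (- c) * y + (- s\<^sup>2))))" for c
  have Fm[measurable]: "F c \<in> borel_measurable (borel \<Otimes>\<^sub>M borel)" for c unfolding F_def by measurable
  have mm[measurable]: "match_density s \<in> borel_measurable (borel \<Otimes>\<^sub>M borel)"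
    "mixed_density e s \<in> borel_measurable (borel \<Otimes>\<^sub>M borel)"
    unfolding match_density_def mixed_density_def by measurable
  have FI: "integral\<^sup>N ?N (F c) = ennreal (exp (c\<^sup>2 - s\<^sup>2))" for c
    unfolding F_def using normal_pair_mgf[of c "- c" "- s\<^sup>2"] by simp
  let ?m = "\<lambda>(x, y). ennreal (match_density s (s * x, s * y))"
  let ?x = "\<lambda>(x, y). ennreal (mixed_density e s (s * x, s * y))"
  let ?r = "\<lambda>(x, y). ennreal (sqrt (match_density s (s * x, s * y) * mixed_density e s (s * x, s * y)))"
  have md: "match_density s v = hf * (lik s 1 1 v + lik s (-1) (-1) v)" for v
    by (simp add: match_density_def hf_def)
  have xd: "mixed_density e s v = (1 - e) * match_density s v + he * (lik s 1 (-1) v + lik s (-1) 1 v)" for v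
    by (simp add: mixed_density_def he_def)
  have m0: "match_density s v \<ge> 0" for v unfolding md using hf l0 by (simp add: less_imp_le)
  have meq: "?m v = ennreal hf * (E 1 1 v + E (-1) (-1) v)" for v
    unfolding E_def md split_beta' using l0 hf by (simp add: ennreal_mult ennreal_plus less_imp_le)
  have mI: "integral\<^sup>N ?N ?m = 1"
    unfolding meq by (simp add: nn_integral_cmult nn_integral_add EI half)
  have xeq: "?x v = ennreal (1 - e) * ?m v + ennreal he * (E 1 (-1) v + E (-1) 1 v)" for v
    unfolding E_def xd split_beta' using l0 he e m0 by (simp add: ennreal_mult ennreal_plus less_imp_le)
  have xI: "integral\<^sup>N ?N ?x = 1"
  proof -
    have "integral\<^sup>N ?N ?x = ennreal (1 - e) * 1 + ennreal he * (1 + 1)"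
      unfolding xeq using mI by (simp add: nn_integral_cmult nn_integral_add EI)
    also have "\<dots> = ennreal (1 - e) + ennreal e" by (simp add: ehalf)
    also have "\<dots> = 1" using e by (subst ennreal_plus[symmetric]) auto
    finally show ?thesis .
  qed
  have pw: "ennreal hf * ?m v + ennreal hf * ?x v \<le> ?r v + ennreal (e powr w) * (?m v + (F (w * s) v + F (- (w * s)) v))" for v
  proof -
    obtain x y where v: "v = (x, y)" by (cases v)
    let ?u = "(s * x, s * y)"
    have nn: "match_density s ?u \<ge> 0" "mixed_density e s ?u \<ge> 0"
      using l0 e m0 he unfolding xd by (auto simp: less_imp_le intro!: add_nonneg_nonneg mult_nonneg_nonneg)
    have "hf * match_density s ?u + hf * mixed_density e s ?u \<le> sqrt (match_density s ?u * mixed_density e s ?u) +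
      e powr w * (match_density s ?u + (exp (w * s * x + (- (w * s)) * y + (- s\<^sup>2)) + exp ((- (w * s)) * x + (- (- (w * s))) * y + (- s\<^sup>2))))"
      using affinity_pointwise[OF e w, of s ?u]
      by (simp add: hf_def distrib_left exp_add[symmetric] algebra_simps add_divide_distrib)
    from ennreal_leI[OF this] nn hf show ?thesis
      by (simp add: v F_def ennreal_mult ennreal_plus)
  qed
  have "1 = ennreal hf * integral\<^sup>N ?N ?m + ennreal hf * integral\<^sup>N ?N ?x"
    unfolding mI xI using half2 by simp
  also have "\<dots> = (\<integral>\<^sup>+v. ennreal hf * ?m v + ennreal hf * ?x v \<partial>?N)"
    by (simp add: nn_integral_add nn_integral_cmult)
  also have "\<dots> \<le> (\<integral>\<^sup>+v. ?r v + ennreal (e powr w) * (?m v + (F (w * s) v + F (- (w * s)) v)) \<partial>?N)"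
    by (intro nn_integral_mono pw)
  also have "\<dots> = integral\<^sup>N ?N ?r + ennreal (e powr w) * (1 + (ennreal (exp ((w * s)\<^sup>2 - s\<^sup>2)) + ennreal (exp ((w * s)\<^sup>2 - s\<^sup>2))))"
    using mI by (simp add: nn_integral_add nn_integral_cmult FI)
  also have "ennreal (e powr w) * (1 + (ennreal (exp ((w * s)\<^sup>2 - s\<^sup>2)) + ennreal (exp ((w * s)\<^sup>2 - s\<^sup>2)))) =
     ennreal (e powr w * (1 + (exp ((w * s)\<^sup>2 - s\<^sup>2) + exp ((w * s)\<^sup>2 - s\<^sup>2))))"
  proof -
    have "ennreal (1 + (X + X)) = ennreal 1 + (ennreal X + ennreal X)" if "X \<ge> 0" for X
      using that ennreal_plus[of 1 "X + X"] ennreal_plus[of X X] by (simp only: add_nonneg_nonneg zero_le_one)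
    then have "ennreal (1 + (exp ((w * s)\<^sup>2 - s\<^sup>2) + exp ((w * s)\<^sup>2 - s\<^sup>2))) =
      1 + (ennreal (exp ((w * s)\<^sup>2 - s\<^sup>2)) + ennreal (exp ((w * s)\<^sup>2 - s\<^sup>2)))" by simp
    then show ?thesis by (metis ennreal_mult' powr_ge_zero)
  qed
  also have "(w * s)\<^sup>2 - s\<^sup>2 = s\<^sup>2 * (w\<^sup>2 - 1)" by (simp add: power_mult_distrib algebra_simps)
  finally show ?thesis by simp
qed

subsection \<open>The Bayes risk under a random sign pattern\<close>

text \<open>Finite distributivity. A prior with independent coordinates turns a sum over all sign
  patterns into a product of four-term sums.\<close>

lemma sum_sign_vectors_prod:
  fixes F :: "real \<Rightarrow> real \<Rightarrow> nat \<Rightarrow> 'c :: comm_semiring_1"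
  shows "(\<Sum>z\<in>sign_vectors n. \<Sum>\<sigma>\<in>sign_vectors n. \<Prod>i<n. F (z i) (\<sigma> i) i) = (\<Prod>i<n. \<Sum>a\<in>{-1, 1}. \<Sum>b\<in>{-1, 1}. F a b i)"
proof -
  have "(\<Sum>z\<in>sign_vectors n. \<Sum>\<sigma>\<in>sign_vectors n. \<Prod>i<n. F (z i) (\<sigma> i) i) = (\<Sum>z\<in>sign_vectors n. \<Prod>i<n. \<Sum>b\<in>{-1, 1}. F (z i) b i)"
    unfolding sign_vectors_def by (intro sum.cong refl prod_sum_PiE[symmetric]) auto
  also have "\<dots> = (\<Prod>i<n. \<Sum>a\<in>{-1, 1}. \<Sum>b\<in>{-1, 1}. F a b i)"
    unfolding sign_vectors_def by (intro prod_sum_PiE[symmetric]) auto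
  finally show ?thesis .
qed

text \<open>Prior mass of a pattern: z is uniform and \<sigma> arises from z by independent flips
  with probability e. At e = 0 all mass sits on \<sigma> = z, which gives the null prior.\<close>

definition flip_weight :: "real \<Rightarrow> nat \<Rightarrow> (nat \<Rightarrow> real) \<Rightarrow> (nat \<Rightarrow> real) \<Rightarrow> real" where
  "flip_weight e n z \<sigma> = (\<Prod>i<n. (if z i = \<sigma> i then 1 - e else e) / 2)"

lemma flip_weight_nonneg: "0 \<le> e \<Longrightarrow> e \<le> 1 \<Longrightarrow> 0 \<le> flip_weight e n z \<sigma>"
  unfolding flip_weight_def by (intro prod_nonneg) auto

lemma flip_weight_sum: "(\<Sum>z\<in>sign_vectors n. \<Sum>\<sigma>\<in>sign_vectors n. flip_weight e n z \<sigma>) = 1"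
  unfolding flip_weight_def
  by (subst sum_sign_vectors_prod[where F="\<lambda>a b i. (if a = b then 1 - e else e) / 2"]) simp

lemma flip_weight_zero:
  assumes "z \<in> sign_vectors n" "\<sigma> \<in> sign_vectors n" "flip_weight 0 n z \<sigma> \<noteq> 0"
  shows "ell n z \<sigma> = 0"
proof -
  have "z i = \<sigma> i" if "i < n" for i
    using assms(3) that unfolding flip_weight_def by (auto split: if_splits)
  then have "{i\<in>{..<n}. z i \<noteq> \<sigma> i} = {}" by auto
  then have "real (card {i\<in>{..<n}. z i \<noteq> \<sigma> i}) / real n = 0" by (simp only: card.empty)
  then show ?thesis unfolding ell_def by (simp only: min_def) simp
qed

text \<open>Exponential Markov inequality for the number of flips, respectively of non-flips.\<close>
lemma flip_weight_tail:
  assumes \<epsilon>: "0 \<le> \<epsilon>" "\<epsilon> \<le> 1 / 8" and n: "n \<ge> 1"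
  shows "(\<Sum>z\<in>sign_vectors n. \<Sum>\<sigma>\<in>sign_vectors n. if ell n z \<sigma> > \<epsilon> then 0 else flip_weight (4 * \<epsilon>) n z \<sigma>) \<le> 2 * exp (- (real n * \<epsilon>))"
proof -
  define e where "e = 4 * \<epsilon>"
  have e: "0 \<le> e" "e \<le> 1/2" using \<epsilon> by (auto simp: e_def)
  define q where "q = exp (-1 :: real)"
  have q: "0 < q" "q \<le> 1/2"
  proof -
    have "2 \<le> exp (1::real)" using exp_ge_add_one_self[of 1] by simp
    then show "q \<le> 1/2" by (simp add: q_def exp_minus field_simps)
  qed (simp add: q_def)
  define W1 where "W1 z \<sigma> = (\<Prod>i<n. (if z i = \<sigma> i then 1 - e else e) / 2 * (if z i \<noteq> \<sigma> i then q else 1))" for z \<sigma> :: "nat \<Rightarrow> real"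
  define W2 where "W2 z \<sigma> = (\<Prod>i<n. (if z i = \<sigma> i then 1 - e else e) / 2 * (if z i \<noteq> - \<sigma> i then q else 1))" for z \<sigma> :: "nat \<Rightarrow> real"
  have card: "(\<Prod>i<n. if P i then q else 1) = exp (- real (card {i\<in>{..<n}. P i}))" for P
  proof -
    have "(\<Prod>i<n. if P i then q else 1) = q ^ card {i\<in>{..<n}. P i}"
      by (simp add: prod.If_cases Int_def)
    then show ?thesis by (simp add: q_def exp_of_nat_mult[symmetric])
  qed
  have le: "(if ell n z \<sigma> > \<epsilon> then 0 else flip_weight e n z \<sigma>) \<le> exp (real n * \<epsilon>) * W1 z \<sigma> + exp (real n * \<epsilon>) * W2 z \<sigma>" for z \<sigma>
  proof -
    let ?w = "flip_weight e n z \<sigma>"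
    have w: "?w \<ge> 0" using e by (intro flip_weight_nonneg) auto
    have W1: "W1 z \<sigma> = ?w * exp (- real (card {i\<in>{..<n}. z i \<noteq> \<sigma> i}))"
      unfolding W1_def flip_weight_def prod.distrib card ..
    have W2: "W2 z \<sigma> = ?w * exp (- real (card {i\<in>{..<n}. z i \<noteq> - \<sigma> i}))"
      unfolding W2_def flip_weight_def prod.distrib card ..
    have pos: "exp (real n * \<epsilon>) * W1 z \<sigma> \<ge> 0" "exp (real n * \<epsilon>) * W2 z \<sigma> \<ge> 0" using w by (simp_all add: W1 W2)
    have key: "?w \<le> exp (real n * \<epsilon>) * (?w * exp (- c))" if "c / real n \<le> \<epsilon>" for c
    proof -
      have "c \<le> real n * \<epsilon>" using that n by (simp add: field_simps)
      then have "1 \<le> exp (real n * \<epsilon> + - c)" by simp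
      from mult_left_mono[OF this w] show ?thesis by (simp only: exp_add mult_ac mult_1_right)
    qed
    show ?thesis
    proof (cases "ell n z \<sigma> > \<epsilon>")
      case True then show ?thesis using pos by simp
    next
      case False
      then consider "real (card {i\<in>{..<n}. z i \<noteq> \<sigma> i}) / real n \<le> \<epsilon>" | "real (card {i\<in>{..<n}. z i \<noteq> - \<sigma> i}) / real n \<le> \<epsilon>"
        unfolding ell_def by linarith
      then show ?thesis
      proof cases
        case 1
        from key[OF this] show ?thesis using False pos(2) unfolding W1[symmetric] by simp
      next
        case 2
        from key[OF this] show ?thesis using False pos(1) unfolding W2[symmetric] by simp
      qed
    qed
  qed
  have S1: "(\<Sum>z\<in>sign_vectors n. \<Sum>\<sigma>\<in>sign_vectors n. W1 z \<sigma>) = ((1 - e) + e * q) ^ n"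
    unfolding W1_def
    by (subst sum_sign_vectors_prod[where F="\<lambda>a b i. (if a = b then 1 - e else e) / 2 * (if a \<noteq> b then q else 1)"]) (simp add: add.commute)
  have S2: "(\<Sum>z\<in>sign_vectors n. \<Sum>\<sigma>\<in>sign_vectors n. W2 z \<sigma>) = ((1 - e) * q + e) ^ n"
    unfolding W2_def
    by (subst sum_sign_vectors_prod[where F="\<lambda>a b i. (if a = b then 1 - e else e) / 2 * (if a \<noteq> - b then q else 1)"]) (simp add: add.commute mult.commute)
  \<comment> \<open>The rate e = 4 * \<epsilon> leaves room in both generating factors: 1 - e + e *
    q is at most 1 - e / 2 = 1 - 2 * \<epsilon>, and (1 - e) * q + e is at most 1/2 + 2 *
    \<epsilon>, which is at most 1 - 2 * \<epsilon> because \<epsilon> \<le> 1/8. Markov's factor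
    exp (n * \<epsilon>) then takes back one of the two \<epsilon>.\<close>
  have pw: "x ^ n \<le> exp (- (real n * (2 * \<epsilon>)))" if "0 \<le> x" "x \<le> 1 - 2 * \<epsilon>" for x :: real
  proof -
    have "x \<le> exp (- (2 * \<epsilon>))" using that(2) exp_ge_add_one_self[of "- (2 * \<epsilon>)"] by simp
    then have "x ^ n \<le> exp (- (2 * \<epsilon>)) ^ n" using that(1) by (intro power_mono) auto
    then show ?thesis by (simp add: exp_of_nat_mult[symmetric])
  qed
  have "e * q \<le> e * (1/2)" "(1 - e) * q \<le> (1 - e) * (1/2)" using q e by (intro mult_left_mono; simp)+
  note qe = this
  have b1: "(1 - e) + e * q \<le> 1 - 2 * \<epsilon>" using qe(1) e_def by linarith
  have "X + e \<le> 1 - 2 * \<epsilon>" if "X \<le> (1 - e) * (1 / 2)" for X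
    using that \<epsilon> by (simp add: e_def)
  then have b2: "(1 - e) * q + e \<le> 1 - 2 * \<epsilon>" using qe(2) by blast
  have "(\<Sum>z\<in>sign_vectors n. \<Sum>\<sigma>\<in>sign_vectors n. if ell n z \<sigma> > \<epsilon> then 0 else flip_weight e n z \<sigma>) \<le>
    (\<Sum>z\<in>sign_vectors n. \<Sum>\<sigma>\<in>sign_vectors n. exp (real n * \<epsilon>) * W1 z \<sigma> + exp (real n * \<epsilon>) * W2 z \<sigma>)"
    by (intro sum_mono le)
  also have "\<dots> = exp (real n * \<epsilon>) * ((1 - e) + e * q) ^ n + exp (real n * \<epsilon>) * ((1 - e) * q + e) ^ n"
    by (simp only: sum.distrib sum_distrib_left[symmetric] S1 S2)
  also have "\<dots> \<le> exp (real n * \<epsilon>) * exp (- (real n * (2 * \<epsilon>))) + exp (real n * \<epsilon>) * exp (- (real n * (2 * \<epsilon>)))"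
    using e q b1 b2 by (intro add_mono mult_left_mono pw) auto
  also have "\<dots> = 2 * exp (- (real n * \<epsilon>))" by (simp add: exp_add[symmetric] algebra_simps)
  finally show ?thesis unfolding e_def .
qed

lemma flip_mixture:
  assumes e: "0 \<le> e" "e \<le> 1"
  shows "(\<Sum>z\<in>sign_vectors n. \<Sum>\<sigma>\<in>sign_vectors n. ennreal (flip_weight e n z \<sigma>) * (\<Prod>i<n. ennreal (lik s (z i) (\<sigma> i) (v i)))) =
    (\<Prod>i<n. ennreal (mixed_density e s (v i)))"
proof -
  have l0: "lik s a b v \<ge> 0" for a b v by (simp add: lik_def split_beta')
  have "(\<Sum>z\<in>sign_vectors n. \<Sum>\<sigma>\<in>sign_vectors n. ennreal (flip_weight e n z \<sigma>) * (\<Prod>i<n. ennreal (lik s (z i) (\<sigma> i) (v i)))) =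
    (\<Sum>z\<in>sign_vectors n. \<Sum>\<sigma>\<in>sign_vectors n. (\<Prod>i<n. ennreal ((if z i = \<sigma> i then 1 - e else e) / 2 * lik s (z i) (\<sigma> i) (v i))))"
  proof (intro sum.cong refl)
    fix z \<sigma> :: "nat \<Rightarrow> real"
    show "ennreal (flip_weight e n z \<sigma>) * (\<Prod>i<n. ennreal (lik s (z i) (\<sigma> i) (v i))) =
      (\<Prod>i<n. ennreal ((if z i = \<sigma> i then 1 - e else e) / 2 * lik s (z i) (\<sigma> i) (v i)))"
    proof -
      have c: "0 \<le> (if z i = \<sigma> i then 1 - e else e) / 2" for i using e by simp
      show ?thesis
        unfolding flip_weight_def prod_ennreal[OF c, symmetric] prod.distrib[symmetric]
        by (intro prod.cong refl ennreal_mult[symmetric] c l0)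
    qed
  qed
  also have "\<dots> = (\<Prod>i<n. \<Sum>a\<in>{-1, 1}. \<Sum>b\<in>{-1, 1}. ennreal ((if a = b then 1 - e else e) / 2 * lik s a b (v i)))"
    by (rule sum_sign_vectors_prod[where F="\<lambda>a b i. ennreal ((if a = b then 1 - e else e) / 2 * lik s a b (v i))"])
  also have "\<dots> = (\<Prod>i<n. ennreal (mixed_density e s (v i)))"
  proof (rule prod.cong[OF refl])
    fix i
    have "(\<Sum>a\<in>{-1, 1}. \<Sum>b\<in>{-1, 1}. ennreal ((if a = b then 1 - e else e) / 2 * lik s a b (v i))) =
      ennreal (\<Sum>a\<in>{-1, 1}. \<Sum>b\<in>{-1, 1}. (if a = b then 1 - e else e) / 2 * lik s a b (v i))"
    proof -
      have ee: "(\<Sum>a\<in>{-1, 1}. \<Sum>b\<in>{-1, 1}. ennreal (f a b)) = ennreal (\<Sum>a\<in>{-1, 1}. \<Sum>b\<in>{-1, 1}. f a b)"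
        if "\<And>a b. f a b \<ge> 0" for f :: "real \<Rightarrow> real \<Rightarrow> real"
        using that by (simp only: sum_ennreal sum_nonneg)
      show ?thesis by (rule ee) (use e l0 in simp)
    qed
    also have "(\<Sum>a\<in>{-1, 1}. \<Sum>b\<in>{-1, 1}. (if a = b then 1 - e else e) / 2 * lik s a b (v i)) = mixed_density e s (v i)"
    proof -
      have alg: "(1 - e) / 2 * A + e / 2 * B + (e / 2 * C + (1 - e) / 2 * D) = (1 - e) * ((D + A) / 2) + e * ((C + B) / 2)" for A B C D
        by (simp add: field_simps)
      have "(\<Sum>a\<in>{-1, 1}. \<Sum>b\<in>{-1, 1}. (if a = b then 1 - e else e) / 2 * lik s a b (v i)) =
        (1 - e) / 2 * lik s (-1) (-1) (v i) + e / 2 * lik s (-1) 1 (v i) + (e / 2 * lik s 1 (-1) (v i) + (1 - e) / 2 * lik s 1 1 (v i))"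
        by simp
      then show ?thesis unfolding alg mixed_density_def match_density_def .
    qed
    finally show "(\<Sum>a\<in>{-1, 1}. \<Sum>b\<in>{-1, 1}. ennreal ((if a = b then 1 - e else e) / 2 * lik s a b (v i))) = ennreal (mixed_density e s (v i))" .
  qed
  finally show ?thesis .
qed

text \<open>The prior average of a risk is a single integral: mixing the product likelihoods over
  independent sign pairs gives again a product, with one \<open>mixed_density\<close> factor per
  coordinate.\<close>

lemma flip_average:
  assumes s: "euclid_norm p \<theta> = s" "euclid_norm q \<eta> = s" "s > 0" and e: "0 \<le> e" "e \<le> 1"
    and \<phi>: "\<phi> \<in> borel_measurable (sample_space n p q)"
  shows "(\<Sum>z\<in>sign_vectors n. \<Sum>\<sigma>\<in>sign_vectors n. ennreal (flip_weight e n z \<sigma>) * (\<integral>\<^sup>+x. \<phi> x \<partial>sample_law n p q \<theta> \<eta> z \<sigma>)) =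
    (\<integral>\<^sup>+x. (\<Prod>i<n. ennreal (mixed_density e s (inner_pair p q \<theta> \<eta> x i))) * \<phi> x \<partial>base_law n p q)"
proof -
  have \<phi>m[measurable]: "\<phi> \<in> borel_measurable (base_law n p q)"
    using \<phi> by (simp add: measurable_cong_sets[OF sets_base_law refl])
  have dm[measurable]: "(\<lambda>x. \<Prod>i<n. ennreal (lik s (z i) (\<sigma> i) (inner_pair p q \<theta> \<eta> x i))) \<in> borel_measurable (base_law n p q)" for z \<sigma>
    by (intro borel_measurable_prod_ennreal measurable_compose[OF _ measurable_ennreal] measurable_compose[OF inner_pair_measurable lik_measurable]) auto
  have "(\<Sum>z\<in>sign_vectors n. \<Sum>\<sigma>\<in>sign_vectors n. ennreal (flip_weight e n z \<sigma>) * (\<integral>\<^sup>+x. \<phi> x \<partial>sample_law n p q \<theta> \<eta> z \<sigma>)) =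
    (\<Sum>z\<in>sign_vectors n. \<Sum>\<sigma>\<in>sign_vectors n. \<integral>\<^sup>+x. ennreal (flip_weight e n z \<sigma>) * (\<Prod>i<n. ennreal (lik s (z i) (\<sigma> i) (inner_pair p q \<theta> \<eta> x i))) * \<phi> x \<partial>base_law n p q)"
  proof (intro sum.cong refl)
    fix z \<sigma> assume z: "z \<in> sign_vectors n" "\<sigma> \<in> sign_vectors n"
    show "ennreal (flip_weight e n z \<sigma>) * (\<integral>\<^sup>+x. \<phi> x \<partial>sample_law n p q \<theta> \<eta> z \<sigma>) =
      (\<integral>\<^sup>+x. ennreal (flip_weight e n z \<sigma>) * (\<Prod>i<n. ennreal (lik s (z i) (\<sigma> i) (inner_pair p q \<theta> \<eta> x i))) * \<phi> x \<partial>base_law n p q)"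
      unfolding sample_law_density[OF s(1,2) z] mult.assoc
      by (subst nn_integral_density[OF dm \<phi>m], subst nn_integral_cmult) auto
  qed
  also have "\<dots> = (\<Sum>z\<in>sign_vectors n. \<integral>\<^sup>+x. (\<Sum>\<sigma>\<in>sign_vectors n. ennreal (flip_weight e n z \<sigma>) * (\<Prod>i<n. ennreal (lik s (z i) (\<sigma> i) (inner_pair p q \<theta> \<eta> x i))) * \<phi> x) \<partial>base_law n p q)"
    by (intro sum.cong refl nn_integral_sum[symmetric]) measurable
  also have "\<dots> = (\<integral>\<^sup>+x. (\<Sum>z\<in>sign_vectors n. \<Sum>\<sigma>\<in>sign_vectors n. ennreal (flip_weight e n z \<sigma>) * (\<Prod>i<n. ennreal (lik s (z i) (\<sigma> i) (inner_pair p q \<theta> \<eta> x i))) * \<phi> x) \<partial>base_law n p q)"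
    by (intro nn_integral_sum[symmetric]) measurable
  also have "\<dots> = (\<integral>\<^sup>+x. (\<Prod>i<n. ennreal (mixed_density e s (inner_pair p q \<theta> \<eta> x i))) * \<phi> x \<partial>base_law n p q)"
    by (simp only: sum_distrib_right[symmetric] flip_mixture[OF e])
  finally show ?thesis .
qed

section \<open>From the Bayes risk to the error of an arbitrary test\<close>

lemma prob_space_sample_law: "prob_space (sample_law n p q \<theta> \<eta> z \<sigma>)"
  unfolding sample_law_def by (intro prob_space_pair prob_space_PiM) auto

text \<open>The arithmetic-geometric mean inequality for 2 * a and b / 2, with a the smaller number.
  Integrated over two probability densities it says that the affinity is at most the overlap plus
  1/2, so an affinity near 1 forces an overlap, hence a testing error, near 1/2 at least.\<close>

lemma sqrt_mult_le_min:
  fixes x y :: real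
  assumes "x \<ge> 0" "y \<ge> 0"
  shows "sqrt (x * y) \<le> min x y + (x + y) / 4"
proof -
  have *: "sqrt (a * b) \<le> a + b / 4" if "a \<ge> 0" "b \<ge> 0" for a b :: real
    using arith_geo_mean_sqrt[of "2 * a" "b / 2"] that by simp
  show ?thesis
  proof (cases "x \<le> y")
    case True then show ?thesis using *[OF assms] assms by (simp add: min_def field_simps)
  next
    case False then show ?thesis using *[OF assms(2,1)] assms by (simp add: min_def field_simps)
  qed
qed

text \<open>The affinity of the two n-fold mixtures is at least 1 - n * H, and it is at most 1/2
  plus the sum of the Bayes errors. Replacing Bayes errors by suprema costs the prior mass outside
  the alternative. With n * H and that mass together at most 1/4, an error of 1/4 remains.\<close>

lemma test_error_lower:
  assumes s: "euclid_norm p \<theta> = s" "euclid_norm q \<eta> = s" "s > 0"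
    and \<epsilon>: "0 \<le> \<epsilon>" "\<epsilon> \<le> 1 / 8" and n: "n \<ge> 1" and w: "1 \<le> w" "w \<le> 2"
    and \<psi>: "\<psi> \<in> tests n p q"
    and H: "H = (4 * \<epsilon>) powr w * (1 + 2 * exp (s\<^sup>2 * (w\<^sup>2 - 1)))" "real n * H + 2 * exp (- (real n * \<epsilon>)) \<le> 1 / 4"
  shows "test_error n p q \<psi> \<theta> \<eta> \<epsilon> \<ge> ennreal (1 / 4)"
proof -
  let ?e = "4 * \<epsilon>"
  have e: "0 \<le> ?e" "?e \<le> 1" using \<epsilon> by auto
  let ?SV = "sign_vectors n"
  let ?P = "\<lambda>z \<sigma>. sample_law n p q \<theta> \<eta> z \<sigma>"
  let ?G = "\<lambda>e x. \<Prod>i<n. mixed_density e s (inner_pair p q \<theta> \<eta> x i)"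
  let ?B = "base_law n p q"
  define R0 where "R0 = (SUP (z, \<sigma>) \<in> {(z, \<sigma>) \<in> ?SV \<times> ?SV. ell n z \<sigma> = 0}. \<integral>\<^sup>+ x. ennreal (\<psi> x) \<partial>?P z \<sigma>)"
  define R1 where "R1 = (SUP (z, \<sigma>) \<in> {(z, \<sigma>) \<in> ?SV \<times> ?SV. ell n z \<sigma> > \<epsilon>}. \<integral>\<^sup>+ x. ennreal (1 - \<psi> x) \<partial>?P z \<sigma>)"
  have R: "test_error n p q \<psi> \<theta> \<eta> \<epsilon> = R0 + R1" by (simp add: test_error_def R0_def R1_def)
  have \<psi>m: "\<psi> \<in> borel_measurable (sample_space n p q)" and \<psi>01: "\<And>x. x \<in> space (sample_space n p q) \<Longrightarrow> 0 \<le> \<psi> x \<and> \<psi> x \<le> 1"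
    using \<psi> by (auto simp: tests_def)
  have spB: "space ?B = space (sample_space n p q)" "space (?P z \<sigma>) = space (sample_space n p q)" for z \<sigma>
    by (rule sets_eq_imp_space_eq[OF sets_base_law], rule sets_eq_imp_space_eq[OF sets_sample_law])
  have mx0: "mixed_density e' s v \<ge> 0" if "0 \<le> e'" "e' \<le> 1" for e' v
    using that by (cases v) (auto simp: densities_cosh cosh_real_nonneg intro!: mult_nonneg_nonneg add_nonneg_nonneg)
  have G0: "?G e' x \<ge> 0" if "0 \<le> e'" "e' \<le> 1" for e' x by (intro prod_nonneg ballI mx0 that)
  have Ge: "(\<Prod>i<n. ennreal (mixed_density e' s (inner_pair p q \<theta> \<eta> x i))) = ennreal (?G e' x)" if "0 \<le> e'" "e' \<le> 1" for e' x
    by (intro prod_ennreal mx0 that)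
  have mm: "mixed_density e' s \<in> borel_measurable (borel \<Otimes>\<^sub>M borel)" for e'
    unfolding mixed_density_def match_density_def by measurable
  have Gm[measurable]: "?G e' \<in> borel_measurable ?B" for e'
    by (intro borel_measurable_prod measurable_compose[OF inner_pair_measurable mm]) auto
  have \<psi>B[measurable]: "\<psi> \<in> borel_measurable ?B" using \<psi>m by (simp add: measurable_cong_sets[OF sets_base_law refl])
  \<comment> \<open>All mass of the prior with e = 0 lies on the null hypothesis, so its average is
    at most the supremum there.\<close>
  have A0: "(\<integral>\<^sup>+x. ennreal (?G 0 x) * ennreal (\<psi> x) \<partial>?B) \<le> R0"
  proof -
    have "(\<integral>\<^sup>+x. ennreal (?G 0 x) * ennreal (\<psi> x) \<partial>?B) =
      (\<Sum>z\<in>?SV. \<Sum>\<sigma>\<in>?SV. ennreal (flip_weight 0 n z \<sigma>) * (\<integral>\<^sup>+x. ennreal (\<psi> x) \<partial>?P z \<sigma>))"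
      using flip_average[OF s, of 0 "\<lambda>x. ennreal (\<psi> x)" n] \<psi>m by (simp add: Ge)
    also have "\<dots> \<le> (\<Sum>z\<in>?SV. \<Sum>\<sigma>\<in>?SV. ennreal (flip_weight 0 n z \<sigma>) * R0)"
    proof (intro sum_mono)
      fix z \<sigma> assume z: "z \<in> ?SV" "\<sigma> \<in> ?SV"
      show "ennreal (flip_weight 0 n z \<sigma>) * (\<integral>\<^sup>+x. ennreal (\<psi> x) \<partial>?P z \<sigma>) \<le> ennreal (flip_weight 0 n z \<sigma>) * R0"
      proof (cases "flip_weight 0 n z \<sigma> = 0")
        case False
        then have "(z, \<sigma>) \<in> {(z, \<sigma>) \<in> ?SV \<times> ?SV. ell n z \<sigma> = 0}" using flip_weight_zero[OF z] z by auto
        then have "(\<integral>\<^sup>+x. ennreal (\<psi> x) \<partial>?P z \<sigma>) \<le> R0" unfolding R0_def by (rule SUP_upper2) simp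
        then show ?thesis by (rule mult_left_mono) simp
      qed simp
    qed
    also have "\<dots> = R0"
      using flip_weight_nonneg[of 0 n] flip_weight_sum[of 0 n]
      by (simp add: sum_distrib_right[symmetric] sum_ennreal sum_nonneg)
    finally show ?thesis .
  qed
  \<comment> \<open>Patterns outside the alternative are charged the trivial error 1; their prior
    mass is bounded by \<open>flip_weight_tail\<close>.\<close>
  have A1: "(\<integral>\<^sup>+x. ennreal (?G ?e x) * ennreal (1 - \<psi> x) \<partial>?B) \<le> R1 + ennreal (2 * exp (- (real n * \<epsilon>)))"
  proof -
    have fw: "flip_weight ?e n z \<sigma> \<ge> 0" for z \<sigma> by (rule flip_weight_nonneg[OF e])
    have "(\<integral>\<^sup>+x. ennreal (?G ?e x) * ennreal (1 - \<psi> x) \<partial>?B) =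
      (\<Sum>z\<in>?SV. \<Sum>\<sigma>\<in>?SV. ennreal (flip_weight ?e n z \<sigma>) * (\<integral>\<^sup>+x. ennreal (1 - \<psi> x) \<partial>?P z \<sigma>))"
      using flip_average[OF s e, of "\<lambda>x. ennreal (1 - \<psi> x)" n] \<psi>m by (simp add: Ge[OF e])
    also have "\<dots> \<le> (\<Sum>z\<in>?SV. \<Sum>\<sigma>\<in>?SV. ennreal (flip_weight ?e n z \<sigma>) * R1 + ennreal (if ell n z \<sigma> > \<epsilon> then 0 else flip_weight ?e n z \<sigma>))"
    proof (intro sum_mono)
      fix z \<sigma> assume z: "z \<in> ?SV" "\<sigma> \<in> ?SV"
      show "ennreal (flip_weight ?e n z \<sigma>) * (\<integral>\<^sup>+x. ennreal (1 - \<psi> x) \<partial>?P z \<sigma>) \<le>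
        ennreal (flip_weight ?e n z \<sigma>) * R1 + ennreal (if ell n z \<sigma> > \<epsilon> then 0 else flip_weight ?e n z \<sigma>)"
      proof (cases "ell n z \<sigma> > \<epsilon>")
        case True
        then have "(z, \<sigma>) \<in> {(z, \<sigma>) \<in> ?SV \<times> ?SV. ell n z \<sigma> > \<epsilon>}" using z by auto
        then have "(\<integral>\<^sup>+x. ennreal (1 - \<psi> x) \<partial>?P z \<sigma>) \<le> R1" unfolding R1_def by (rule SUP_upper2) simp
        then show ?thesis using True by (simp add: mult_left_mono)
      next
        case False
        have "(\<integral>\<^sup>+x. ennreal (1 - \<psi> x) \<partial>?P z \<sigma>) \<le> (\<integral>\<^sup>+x. 1 \<partial>?P z \<sigma>)"
          using \<psi>01 by (intro nn_integral_mono) (auto simp: spB ennreal_le_1)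
        also have "\<dots> = 1" using prob_space.emeasure_space_1[OF prob_space_sample_law] by simp
        finally have "ennreal (flip_weight ?e n z \<sigma>) * (\<integral>\<^sup>+x. ennreal (1 - \<psi> x) \<partial>?P z \<sigma>) \<le> ennreal (flip_weight ?e n z \<sigma>) * 1"
          by (rule mult_left_mono) simp
        then show ?thesis using False by (simp add: add_increasing)
      qed
    qed
    also have "\<dots> = R1 + ennreal (\<Sum>z\<in>?SV. \<Sum>\<sigma>\<in>?SV. if ell n z \<sigma> > \<epsilon> then 0 else flip_weight ?e n z \<sigma>)"
      using fw flip_weight_sum[of ?e n]
      by (simp add: sum.distrib sum_distrib_right[symmetric] sum_ennreal sum_nonneg)
    also have "\<dots> \<le> R1 + ennreal (2 * exp (- (real n * \<epsilon>)))"
      by (intro add_left_mono ennreal_leI flip_weight_tail \<epsilon> n)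
    finally show ?thesis .
  qed
  have G1: "(\<integral>\<^sup>+x. ennreal (?G e' x) \<partial>?B) = 1" if e': "0 \<le> e'" "e' \<le> 1" for e'
  proof -
    have "(\<integral>\<^sup>+x. ennreal (?G e' x) \<partial>?B) = (\<Sum>z\<in>?SV. \<Sum>\<sigma>\<in>?SV. ennreal (flip_weight e' n z \<sigma>) * (\<integral>\<^sup>+x. 1 \<partial>?P z \<sigma>))"
      using flip_average[OF s e', of "\<lambda>x. 1" n] by (simp add: Ge[OF e'])
    also have "\<dots> = 1"
      using prob_space.emeasure_space_1[OF prob_space_sample_law] flip_weight_nonneg[OF e'] flip_weight_sum[of e' n]
      by (simp add: sum_ennreal sum_nonneg)
    finally show ?thesis .
  qed
  define \<rho> where "\<rho> = (\<integral>\<^sup>+(x, y). ennreal (sqrt (match_density s (s * x, s * y) * mixed_density ?e s (s * x, s * y))) \<partial>(normal_law 0 \<Otimes>\<^sub>M normal_law 0))"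
  have md0: "match_density s = mixed_density 0 s" by (simp add: mixed_density_def fun_eq_iff)
  have sq: "(\<integral>\<^sup>+x. ennreal (sqrt (?G 0 x * ?G ?e x)) \<partial>?B) = \<rho> ^ n"
  proof -
    have "ennreal (sqrt (?G 0 x * ?G ?e x)) = (\<Prod>i<n. ennreal (sqrt (match_density s (inner_pair p q \<theta> \<eta> x i) * mixed_density ?e s (inner_pair p q \<theta> \<eta> x i))))" for x
    proof -
      have "sqrt (\<Prod>i<n. f i) = (\<Prod>i<n. sqrt (f i))" for f :: "nat \<Rightarrow> real"
        by (induction n) (simp_all add: real_sqrt_mult)
      then show ?thesis using mx0 e
        by (subst prod_ennreal) (auto simp: md0 prod.distrib[symmetric])
    qed
    then show ?thesis unfolding \<rho>_def
      using base_law_integral_prod[OF s, of "\<lambda>v. ennreal (sqrt (match_density s v * mixed_density ?e s v))" n] mm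
      by (simp add: md0)
  qed
  have H0: "H \<ge> 0" using H(1) by simp
  have nH: "real n * H \<le> 1/4" using H(2) exp_ge_zero[of "- (real n * \<epsilon>)"] by linarith
  have H1: "H \<le> 1" using nH n mult_right_mono[of 1 "real n" H] H0 by simp
  have \<rho>: "ennreal (1 - H) \<le> \<rho>"
  proof -
    have "ennreal 1 \<le> \<rho> + ennreal H" using affinity_lower[OF e w, of s] by (simp add: \<rho>_def H(1))
    then have "ennreal 1 - ennreal H \<le> \<rho>" by (simp add: ennreal_minus_le_iff add.commute)
    then show ?thesis using H0 by (simp add: ennreal_minus[symmetric])
  qed
  \<comment> \<open>Affinities of product laws multiply, and Bernoulli's inequality turns the defect
    H per coordinate into at most n * H in total.\<close>
  have "ennreal (1 - real n * H) \<le> ennreal ((1 - H) ^ n)"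
    using Bernoulli_inequality[of "- H" n] H1 by (intro ennreal_leI) simp
  also have "\<dots> = ennreal (1 - H) ^ n" using H1 by (simp add: ennreal_power)
  also have "\<dots> \<le> \<rho> ^ n" by (intro power_mono \<rho>) simp
  also have "\<dots> = (\<integral>\<^sup>+x. ennreal (sqrt (?G 0 x * ?G ?e x)) \<partial>?B)" by (rule sq[symmetric])
  also have "\<dots> \<le> (\<integral>\<^sup>+x. (ennreal (?G 0 x) * ennreal (\<psi> x) + ennreal (?G ?e x) * ennreal (1 - \<psi> x)) + (ennreal (1/4) * ennreal (?G 0 x) + ennreal (1/4) * ennreal (?G ?e x)) \<partial>?B)"
  proof (rule nn_integral_mono)
    fix x assume "x \<in> space ?B"
    then have p: "0 \<le> \<psi> x" "\<psi> x \<le> 1" using \<psi>01 by (auto simp: spB)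
    have g: "?G 0 x \<ge> 0" "?G ?e x \<ge> 0" using G0 e by auto
    define X where "X = ?G 0 x"
    define Y where "Y = ?G ?e x"
    have XY: "X \<ge> 0" "Y \<ge> 0" using g by (auto simp: X_def Y_def)
    have "min X Y = min X Y * \<psi> x + min X Y * (1 - \<psi> x)" by (simp add: algebra_simps)
    also have "\<dots> \<le> X * \<psi> x + Y * (1 - \<psi> x)" using p by (intro add_mono mult_right_mono) auto
    finally have mn: "min X Y \<le> X * \<psi> x + Y * (1 - \<psi> x)" .
    have tr: "R \<le> A + (1/4 * X + 1/4 * Y)" if "m \<le> A" "R \<le> m + (X + Y) / 4" for m A R :: real
      using that by (simp add: add_divide_distrib)
    have "sqrt (X * Y) \<le> (X * \<psi> x + Y * (1 - \<psi> x)) + (1/4 * X + 1/4 * Y)"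
      by (rule tr[OF mn sqrt_mult_le_min[OF XY]])
    from ennreal_leI[OF this] p XY
    show "ennreal (sqrt (?G 0 x * ?G ?e x)) \<le> (ennreal (?G 0 x) * ennreal (\<psi> x) + ennreal (?G ?e x) * ennreal (1 - \<psi> x)) + (ennreal (1/4) * ennreal (?G 0 x) + ennreal (1/4) * ennreal (?G ?e x))"
      unfolding X_def[symmetric] Y_def[symmetric]
      by (simp add: ennreal_mult[symmetric] ennreal_plus[symmetric] del: ennreal_plus)
  qed
  also have "\<dots> = ((\<integral>\<^sup>+x. ennreal (?G 0 x) * ennreal (\<psi> x) \<partial>?B) + (\<integral>\<^sup>+x. ennreal (?G ?e x) * ennreal (1 - \<psi> x) \<partial>?B)) + (ennreal (1/4) * 1 + ennreal (1/4) * 1)"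
    by (subst nn_integral_add, measurable, subst nn_integral_add, measurable, subst nn_integral_add, measurable,
        subst nn_integral_cmult, measurable, subst nn_integral_cmult, measurable) (simp add: G1 e)
  also have "\<dots> \<le> (R0 + (R1 + ennreal (2 * exp (- (real n * \<epsilon>))))) + (ennreal (1/4) * 1 + ennreal (1/4) * 1)"
    by (intro add_mono A0 A1 order_refl)
  also have "\<dots> = test_error n p q \<psi> \<theta> \<eta> \<epsilon> + ennreal (2 * exp (- (real n * \<epsilon>)) + 1/2)"
  proof -
    have q4: "ennreal (1/4) * 1 + ennreal (1/4) * 1 = ennreal (1/2)"
      unfolding mult_1_right by (subst ennreal_plus[symmetric]) auto
    show ?thesis unfolding R q4 by (subst ennreal_plus, simp, simp, simp only: add.assoc)
  qed
  finally have main: "ennreal (1 - real n * H) \<le> test_error n p q \<psi> \<theta> \<eta> \<epsilon> + ennreal (2 * exp (- (real n * \<epsilon>)) + 1/2)" .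
  show ?thesis
  proof (cases "test_error n p q \<psi> \<theta> \<eta> \<epsilon>")
    case (real x)
    have "1 - real n * H \<le> x + (2 * exp (- (real n * \<epsilon>)) + 1/2)"
      using main real by (simp add: ennreal_plus[symmetric] del: ennreal_plus)
    then have "1/4 \<le> x" using H(2) by linarith
    then show ?thesis using real by (simp add: ennreal_leI)
  qed simp
qed

section \<open>Choice of the moment order above the boundary, and the conclusion\<close>

lemma lower_exponent:
  assumes "0 < \<beta>" "\<beta> < 1" "0 < r" "\<beta> > beta_star r"
  obtains w where "1 \<le> w" "w \<le> 2" "1 - \<beta> * w + r * (w\<^sup>2 - 1) < 0"
proof -
  consider "r \<le> 1/5" | "1/5 < r" "r < 1/2" | "r \<ge> 1/2" by linarith
  then show thesis
  proof cases
    case 1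
    then show ?thesis using assms by (intro that[of 2]) (auto simp: beta_star_def)
  next
    case 2
    define x where "x = sqrt r"
    define y where "y = sqrt (1 - r)"
    have x: "x > 0" "x\<^sup>2 = r" using assms by (auto simp: x_def)
    have y: "y > 0" "y\<^sup>2 = 1 - r" "y \<ge> x" using 2 by (auto simp: y_def x_def)
    have "y\<^sup>2 \<le> (2 * x)\<^sup>2" using 2 x y by (simp add: power_mult_distrib)
    then have y2: "y \<le> 2 * x" by (rule power2_le_imp_le) (use x in simp)
    have b: "\<beta> > 2 * (x * y)" using assms beta_star_middle[OF 2] by (simp add: x_def y_def)
    \<comment> \<open>The quadratic r * w^2 - \<beta> * w is minimal at \<beta> / (2 * r), and at
      the boundary value \<beta> = 2 * x * y this is y / x. It lies between 1 and 2 precisely for r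
      between 1/5 and 1/2, which explains the three regimes.\<close>
    define w where "w = y / x"
    have w: "w * x = y" "w\<^sup>2 * r = 1 - r" "w > 0" using x y by (auto simp: w_def power_divide)
    have "\<beta> * w > 2 * (x * y) * w" using b w(3) by (rule mult_strict_right_mono)
    also have "2 * (x * y) * w = 2 * y\<^sup>2" using w(1) by (simp add: power2_eq_square mult_ac)
    finally have "1 - \<beta> * w + r * (w\<^sup>2 - 1) < 0" using w(2) y(2) by (simp add: algebra_simps)
    moreover have "1 \<le> w" "w \<le> 2" using x y y2 by (auto simp: w_def field_simps)
    ultimately show ?thesis by (intro that) auto
  next
    case 3
    then have "beta_star r = 1" by (simp add: beta_star_def)
    then show ?thesis using assms by simp
  qed
qed

theorem minimax_error_liminf:
  fixes \<beta> r :: real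
  assumes b: "0 < \<beta>" "\<beta> < 1" and r: "0 < r"
    and eps: "\<And>n. n \<ge> 1 \<Longrightarrow> \<epsilon> n = real n powr (- \<beta>)"
    and th: "\<And>n. n \<ge> 1 \<Longrightarrow> euclid_norm (p n) (\<theta> n) = sqrt (r * ln (real n))"
    and et: "\<And>n. n \<ge> 1 \<Longrightarrow> euclid_norm (q n) (\<eta> n) = sqrt (r * ln (real n))"
    and gt: "\<beta> > beta_star r"
  shows "liminf (\<lambda>n. minimax_error n (p n) (q n) (\<theta> n) (\<eta> n) (\<epsilon> n)) > 0"
proof -
  obtain w where w: "1 \<le> w" "w \<le> 2" "1 - \<beta> * w + r * (w\<^sup>2 - 1) < 0"
    using lower_exponent[OF b r gt] by blast
  \<comment> \<open>n * H has order n^-y + n^-x, from the constant and the exponential part of H.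
    Positivity of x forces that of y because r * (w^2 - 1) \<ge> 0.\<close>
  define x where "x = - (1 - \<beta> * w + r * (w\<^sup>2 - 1))"
  define y where "y = - (1 - \<beta> * w)"
  have "1 \<le> w\<^sup>2" using w(1) by simp
  then have "r * (w\<^sup>2 - 1) \<ge> 0" using r by simp
  then have xy: "x > 0" "y > 0" using w(3) by (auto simp: x_def y_def)
  define C where "C = 4 powr w"
  have lim: "(\<lambda>n. C * (real n powr (- y) + 2 * real n powr (- x)) + 2 * exp (- (real n powr (1 - \<beta>)))) \<longlonglongrightarrow> 0"
  proof -
    define b' where "b' = 1 - \<beta>"
    have b': "b' > 0" using b by (simp add: b'_def)
    have l1: "(\<lambda>n. real n powr (- y)) \<longlonglongrightarrow> 0" using xy(2) by real_asymp
    have l2: "(\<lambda>n. real n powr (- x)) \<longlonglongrightarrow> 0" using xy(1) by real_asymp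
    have l3: "(\<lambda>n. exp (- (real n powr b'))) \<longlonglongrightarrow> 0" using b' by real_asymp
    have "(\<lambda>n. C * (real n powr (- y) + 2 * real n powr (- x)) + 2 * exp (- (real n powr b'))) \<longlonglongrightarrow> C * (0 + 2 * 0) + 2 * 0"
      by (intro tendsto_intros l1 l2 l3)
    then show ?thesis by (simp add: b'_def)
  qed
  have e1: "eventually (\<lambda>n. C * (real n powr (- y) + 2 * real n powr (- x)) + 2 * exp (- (real n powr (1 - \<beta>))) < 1/4) sequentially"
    using order_tendstoD(2)[OF lim, of "1/4"] by simp
  have "(\<lambda>n. real n powr (- \<beta>)) \<longlonglongrightarrow> 0" using b by real_asymp
  then have e2: "eventually (\<lambda>n. real n powr (- \<beta>) < 1/8) sequentially" by (rule order_tendstoD(2)) simp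
  have "eventually (\<lambda>n. ennreal (1/4) \<le> minimax_error n (p n) (q n) (\<theta> n) (\<eta> n) (\<epsilon> n)) sequentially"
    using eventually_ge_at_top[of "2::nat"] e1 e2
  proof eventually_elim
    case (elim n)
    define N where "N = real n"
    define s where "s = sqrt (r * ln N)"
    have n: "n \<ge> 1" "N > 1" using elim(1) by (auto simp: N_def)
    have s0: "s > 0" using r n by (simp add: s_def)
    have s: "euclid_norm (p n) (\<theta> n) = s" "euclid_norm (q n) (\<eta> n) = s" using th[OF n(1)] et[OF n(1)] by (simp_all add: s_def N_def)
    have ep: "\<epsilon> n = N powr (- \<beta>)" using eps[OF n(1)] by (simp add: N_def)
    define H where "H = (4 * \<epsilon> n) powr w * (1 + 2 * exp (s\<^sup>2 * (w\<^sup>2 - 1)))"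
    have "exp (s\<^sup>2 * (w\<^sup>2 - 1)) = N powr (r * (w\<^sup>2 - 1))"
      using n r by (simp add: s_def powr_def mult_ac)
    moreover have "(4 * \<epsilon> n) powr w = C * N powr (- \<beta> * w)" using n by (simp add: ep C_def powr_mult powr_powr)
    ultimately have "real n * H = C * (N * N powr (- \<beta> * w) + 2 * (N * (N powr (- \<beta> * w) * N powr (r * (w\<^sup>2 - 1)))))"
      by (simp add: H_def N_def algebra_simps)
    also have "N * N powr (- \<beta> * w) = N powr (- y)" using n by (simp add: y_def powr_mult_base)
    also have "N * (N powr (- \<beta> * w) * N powr (r * (w\<^sup>2 - 1))) = N powr (1 + (- \<beta> * w + r * (w\<^sup>2 - 1)))"
      using n by (simp only: powr_add) simp
    also have "1 + (- \<beta> * w + r * (w\<^sup>2 - 1)) = - x" by (simp add: x_def)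
    finally have nH: "real n * H = C * (N powr (- y) + 2 * N powr (- x))" .
    have "real n * \<epsilon> n = N powr (1 - \<beta>)" using n by (simp add: ep N_def[symmetric] powr_mult_base)
    then have bound: "real n * H + 2 * exp (- (real n * \<epsilon> n)) \<le> 1/4" using elim nH by (simp add: N_def)
    show ?case unfolding minimax_error_def
    proof (rule INF_greatest)
      fix \<psi> assume "\<psi> \<in> tests n (p n) (q n)"
      then show "ennreal (1/4) \<le> test_error n (p n) (q n) \<psi> (\<theta> n) (\<eta> n) (\<epsilon> n)"
        using elim ep by (intro test_error_lower[OF s s0 _ _ n(1) w(1,2) _ H_def bound]) (auto simp: N_def)
    qed
  qed
  then have "ennreal (1/4) \<le> liminf (\<lambda>n. minimax_error n (p n) (q n) (\<theta> n) (\<eta> n) (\<epsilon> n))"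
    by (rule Liminf_bounded)
  moreover have "0 < ennreal (1/4)" by simp
  ultimately show ?thesis by (rule less_le_trans[rotated])
qed

theorem theorem2p4:
  fixes \<beta> r \<delta> :: real
    and p q :: "nat \<Rightarrow> nat"
    and \<theta> \<eta> :: "nat \<Rightarrow> nat \<Rightarrow> real"
    and \<epsilon> :: "nat \<Rightarrow> real"
  assumes "0 < \<beta>" "\<beta> < 1" "0 < r" "0 < \<delta>"
    and "\<And>n. n \<ge> 1 \<Longrightarrow> \<epsilon> n = real n powr (- \<beta>)"
    and "\<And>n. n \<ge> 1 \<Longrightarrow> euclid_norm (p n) (\<theta> n) = sqrt (r * ln (real n))"
    and "\<And>n. n \<ge> 1 \<Longrightarrow> euclid_norm (q n) (\<eta> n) = sqrt (r * ln (real n))"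
  shows "(\<beta> < beta_star r \<longrightarrow>
            (\<lambda>n. test_error n (p n) (q n) (psi_check \<delta> n (p n) (q n) (\<theta> n) (\<eta> n))
                   (\<theta> n) (\<eta> n) (\<epsilon> n)) \<longlonglongrightarrow> 0) \<and>
         (\<beta> > beta_star r \<longrightarrow>
            liminf (\<lambda>n. minimax_error n (p n) (q n) (\<theta> n) (\<eta> n) (\<epsilon> n)) > 0)"
  using test_error_limit[OF assms] minimax_error_liminf[OF assms(1-3,5-7)] by blast

end
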